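(* Let $E$ be a Banach lattice with the Hardy--Littlewood property and let $\mu$ be a locally finite Borel measure on $\mathbb{R}^d$ such that $\mu(\mathbb{R}^d)=\infty$. Define $$q^*:=\sup\{q\in(1,\infty): E\text{ is }q\text{-convex}\}.$$ For $q\in[1,\infty)$, say that sparse domination holds for $q$ if there is a constant $C_{E,q}$ such that for each locally integrable function $f:\mathbb{R}^d\to E$ and each finite collection $\mathcal{D}$ of dyadic cubes there exists a sparse subcollection $\mathcal{S}\subseteq\mathcal{D}$ such that $$\bigl\|\widetilde{M}^\mu_{\mathcal{D}}f\bigr\|_E\leq C_{E,q}\,\mathcal{A}^\mu_{q,\mathcal{S}}(\|f\|_E)\qquad\mu\text{-a.e.}$$ Then sparse domination holds for all $q\in[1,q^* )$ and fails for all $q\in(q^*,\infty)$.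
   Context: Dyadic cubes are the cubes of the standard dyadic system on $\mathbb{R}^d$, i.e. $2^{-k}([0,1)^d+m)$ with $k\in\mathbb{Z}$, $m\in\mathbb{Z}^d$. Local integrability of $f:\mathbb{R}^d\to E$ is with respect to $\mu$, in the Bochner sense; $\|f\|_E$ denotes the scalar function $x\mapsto\|f(x)\|_E$. For a cube $Q$, $\langle f\rangle^\mu_Q:=\frac{1}{\mu(Q)}\int_Q f\,\mathrm{d}\mu$ (cubes of $\mu$-measure zero are irrelevant for the $\mu$-a.e. statement; take the average to be $0$ there). Dyadic lattice Hardy--Littlewood maximal operator: for a finite collection $\mathcal{D}$ of dyadic cubes and locally integrable $f:\mathbb{R}^d\to E$, $$\widetilde{M}^\mu_{\mathcal{D}}f(x):=\sup_{Q\in\mathcal{D}}\langle|f|\rangle^\mu_Q\mathbf{1}_Q(x),\qquad x\in\mathbb{R}^d,$$ where the supremum and the absolute value are taken in the lattice sense in $E$. Sparse collection: a subcollection $\mathcal{S}\subseteq\mathcal{D}$ is sparse (with respect to $\mu$) if for every $S\in\mathcal{S}$ there is a measurable subset $E_S\subseteq S$ with $\mu(E_S)\geq\frac12\mu(S)$ such that the sets $\{E_S\}_{S\in\mathcal{S}}$ are pairwise disjoint. Sparse operator: for $q\in[1,\infty)$, a sparse collection $\mathcal{S}$ of dyadic cubes and locally integrable $g:\mathbb{R}^d\to\mathbb{R}$, $$\mathcal{A}^\mu_{q,\mathcal{S}}g(x):=\Bigl(\sum_{S\in\mathcal{S}}\bigl(\langle|g|\rangle^\mu_S\bigr)^q\mathbf{1}_S(x)\Bigr)^{1/q}.$$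 Hardy--Littlewood property: $E$ has the Hardy--Littlewood property if for some $p\in(1,\infty)$, $$\sup_{\mathcal{D}}\bigl\|\widetilde{M}^{\mathrm{d}x}_{\mathcal{D}}\bigr\|_{L^p(\mathrm{d}x;E)\to L^p(\mathrm{d}x;E)}<\infty,$$ where the supremum is over all finite collections $\mathcal{D}$ of dyadic cubes in $\mathbb{R}^d$, $\mathrm{d}x$ is the Lebesgue measure on $\mathbb{R}^d$, and $L^p(\mathrm{d}x;E)$ is the Lebesgue--Bochner space. (It is a known fact that every Banach lattice with the Hardy--Littlewood property is $q$-convex for some $q>1$, so the set defining $q^*$ is nonempty.) $q$-convexity: a Banach lattice $E$ is $q$-convex, $q\in[1,\infty)$, if there is a constant $C$ (depending on $E$ and $q$) such that $$\Bigl\|\Bigl(\sum_{k=1}^n|e_k|^q\Bigr)^{1/q}\Bigr\|_E\leq C\Bigl(\sum_{k=1}^n\|e_k\|_E^q\Bigr)^{1/q}$$ for all $n\in\mathbb{N}$ and $e_1,\dots,e_n\in E$, where $\bigl(\sum_k|e_k|^q\bigr)^{1/q}$ is defined by the Krivine functional calculus (pointwise in a Banach function space). *)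

theory Defs
  imports "HOL-Analysis.Analysis" "HOL-Library.Lattice_Algebras"
begin

class banach_lattice = banach + ordered_real_vector + lattice_ab_group_add_abs +
  assumes norm_abs_mono: "\<bar>x\<bar> \<le> \<bar>y\<bar> \<Longrightarrow> norm x \<le> norm y"


section \<open>The Bochner integral for possibly non-separable range\<close>

text \<open>
  The Bochner integral of HOL-Analysis is confined to separable (second countable) range spaces.
  The following is the same construction, with Borel measurability replaced by
  strong measurability, for arbitrary normed spaces.
\<close>

definition strongly_measurable :: "'a measure \<Rightarrow> ('a \<Rightarrow> 'b::real_normed_vector) \<Rightarrow> bool" where
  "strongly_measurable M f \<longleftrightarrow>
     (\<exists>s. (\<forall>i. simple_function M (s i)) \<and> (AE x in M. (\<lambda>i. s i x) \<longlonglongrightarrow> f x))"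

definition has_strong_integral :: "'a measure \<Rightarrow> ('a \<Rightarrow> 'b::real_normed_vector) \<Rightarrow> 'b \<Rightarrow> bool" where
  "has_strong_integral M f I \<longleftrightarrow> strongly_measurable M f \<and>
     (\<exists>s. (\<forall>i. Bochner_Integration.simple_bochner_integrable M (s i)) \<and>
          (\<lambda>i. \<integral>\<^sup>+x. ennreal (norm (f x - s i x)) \<partial>M) \<longlonglongrightarrow> 0 \<and>
          (\<lambda>i. Bochner_Integration.simple_bochner_integral M (s i)) \<longlonglongrightarrow> I)"

definition strongly_integrable :: "'a measure \<Rightarrow> ('a \<Rightarrow> 'b::real_normed_vector) \<Rightarrow> bool" where
  "strongly_integrable M f \<longleftrightarrow> (\<exists>I. has_strong_integral M f I)"

definition strong_integral :: "'a measure \<Rightarrow> ('a \<Rightarrow> 'b::real_normed_vector) \<Rightarrow> 'b" where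
  "strong_integral M f = (THE I. has_strong_integral M f I)"

definition locally_integrable ::
    "'a::topological_space measure \<Rightarrow> ('a \<Rightarrow> 'b::real_normed_vector) \<Rightarrow> bool" where
  "locally_integrable M f \<longleftrightarrow>
     (\<forall>K. compact K \<longrightarrow> strongly_integrable M (\<lambda>x. indicator K x *\<^sub>R f x))"

definition locally_finite_measure :: "'a::topological_space measure \<Rightarrow> bool" where
  "locally_finite_measure M \<longleftrightarrow> (\<forall>x. \<exists>U. open U \<and> x \<in> U \<and> emeasure M U < \<infinity>)"

definition Lp_space :: "real \<Rightarrow> 'a measure \<Rightarrow> ('a \<Rightarrow> 'b::real_normed_vector) set" where
  "Lp_space p M =
     {f. strongly_measurable M f \<and> (\<integral>\<^sup>+x. ennreal (norm (f x) powr p) \<partial>M) < \<infinity>}"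

definition Lp_norm :: "real \<Rightarrow> 'a measure \<Rightarrow> ('a \<Rightarrow> 'b::real_normed_vector) \<Rightarrow> real" where
  "Lp_norm p M f = enn2real (\<integral>\<^sup>+x. ennreal (norm (f x) powr p) \<partial>M) powr (1 / p)"


section \<open>Dyadic cubes, maximal operator, sparse operator\<close>

definition dyadic_cubes :: "(real ^ 'd) set set" where
  "dyadic_cubes =
     {(\<lambda>x. 2 powi (- k) *\<^sub>R (x + (\<chi> i. of_int (m i)))) ` {x. \<forall>i. 0 \<le> x $ i \<and> x $ i < 1}
       | (k :: int) (m :: 'd \<Rightarrow> int). True}"

text \<open>Cubes of measure zero get average \<open>0\<close>, because \<open>1 / 0 = 0\<close>.\<close>

definition average :: "'a measure \<Rightarrow> 'a set \<Rightarrow> ('a \<Rightarrow> 'b::real_normed_vector) \<Rightarrow> 'b" where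
  "average M Q f = (1 / measure M Q) *\<^sub>R strong_integral M (\<lambda>x. indicator Q x *\<^sub>R f x)"

text \<open>
  All elements in the supremum are positive, so that inserting \<open>0\<close> only matters for the
  empty collection, whose maximal operator is \<open>0\<close>.
\<close>

definition lattice_maximal ::
    "'a measure \<Rightarrow> 'a set set \<Rightarrow> ('a \<Rightarrow> 'e::banach_lattice) \<Rightarrow> 'a \<Rightarrow> 'e" where
  "lattice_maximal M \<D> f x =
     Sup_fin (insert 0 ((\<lambda>Q. indicator Q x *\<^sub>R average M Q (\<lambda>y. \<bar>f y\<bar>)) ` \<D>))"

definition sparse :: "'a measure \<Rightarrow> 'a set set \<Rightarrow> bool" where
  "sparse M \<S> \<longleftrightarrow>
     (\<exists>E. (\<forall>S\<in>\<S>. E S \<in> sets M \<and> E S \<subseteq> S \<and> emeasure M (E S) \<ge> emeasure M S / 2) \<and>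
          disjoint_family_on E \<S>)"

definition sparse_operator ::
    "'a measure \<Rightarrow> real \<Rightarrow> 'a set set \<Rightarrow> ('a \<Rightarrow> real) \<Rightarrow> 'a \<Rightarrow> real" where
  "sparse_operator M q \<S> g x =
     (\<Sum>S\<in>\<S>. average M S (\<lambda>y. \<bar>g y\<bar>) powr q * indicator S x) powr (1 / q)"

definition hardy_littlewood_property :: "'e::banach_lattice itself \<Rightarrow> 'd::finite itself \<Rightarrow> bool" where
  "hardy_littlewood_property _ _ \<longleftrightarrow>
     (\<exists>p>1. \<exists>C. \<forall>\<D> \<subseteq> dyadic_cubes. finite \<D> \<longrightarrow>
        (\<forall>f :: real ^ 'd \<Rightarrow> 'e. f \<in> Lp_space p lborel \<longrightarrow>
           lattice_maximal lborel \<D> f \<in> Lp_space p lborel \<and>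
           Lp_norm p lborel (lattice_maximal lborel \<D> f) \<le> C * Lp_norm p lborel f))"


section \<open>Krivine functional calculus and convexity\<close>

text \<open>
  The continuous positively homogeneous functions on \<open>\<real>\<^sup>n\<close>, represented as functions of real
  sequences that depend on the first \<open>n\<close> coordinates only. For such functions continuity in the
  product topology is continuity on \<open>\<real>\<^sup>n\<close>.
\<close>

definition krivine_functions :: "nat \<Rightarrow> ((nat \<Rightarrow> real) \<Rightarrow> real) set" where
  "krivine_functions n =
     {h. continuous_on UNIV h \<and>
         (\<forall>c t. c \<ge> 0 \<longrightarrow> h (\<lambda>i. c * t i) = c * h t) \<and>
         (\<forall>t u. (\<forall>i<n. t i = u i) \<longrightarrow> h t = h u)}"

text \<open>
  The functional calculus of \<open>e 0, \<dots>, e (n - 1)\<close> is the unique lattice homomorphism from the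
  continuous positively homogeneous functions to the Banach lattice that sends
  the \<open>i\<close>-th coordinate function to \<open>e i\<close>. Its values outside \<open>krivine_functions n\<close> are irrelevant.
\<close>

definition is_krivine_calculus ::
    "nat \<Rightarrow> (nat \<Rightarrow> 'e::banach_lattice) \<Rightarrow> (((nat \<Rightarrow> real) \<Rightarrow> real) \<Rightarrow> 'e) \<Rightarrow> bool" where
  "is_krivine_calculus n e \<tau> \<longleftrightarrow>
     (\<forall>i<n. \<tau> (\<lambda>t. t i) = e i) \<and>
     (\<forall>g\<in>krivine_functions n. \<forall>h\<in>krivine_functions n. \<forall>a b :: real.
        \<tau> (\<lambda>t. a * g t + b * h t) = a *\<^sub>R \<tau> g + b *\<^sub>R \<tau> h) \<and>
     (\<forall>g\<in>krivine_functions n. \<forall>h\<in>krivine_functions n.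
        \<tau> (\<lambda>t. max (g t) (h t)) = sup (\<tau> g) (\<tau> h))"

definition krivine :: "nat \<Rightarrow> (nat \<Rightarrow> 'e::banach_lattice) \<Rightarrow> ((nat \<Rightarrow> real) \<Rightarrow> real) \<Rightarrow> 'e" where
  "krivine n e h = (THE y. \<exists>\<tau>. is_krivine_calculus n e \<tau> \<and> \<tau> h = y)"

definition q_convex :: "'e::banach_lattice itself \<Rightarrow> real \<Rightarrow> bool" where
  "q_convex _ q \<longleftrightarrow>
     (\<exists>C. \<forall>n. \<forall>e :: nat \<Rightarrow> 'e.
        norm (krivine n e (\<lambda>t. (\<Sum>k<n. \<bar>t k\<bar> powr q) powr (1 / q)))
          \<le> C * (\<Sum>k<n. norm (e k) powr q) powr (1 / q))"

definition convexity_exponent :: "'e::banach_lattice itself \<Rightarrow> ereal" where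
  "convexity_exponent E = (SUP q \<in> {q :: real. 1 < q \<and> q_convex E q}. ereal q)"

definition sparse_domination ::
    "'e::banach_lattice itself \<Rightarrow> (real ^ 'd) measure \<Rightarrow> real \<Rightarrow> real \<Rightarrow> bool" where
  "sparse_domination _ \<mu> q C \<longleftrightarrow>
     (\<forall>f :: real ^ 'd \<Rightarrow> 'e. \<forall>\<D> \<subseteq> dyadic_cubes. locally_integrable \<mu> f \<longrightarrow> finite \<D> \<longrightarrow>
        (\<exists>\<S> \<subseteq> \<D>. sparse \<mu> \<S> \<and>
           (AE x in \<mu>. norm (lattice_maximal \<mu> \<D> f x)
                          \<le> C * sparse_operator \<mu> q \<S> (\<lambda>y. norm (f y)) x)))"

end

theory Submission
  imports Defs
begin

text \<open>
  Both directions go through the upper estimate \<open>\<parallel>sup e\<^sub>k\<parallel> \<le> C (\<Sum> \<parallel>e\<^sub>k\<parallel>\<^sup>q)\<^sup>1\<^sup>/\<^sup>q\<close>. It follows from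
  \<open>q\<close>-convexity, and it implies \<open>r\<close>-convexity for all \<open>r < q\<close>, because the \<open>l\<^sup>r\<close>-mean of a family of
  vectors is controlled by expected suprema of independent samples of the family.

  Domination: the Hardy--Littlewood inequality for the Lebesgue measure passes to arbitrary measures,
  since the Bellman function of the dyadic problem is midpoint concave and nonnegative, hence concave,
  so that splittings with arbitrary weights are allowed. A change of measure gives the weak type
  \<open>(1,1)\<close> bound. Stop at the maximal cubes \<open>Q\<close> inside \<open>S\<close> for which the supremum of the averages of \<open>\<bar>f\<bar>\<close>
  over the cubes between \<open>Q\<close> and \<open>S\<close> has norm larger than a multiple of the average of \<open>\<parallel>f\<parallel>\<close> over \<open>S\<close>;
  the stopping cubes are sparse, and the upper estimate sums up the contributions of the different
  stopping cubes.

  Sharpness: in a space of infinite measure there are chains of cubes of rapidly growing measure.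
  Testing the domination on a function with value \<open>e\<^sub>k\<close> on the difference of the \<open>k\<close>-th cube and its predecessor
  gives the upper estimate. That some \<open>q > 1\<close> is admissible follows by iterating a nontrivial bound for the norm of a
  supremum of finitely many unit vectors, which the Hardy--Littlewood property provides.
\<close>

subsection \<open>Banach lattices\<close>

text \<open>The Hardy--Littlewood property concerns Lebesgue measure, where cubes split into equal
  parts, while a general measure splits them in arbitrary proportions, some of them zero. The two
  meet in a discrete problem: on binary trees the property becomes an inequality without geometry,
  and gluing two trees at a new root is exactly midpoint concavity of the best payoff. The constant
  \<open>K\<close> found there does not see the measure, which is why one constant serves every
  \<mu>. The comparison of the \<open>l^q\<close>-mean with expected suprema is an inequality
  between real numbers. To read it in a lattice one needs the functional calculus, and
  \<open>krivine\<close> is a mere description until existence and uniqueness are established; this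
  is why the calculus is built from scratch. The comparison costs a geometric series with ratio
  \<open>2 powr (1 / r - 1 / q)\<close>, so an upper estimate at \<open>r\<close> gives convexity
  strictly below \<open>r\<close> only. A supremum does not notice this loss, and only the critical
  exponent itself stays undecided. Some exponent above \<open>1\<close> must be exhibited: over an
  empty set the supremum would be minus infinity, and sharpness would then be claimed for every real
  \<open>q\<close>.\<close>

lemma norm_abs_lattice [simp]: "norm \<bar>x\<bar> = norm (x::'e::banach_lattice)"
  by (intro antisym norm_abs_mono) simp_all

lemma norm_mono_nonneg:
  "0 \<le> x \<Longrightarrow> x \<le> y \<Longrightarrow> norm x \<le> norm (y::'e::banach_lattice)"
  by (intro norm_abs_mono) (metis abs_of_nonneg order_trans)

lemma abs_sup_diff_le: "\<bar>sup x y - sup x z\<bar> \<le> \<bar>y - (z::'e::banach_lattice)\<bar>"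
proof -
  have *: "sup x y \<le> sup x z + \<bar>y - z\<bar>" for y z :: 'e
  proof (rule sup_least)
    show "x \<le> sup x z + \<bar>y - z\<bar>"
      by (metis abs_ge_zero add_increasing2 sup_ge1)
    have "y = z + (y - z)" by simp
    also have "\<dots> \<le> sup x z + \<bar>y - z\<bar>" by (intro add_mono sup_ge2 abs_ge_self)
    finally show "y \<le> sup x z + \<bar>y - z\<bar>" .
  qed
  have "sup x y - sup x z \<le> \<bar>y - z\<bar>"
    using *[of y z] by (simp only: diff_le_eq add.commute)
  moreover have "sup x z - sup x y \<le> \<bar>y - z\<bar>"
    using *[of z y] by (simp only: diff_le_eq add.commute abs_minus_commute)
  ultimately show ?thesis
    by (intro abs_leI) (simp_all only: minus_diff_eq)
qed

lemma norm_sup_diff_le: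
  "norm (sup a b - sup c d) \<le> norm (a - c) + norm (b - (d::'e::banach_lattice))"
proof -
  have "norm (sup a b - sup c d) \<le> norm (sup a b - sup a d) + norm (sup d a - sup d c)"
    by (metis diff_add_cancel norm_triangle_ineq sup_commute add_diff_eq)
  also have "norm (sup a b - sup a d) \<le> norm (b - d)"
    by (intro norm_abs_mono abs_sup_diff_le)
  also have "norm (sup d a - sup d c) \<le> norm (a - c)"
    by (intro norm_abs_mono abs_sup_diff_le)
  finally show ?thesis by simp
qed

lemma tendsto_sup_lattice:
  fixes f g :: "'i \<Rightarrow> 'e::banach_lattice"
  assumes "(f \<longlongrightarrow> a) F" "(g \<longlongrightarrow> b) F"
  shows "((\<lambda>x. sup (f x) (g x)) \<longlongrightarrow> sup a b) F"
proof (rule Lim_null_comparison[THEN LIM_zero_cancel])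
  show "\<forall>\<^sub>F x in F. norm (sup (f x) (g x) - sup a b) \<le> norm (f x - a) + norm (g x - b)"
    by (intro always_eventually allI norm_sup_diff_le)
  show "((\<lambda>x. norm (f x - a) + norm (g x - b)) \<longlongrightarrow> 0) F"
    using assms by (intro tendsto_eq_intros LIM_zero tendsto_norm_zero) auto
qed

lemma norm_abs_diff_le: "norm (\<bar>x\<bar> - \<bar>y\<bar>) \<le> norm (x - (y::'e::banach_lattice))"
proof (rule norm_abs_mono)
  show "\<bar>\<bar>x\<bar> - \<bar>y\<bar>\<bar> \<le> \<bar>x - y\<bar>" by (rule abs_triangle_ineq3)
qed

text \<open>The positive cone is closed, being the set of fixed points of the continuous map
  \<open>\<lambda>x. sup x 0\<close>.\<close>

lemma tendsto_nonneg_lattice: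
  fixes f :: "'i \<Rightarrow> 'e::banach_lattice"
  assumes "(f \<longlongrightarrow> a) F" "F \<noteq> bot" "\<And>x. 0 \<le> f x"
  shows "0 \<le> a"
proof -
  have "((\<lambda>x. sup (f x) 0) \<longlongrightarrow> sup a 0) F"
    by (intro tendsto_sup_lattice assms tendsto_const)
  moreover have "(\<lambda>x. sup (f x) 0) = f"
    using assms(3) by (simp add: fun_eq_iff sup_absorb1)
  ultimately have "sup a 0 = a"
    using assms tendsto_unique by metis
  thus ?thesis by (metis sup_ge2)
qed

lemma scaleR_sup:
  fixes x y :: "'e::banach_lattice"
  assumes "0 \<le> c"
  shows "c *\<^sub>R sup x y = sup (c *\<^sub>R x) (c *\<^sub>R y)"
proof (cases "c = 0")
  case False
  hence c: "c > 0" using assms by simp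
  show ?thesis
  proof (rule antisym)
    have "x \<le> (1/c) *\<^sub>R sup (c *\<^sub>R x) (c *\<^sub>R y)"
      using scaleR_left_mono[OF sup_ge1, of "1/c" "c *\<^sub>R x" "c *\<^sub>R y"] c by simp
    moreover have "y \<le> (1/c) *\<^sub>R sup (c *\<^sub>R x) (c *\<^sub>R y)"
      using scaleR_left_mono[OF sup_ge2, of "1/c" "c *\<^sub>R y" "c *\<^sub>R x"] c by simp
    ultimately have "sup x y \<le> (1/c) *\<^sub>R sup (c *\<^sub>R x) (c *\<^sub>R y)" by simp
    from scaleR_left_mono[OF this assms] c
    show "c *\<^sub>R sup x y \<le> sup (c *\<^sub>R x) (c *\<^sub>R y)" by simp
    show "sup (c *\<^sub>R x) (c *\<^sub>R y) \<le> c *\<^sub>R sup x y"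
      using assms by (intro sup_least scaleR_left_mono) auto
  qed
qed simp

lemma abs_scaleR_lattice: "\<bar>c *\<^sub>R x\<bar> = \<bar>c\<bar> *\<^sub>R \<bar>x::'e::banach_lattice\<bar>"
proof (cases "0 \<le> c")
  case True
  then show ?thesis by (simp add: abs_lattice[where 'a = 'e] scaleR_sup)
next
  case False
  hence "\<bar>-(c *\<^sub>R x)\<bar> = \<bar>c\<bar> *\<^sub>R \<bar>x\<bar>"
    using scaleR_sup[of "-c" x "-x"] unfolding abs_lattice[where 'a = 'e] by simp
  thus ?thesis by (metis abs_minus_cancel)
qed

text \<open>The supremum together with \<open>0\<close> makes sense for empty index sets and is the one that occurs
  in the maximal operator.\<close>

definition psup :: "('i \<Rightarrow> 'e::banach_lattice) \<Rightarrow> 'i set \<Rightarrow> 'e" where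
  "psup f A = Sup_fin (insert 0 (f ` A))"

lemma psup_empty [simp]: "psup f {} = 0"
  by (simp add: psup_def)

lemma psup_nonneg: "finite A \<Longrightarrow> 0 \<le> psup f A"
  unfolding psup_def by (intro Sup_fin.coboundedI) auto

lemma psup_upper: "finite A \<Longrightarrow> i \<in> A \<Longrightarrow> f i \<le> psup f A"
  unfolding psup_def by (intro Sup_fin.coboundedI) auto

lemma psup_least:
  "finite A \<Longrightarrow> 0 \<le> y \<Longrightarrow> (\<And>i. i \<in> A \<Longrightarrow> f i \<le> y) \<Longrightarrow> psup f A \<le> y"
  unfolding psup_def by (intro Sup_fin.boundedI) auto

lemma psup_insert: "finite A \<Longrightarrow> psup f (insert i A) = sup (f i) (psup f A)"
  unfolding psup_def image_insert by (subst insert_commute, subst Sup_fin.insert) auto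

lemma psup_mono:
  assumes "finite B" "A \<subseteq> B" "\<And>i. i \<in> A \<Longrightarrow> f i \<le> g i"
  shows "psup f A \<le> psup g B"
proof (intro psup_least psup_nonneg)
  show "f i \<le> psup g B" if "i \<in> A" for i
    using assms(3)[OF that] psup_upper[OF assms(1), of i g] assms(2) that by (blast intro: order_trans)
qed (use assms in \<open>auto intro: finite_subset\<close>)

lemma psup_cong: "(\<And>i. i \<in> A \<Longrightarrow> f i = g i) \<Longrightarrow> psup f A = psup g A"
  unfolding psup_def by (auto intro!: arg_cong[where f = Sup_fin])

lemma psup_reindex: "psup f (h ` A) = psup (f \<circ> h) A"
  by (simp add: psup_def image_comp)

lemma norm_psup_mono:
  assumes "finite B" "A \<subseteq> B" "\<And>i. i \<in> A \<Longrightarrow> f i \<le> g i"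
  shows "norm (psup f A) \<le> norm (psup g B)"
  using assms by (intro norm_mono_nonneg psup_mono psup_nonneg) (auto intro: finite_subset)

lemma psup_scaleR:
  assumes "0 \<le> c" "finite A"
  shows "psup (\<lambda>i. c *\<^sub>R f i) A = c *\<^sub>R psup f A"
  using assms(2) by induction (simp_all add: psup_insert scaleR_sup assms(1))

text \<open>The classical upper \<open>r\<close>-estimate. It contains the familiar version for
  disjoint vectors, because the supremum of disjoint positive vectors is their sum.\<close>

definition upper_estimate :: "'e::banach_lattice itself \<Rightarrow> real \<Rightarrow> real \<Rightarrow> bool" where
  "upper_estimate _ r C \<longleftrightarrow>
     (\<forall>n. \<forall>e :: nat \<Rightarrow> 'e. (\<forall>i<n. 0 \<le> e i) \<longrightarrow>
        norm (psup e {..<n}) \<le> C * (\<Sum>i<n. norm (e i) powr r) powr (1 / r))"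

lemma upper_estimateD:
  fixes e :: "'i \<Rightarrow> 'e::banach_lattice"
  assumes "upper_estimate TYPE('e) r C" "finite A" "\<And>i. i \<in> A \<Longrightarrow> 0 \<le> e i"
  shows "norm (psup e A) \<le> C * (\<Sum>i\<in>A. norm (e i) powr r) powr (1 / r)"
proof -
  obtain h where h: "bij_betw h {..<card A} A"
    using ex_bij_betw_nat_finite[OF assms(2)] by (auto simp: atLeast0LessThan)
  have A: "A = h ` {..<card A}" using h by (simp add: bij_betw_def)
  have h_mem: "h i \<in> A" if "i < card A" for i
    using h that by (auto simp: bij_betw_def)
  have "norm (psup (e \<circ> h) {..<card A}) \<le> C * (\<Sum>i<card A. norm ((e \<circ> h) i) powr r) powr (1 / r)"
    using assms(3) h_mem by (intro assms(1)[unfolded upper_estimate_def, rule_format]) simp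
  also have "psup (e \<circ> h) {..<card A} = psup e A"
    using psup_reindex[of e h "{..<card A}"] A by metis
  also have "(\<Sum>i<card A. norm ((e \<circ> h) i) powr r) = (\<Sum>i\<in>A. norm (e i) powr r)"
    using sum.reindex_bij_betw[OF h, of "\<lambda>i. norm (e i) powr r"] by simp
  finally show ?thesis .
qed

subsection \<open>Krivine functional calculus\<close>

text \<open>Lets one and the same linear form or finite supremum be read on real tuples and on
  lattice vectors; the transfer of inequalities compares these two readings.\<close>

instance real :: banach_lattice
  by standard (simp_all add: sup_max abs_real_def)

text \<open>The choice of the eliminated variable in one Fourier--Motzkin step. Either side may be
  empty, when no form has a coefficient of that sign.\<close>

lemma exists_between_finite:
  fixes L U :: "real set"
  assumes "finite L" "finite U" "\<And>l u. l \<in> L \<Longrightarrow> u \<in> U \<Longrightarrow> l < u"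
  shows "\<exists>s. (\<forall>l\<in>L. l < s) \<and> (\<forall>u\<in>U. s < u)"
proof (cases "L = {} \<or> U = {}")
  case True
  then show ?thesis
  proof
    assume "L = {}"
    moreover have "\<exists>s. \<forall>u\<in>U. s < u"
    proof (cases "U = {}")
      case False
      then show ?thesis using Min_le[OF assms(2)] by (intro exI[of _ "Min U - 1"]) force
    qed auto
    ultimately show ?thesis by auto
  next
    assume "U = {}"
    moreover have "\<exists>s. \<forall>l\<in>L. l < s"
    proof (cases "L = {}")
      case False
      then show ?thesis using assms(1)
        by (intro exI[of _ "Max L + 1"]) (auto intro: le_less_trans[OF Max_ge])
    qed auto
    ultimately show ?thesis by auto
  qed
next
  case False
  hence "Max L < Min U" using assms by auto
  then obtain s where "Max L < s" "s < Min U" using dense by blast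
  thus ?thesis using False assms by (intro exI[of _ s]) auto
qed

definition lin :: "nat \<Rightarrow> (nat \<Rightarrow> real) \<Rightarrow> (nat \<Rightarrow> 'e::banach_lattice) \<Rightarrow> 'e" where
  "lin n a e = (\<Sum>k<n. a k *\<^sub>R e k)"

lemma lin_Suc: "lin (Suc n) a e = lin n a e + a n *\<^sub>R e n"
  by (simp add: lin_def)

lemma lin_combine: "lin n (\<lambda>k. r * a k + s * b k) e = r *\<^sub>R lin n a e + s *\<^sub>R lin n b e"
  by (simp add: lin_def scaleR_add_left scaleR_sum_right sum.distrib)

text \<open>Gordan's alternative, transferred to a lattice by Fourier--Motzkin elimination.\<close>

lemma lattice_gordan:
  fixes e :: "nat \<Rightarrow> 'e::banach_lattice"
  assumes "finite A" "A \<noteq> {}"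
    and "\<And>t. \<exists>a\<in>A. 0 \<le> lin n a (t :: nat \<Rightarrow> real)"
    and "\<And>a. a \<in> A \<Longrightarrow> lin n a e \<le> y"
  shows "0 \<le> y"
  using assms
proof (induction n arbitrary: A)
  case 0
  then show ?case by (auto simp: lin_def)
next
  case (Suc n)
  define P where "P = {a\<in>A. a n > 0}"
  define N where "N = {a\<in>A. a n < 0}"
  define Z where "Z = {a\<in>A. a n = 0}"
  \<comment> \<open>The convex combination of a form with positive and a form with negative last
    coefficient in which the last variable cancels. Being convex, it inherits the upper bound
    \<open>y\<close>.\<close>
  define comb where "comb = (\<lambda>(a, b) k. (a n / (a n - b n)) * b k + (- b n / (a n - b n)) * (a k :: real))"
  define A' where "A' = Z \<union> comb ` (P \<times> N)"
  have fin: "finite P" "finite N" "finite Z" "finite A'"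
    using Suc.prems(1) by (auto simp: P_def N_def Z_def A'_def)
  have comb_n: "comb (a, b) n = 0" for a b
    by (simp add: comb_def)
  \<comment> \<open>If all eliminated forms were negative at \<open>t\<close>, a last coordinate
    \<open>s\<close> could be chosen that makes every form of \<open>A\<close> negative. An empty
    \<open>A'\<close> is refuted in the same way, the condition on \<open>t\<close> being
    vacuous.\<close>
  have main: "A' \<noteq> {} \<and> (\<forall>t. \<exists>a\<in>A'. 0 \<le> lin n a (t :: nat \<Rightarrow> real))"
  proof (rule ccontr)
    assume "\<not> ?thesis"
    then obtain t :: "nat \<Rightarrow> real" where t: "\<And>a. a \<in> A' \<Longrightarrow> lin n a t < 0"
      by (metis empty_iff not_le)
    have "\<exists>s. (\<forall>l\<in>(\<lambda>b. - lin n b t / b n) ` N. l < s) \<and> (\<forall>u\<in>(\<lambda>a. - lin n a t / a n) ` P. s < u)"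
    proof (rule exists_between_finite)
      fix l u assume "l \<in> (\<lambda>b. - lin n b t / b n) ` N" "u \<in> (\<lambda>a. - lin n a t / a n) ` P"
      then obtain a b where ab: "a \<in> P" "b \<in> N" "l = - lin n b t / b n" "u = - lin n a t / a n"
        by auto
      have pos: "a n > 0" "b n < 0" using ab by (auto simp: P_def N_def)
      have "lin n (comb (a, b)) t < 0" using ab by (intro t) (auto simp: A'_def)
      hence "(a n / (a n - b n)) * lin n b t + (- b n / (a n - b n)) * lin n a t < 0"
        by (simp only: comb_def prod.case lin_combine real_scaleR_def)
      hence "(a n * lin n b t - b n * lin n a t) / (a n - b n) < 0"
        by (simp add: diff_divide_distrib)
      hence "a n * lin n b t < b n * lin n a t"
        using pos by (simp add: divide_less_0_iff)
      moreover have "l * b n = - lin n b t" "u * a n = - lin n a t"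
        using pos ab(3,4) by simp_all
      ultimately have "a n * (- (l * b n)) < b n * (- (u * a n))" by simp
      hence "(- (a n * b n)) * l < (- (a n * b n)) * u" by (simp add: mult_ac)
      moreover have "- (a n * b n) > 0" using pos by (simp add: mult_less_0_iff)
      ultimately show "l < u" by (metis mult_less_cancel_left_pos)
    qed (use fin in auto)
    then obtain s where s: "\<And>b. b \<in> N \<Longrightarrow> - lin n b t / b n < s" "\<And>a. a \<in> P \<Longrightarrow> s < - lin n a t / a n"
      by auto
    define t' where "t' = t(n := s)"
    have lt': "lin (Suc n) a t' = lin n a t + a n * s" for a
    proof -
      have "lin n a t' = lin n a t" by (auto simp: lin_def t'_def intro!: sum.cong)
      thus ?thesis by (simp add: lin_Suc t'_def)
    qed
    obtain a where a: "a \<in> A" "0 \<le> lin (Suc n) a t'" using Suc.prems(3) by blast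
    consider "a n = 0" | "a n > 0" | "a n < 0" by linarith
    then show False
    proof cases
      case 1
      hence "a \<in> A'" using a by (auto simp: A'_def Z_def)
      then show ?thesis using t[of a] a 1 lt'[of a] by simp
    next
      case 2
      hence "a \<in> P" using a by (auto simp: P_def)
      from s(2)[OF this] 2 a lt'[of a] show ?thesis by (simp add: field_simps)
    next
      case 3
      hence "a \<in> N" using a by (auto simp: N_def)
      from s(1)[OF this] 3 a lt'[of a] show ?thesis by (simp add: field_simps)
    qed
  qed
  show ?case
  proof (rule Suc.IH[of A'])
    show "lin n a e \<le> y" if "a \<in> A'" for a
    proof -
      from that consider "a \<in> Z" | b c where "b \<in> P" "c \<in> N" "a = comb (b, c)"
        by (auto simp: A'_def)
      then show ?thesis
      proof cases
        case 1
        then show ?thesis using Suc.prems(4)[of a] by (simp add: Z_def lin_Suc)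
      next
        case 2
        have pos: "b n > 0" "c n < 0" and mem: "b \<in> A" "c \<in> A" using 2 by (auto simp: P_def N_def)
        have "lin n a e = lin (Suc n) a e" using comb_n 2 by (simp add: lin_Suc)
        also have "\<dots> = (b n / (b n - c n)) *\<^sub>R lin (Suc n) c e + (- c n / (b n - c n)) *\<^sub>R lin (Suc n) b e"
          unfolding 2 comb_def prod.case by (rule lin_combine)
        also have "\<dots> \<le> (b n / (b n - c n)) *\<^sub>R y + (- c n / (b n - c n)) *\<^sub>R y"
          using pos mem by (intro add_mono scaleR_left_mono Suc.prems) (auto simp: divide_le_0_iff)
        also have "\<dots> = ((b n - c n) / (b n - c n)) *\<^sub>R y"
          by (simp only: scaleR_add_left[symmetric] add_divide_distrib[symmetric]) simp
        also have "\<dots> = y" using pos by simp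
        finally show ?thesis .
      qed
    qed
  qed (use fin main in auto)
qed

section \<open>Differences of finite suprema of linear forms\<close>

definition supl :: "nat \<Rightarrow> (nat \<Rightarrow> real) set \<Rightarrow> (nat \<Rightarrow> 'e::banach_lattice) \<Rightarrow> 'e" where
  "supl n P e = Sup_fin ((\<lambda>a. lin n a e) ` P)"

lemma supl_upper: "finite P \<Longrightarrow> a \<in> P \<Longrightarrow> lin n a e \<le> supl n P e"
  unfolding supl_def by (intro Sup_fin.coboundedI) auto

lemma supl_least:
  "finite P \<Longrightarrow> P \<noteq> {} \<Longrightarrow> (\<And>a. a \<in> P \<Longrightarrow> lin n a e \<le> y) \<Longrightarrow> supl n P e \<le> y"
  unfolding supl_def by (intro Sup_fin.boundedI) auto

lemma supl_Un:
  "\<lbrakk>finite P; P \<noteq> {}; finite Q; Q \<noteq> {}\<rbrakk> \<Longrightarrow> supl n (P \<union> Q) e = sup (supl n P e) (supl n Q e)"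
  by (simp add: supl_def image_Un Sup_fin.union)

definition plus_set :: "(nat \<Rightarrow> real) set \<Rightarrow> (nat \<Rightarrow> real) set \<Rightarrow> (nat \<Rightarrow> real) set" where
  "plus_set P Q = (\<lambda>(a, b) k. a k + b k) ` (P \<times> Q)"

lemma plus_set_finite [simp]: "finite P \<Longrightarrow> finite Q \<Longrightarrow> finite (plus_set P Q)"
  by (simp add: plus_set_def)

lemma plus_set_nonempty [simp]: "P \<noteq> {} \<Longrightarrow> Q \<noteq> {} \<Longrightarrow> plus_set P Q \<noteq> {}"
  by (simp add: plus_set_def)

lemma lin_add: "lin n (\<lambda>k. a k + b k) e = lin n a e + lin n b e"
  using lin_combine[of n 1 a 1 b e] by simp

lemma lin_diff: "lin n (\<lambda>k. a k - b k) e = lin n a e - lin n b e"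
  using lin_combine[of n 1 a "-1" b e] by simp

lemma supl_add:
  assumes "finite P" "P \<noteq> {}" "finite Q" "Q \<noteq> {}"
  shows "supl n (plus_set P Q) e = supl n P e + supl n Q e"
proof (rule antisym)
  show "supl n (plus_set P Q) e \<le> supl n P e + supl n Q e"
    using assms by (intro supl_least) (auto simp: plus_set_def lin_add intro!: add_mono supl_upper)
  have "supl n P e \<le> supl n (plus_set P Q) e - supl n Q e"
  proof (rule supl_least[OF assms(1,2)])
    fix a assume a: "a \<in> P"
    have "supl n Q e \<le> supl n (plus_set P Q) e - lin n a e"
    proof (rule supl_least[OF assms(3,4)])
      fix b assume "b \<in> Q"
      hence "lin n (\<lambda>k. a k + b k) e \<le> supl n (plus_set P Q) e"
        using a assms by (intro supl_upper) (auto simp: plus_set_def)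
      thus "lin n b e \<le> supl n (plus_set P Q) e - lin n a e"
        by (simp add: lin_add le_diff_eq add.commute)
    qed
    thus "lin n a e \<le> supl n (plus_set P Q) e - supl n Q e"
      by (simp add: le_diff_eq add.commute)
  qed
  thus "supl n P e + supl n Q e \<le> supl n (plus_set P Q) e"
    by (simp add: le_diff_eq)
qed

lemma supl_scale:
  assumes "finite P" "P \<noteq> {}" "0 \<le> c"
  shows "supl n ((\<lambda>a k. c * a k) ` P) e = c *\<^sub>R supl n P e"
  using assms(1,2)
proof (induction rule: finite_ne_induct)
  case (singleton a)
  then show ?case using lin_combine[of n c a 0 a e] by (simp add: supl_def)
next
  case (insert a P)
  have "supl n ((\<lambda>a k. c * a k) ` insert a P) e
      = sup (lin n (\<lambda>k. c * a k) e) (supl n ((\<lambda>a k. c * a k) ` P) e)"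
    using insert by (simp add: supl_def)
  also have "\<dots> = c *\<^sub>R sup (lin n a e) (supl n P e)"
    using insert lin_combine[of n c a 0 a e] assms(3) by (simp add: scaleR_sup)
  also have "sup (lin n a e) (supl n P e) = supl n (insert a P) e"
    using insert by (simp add: supl_def)
  finally show ?case .
qed

text \<open>\<open>lattice_term n e F x\<close>: some lattice-linear expression in \<open>n\<close> variables takes the value \<open>F\<close> on
  the coordinate functions and the value \<open>x\<close> on \<open>e\<close>. Every such expression is a difference of two
  finite suprema of linear forms.\<close>

definition lattice_term :: "nat \<Rightarrow> (nat \<Rightarrow> 'e::banach_lattice) \<Rightarrow> ((nat \<Rightarrow> real) \<Rightarrow> real) \<Rightarrow> 'e \<Rightarrow> bool" where
  "lattice_term n e F x \<longleftrightarrow> (\<exists>P Q. finite P \<and> P \<noteq> {} \<and> finite Q \<and> Q \<noteq> {} \<and>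
     F = (\<lambda>t. supl n P t - supl n Q t) \<and> x = supl n P e - supl n Q e)"

lemma lattice_termI:
  assumes "finite P" "P \<noteq> {}" "finite Q" "Q \<noteq> {}"
    "\<And>t. F t = supl n P t - supl n Q t" "x = supl n P e - supl n Q e"
  shows "lattice_term n e F x"
  using assms unfolding lattice_term_def by blast

lemma lin_unit: "i < n \<Longrightarrow> lin n (\<lambda>k. if k = i then 1 else 0) e = e i"
proof -
  have "lin n (\<lambda>k. if k = i then 1 else 0) e = (\<Sum>k<n. if k = i then e k else 0)"
    unfolding lin_def by (intro sum.cong) auto
  thus "i < n \<Longrightarrow> ?thesis" by simp
qed

lemma lin_zero: "lin n (\<lambda>k. 0) e = 0"
  by (simp add: lin_def)

lemma lattice_term_coord: "i < n \<Longrightarrow> lattice_term n e (\<lambda>t. t i) (e i)"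
  by (rule lattice_termI[of "{\<lambda>k. if k = i then 1 else 0}" "{\<lambda>k. 0}"])
    (simp_all add: supl_def lin_unit lin_zero)

lemma lattice_term_zero: "lattice_term n e (\<lambda>t. 0) 0"
  by (rule lattice_termI[of "{\<lambda>k. 0}" "{\<lambda>k. 0}"]) auto

lemma lattice_term_add:
  assumes "lattice_term n e F x" "lattice_term n e G y"
  shows "lattice_term n e (\<lambda>t. F t + G t) (x + y)"
proof -
  obtain P Q P' Q' where *: "finite P" "P \<noteq> {}" "finite Q" "Q \<noteq> {}" "finite P'" "P' \<noteq> {}" "finite Q'" "Q' \<noteq> {}"
    "F = (\<lambda>t. supl n P t - supl n Q t)" "x = supl n P e - supl n Q e"
    "G = (\<lambda>t. supl n P' t - supl n Q' t)" "y = supl n P' e - supl n Q' e"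
    using assms unfolding lattice_term_def by blast
  show ?thesis
    by (rule lattice_termI[of "plus_set P P'" "plus_set Q Q'"]) (simp_all add: * supl_add)
qed

lemma lattice_term_uminus:
  assumes "lattice_term n e F x"
  shows "lattice_term n e (\<lambda>t. - F t) (- x)"
proof -
  obtain P Q where *: "finite P" "P \<noteq> {}" "finite Q" "Q \<noteq> {}"
    "F = (\<lambda>t. supl n P t - supl n Q t)" "x = supl n P e - supl n Q e"
    using assms unfolding lattice_term_def by blast
  show ?thesis
    by (rule lattice_termI[of Q P]) (simp_all add: *)
qed

lemma lattice_term_scale:
  assumes "lattice_term n e F x"
  shows "lattice_term n e (\<lambda>t. c * F t) (c *\<^sub>R x)"
proof -
  have *: "lattice_term n e (\<lambda>t. c * F t) (c *\<^sub>R x)" if c: "0 \<le> c" and F: "lattice_term n e F x" for c F x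
  proof -
    obtain P Q where *: "finite P" "P \<noteq> {}" "finite Q" "Q \<noteq> {}"
      "F = (\<lambda>t. supl n P t - supl n Q t)" "x = supl n P e - supl n Q e"
      using F unfolding lattice_term_def by blast
    show ?thesis
      by (rule lattice_termI[of "(\<lambda>a k. c * a k) ` P" "(\<lambda>a k. c * a k) ` Q"])
        (simp_all add: * c supl_scale right_diff_distrib scaleR_diff_right)
  qed
  show ?thesis
  proof (cases "0 \<le> c")
    case True
    then show ?thesis using * assms by blast
  next
    case False
    then show ?thesis using *[of "-c", OF _ lattice_term_uminus[OF assms]] by simp
  qed
qed

lemma lattice_term_diff:
  assumes "lattice_term n e F x" "lattice_term n e G y"
  shows "lattice_term n e (\<lambda>t. F t - G t) (x - y)"
  using lattice_term_add[OF assms(1) lattice_term_uminus[OF assms(2)]] by simp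

text \<open>Brings two differences to the common subtrahend \<open>q + q'\<close>; this is how
  lattice terms stay closed under \<open>sup\<close>.\<close>

lemma sup_diff_diff:
  "sup (p - q) (p' - q') = sup (p + q') (p' + q) - (q + (q'::'e::lattice_ab_group_add))"
proof -
  have "p - q + (q + q') = p + q'" "p' - q' + (q + q') = p' + q" by (simp_all add: algebra_simps)
  hence "sup (p - q) (p' - q') + (q + q') = sup (p + q') (p' + q)"
    by (simp only: add_sup_distrib_right)
  thus ?thesis by (simp only: eq_diff_eq)
qed

lemma lattice_term_max:
  assumes "lattice_term n e F x" "lattice_term n e G y"
  shows "lattice_term n e (\<lambda>t. max (F t) (G t)) (sup x y)"
proof -
  obtain P Q P' Q' where *: "finite P" "P \<noteq> {}" "finite Q" "Q \<noteq> {}" "finite P'" "P' \<noteq> {}" "finite Q'" "Q' \<noteq> {}"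
    "F = (\<lambda>t. supl n P t - supl n Q t)" "x = supl n P e - supl n Q e"
    "G = (\<lambda>t. supl n P' t - supl n Q' t)" "y = supl n P' e - supl n Q' e"
    using assms unfolding lattice_term_def by blast
  show ?thesis
  proof (rule lattice_termI[of "plus_set P Q' \<union> plus_set P' Q" "plus_set Q Q'"])
    show "max (F t) (G t) = supl n (plus_set P Q' \<union> plus_set P' Q) t - supl n (plus_set Q Q') t" for t
      using * sup_diff_diff[of "supl n P t" "supl n Q t" "supl n P' t" "supl n Q' t"]
      by (simp add: supl_Un supl_add sup_max)
    show "sup x y = supl n (plus_set P Q' \<union> plus_set P' Q) e - supl n (plus_set Q Q') e"
      using * by (simp add: supl_Un supl_add sup_diff_diff)
  qed (use * in auto)
qed

lemma lattice_term_abs: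
  assumes "lattice_term n e F x"
  shows "lattice_term n e (\<lambda>t. \<bar>F t\<bar>) \<bar>x\<bar>"
proof -
  have "(\<lambda>t. \<bar>F t\<bar>) = (\<lambda>t. max (F t) (- F t))" by (auto simp: fun_eq_iff abs_real_def)
  thus ?thesis
    using lattice_term_max[OF assms lattice_term_uminus[OF assms]] by (simp add: abs_lattice)
qed

lemma lattice_term_sum:
  assumes "\<And>i. i \<in> I \<Longrightarrow> lattice_term n e (F i) (x i)"
  shows "lattice_term n e (\<lambda>t. \<Sum>i\<in>I. F i t) (\<Sum>i\<in>I. x i)"
  using assms
  by (induction I rule: infinite_finite_induct) (auto intro: lattice_term_zero lattice_term_add)

lemma lattice_term_min:
  assumes "lattice_term n e F x" "lattice_term n e G y"
  shows "\<exists>z. lattice_term n e (\<lambda>t. min (F t) (G t)) z"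
proof -
  have "(\<lambda>t. min (F t) (G t)) = (\<lambda>t. - max (- F t) (- G t))" by (auto simp: fun_eq_iff)
  thus ?thesis
    using lattice_term_uminus[OF lattice_term_max[OF lattice_term_uminus[OF assms(1)] lattice_term_uminus[OF assms(2)]]]
    by auto
qed

text \<open>The transfer principle. Nonnegativity of \<open>F\<close> says that at every real tuple
  each form \<open>b\<close> of \<open>Q\<close> lies below some form of \<open>P\<close>; Gordan's
  alternative for the differences \<open>a - b\<close> then puts \<open>lin n b e\<close> below
  \<open>supl n P e\<close>. Applied to differences, it also shows that \<open>F\<close> determines
  the value \<open>x\<close>.\<close>

lemma lattice_term_nonneg:
  assumes "lattice_term n e F x" "\<And>t. 0 \<le> F t"
  shows "0 \<le> x"
proof -
  obtain P Q where *: "finite P" "P \<noteq> {}" "finite Q" "Q \<noteq> {}"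
    "F = (\<lambda>t. supl n P t - supl n Q t)" "x = supl n P e - supl n Q e"
    using assms unfolding lattice_term_def by blast
  have "supl n Q e \<le> supl n P e"
  proof (rule supl_least[OF *(3,4)])
    fix b assume b: "b \<in> Q"
    have "0 \<le> supl n P e - lin n b e"
    proof (rule lattice_gordan[of "(\<lambda>a k. a k - b k) ` P" n e])
      show "\<exists>a\<in>(\<lambda>a k. a k - b k) ` P. 0 \<le> lin n a t" for t :: "nat \<Rightarrow> real"
      proof -
        have "lin n b t \<le> supl n P t" using supl_upper[OF *(3) b, of n t] assms(2)[of t] * by simp
        \<comment> \<open>On real tuples a finite supremum is attained by a single form. In a
          lattice this fails, hence the detour through the alternative.\<close>
        moreover have "supl n P t \<in> (\<lambda>a. lin n a t) ` P"
          unfolding supl_def using * by (subst Sup_fin_Max) (auto intro!: Max_in)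
        ultimately show ?thesis by (force simp: lin_diff)
      qed
      show "lin n a e \<le> supl n P e - lin n b e" if "a \<in> (\<lambda>a k. a k - b k) ` P" for a
        using that * by (auto simp: lin_diff intro!: diff_right_mono supl_upper)
    qed (use * in auto)
    thus "lin n b e \<le> supl n P e" by simp
  qed
  thus ?thesis using * by simp
qed

lemma lattice_term_mono:
  assumes "lattice_term n e F x" "lattice_term n e G y" "\<And>t. F t \<le> G t"
  shows "x \<le> y"
  using lattice_term_nonneg[OF lattice_term_diff[OF assms(2,1)]] assms(3) by simp

section \<open>Continuous positively homogeneous functions and the density of lattice terms\<close>

lemma continuous_on_lin: "continuous_on UNIV (lin n a :: (nat \<Rightarrow> real) \<Rightarrow> real)"
  unfolding lin_def by (intro continuous_intros continuous_on_product_coordinates)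

lemma krivine_functionsI:
  assumes "continuous_on UNIV h" "\<And>c t. 0 \<le> c \<Longrightarrow> h (\<lambda>i. c * t i) = c * h t"
    "\<And>t u. (\<And>i. i < n \<Longrightarrow> t i = u i) \<Longrightarrow> h t = h u"
  shows "h \<in> krivine_functions n"
  using assms unfolding krivine_functions_def by blast

lemma krivine_functionsD:
  assumes "h \<in> krivine_functions n"
  shows "continuous_on UNIV h" "\<And>c t. 0 \<le> c \<Longrightarrow> h (\<lambda>i. c * t i) = c * h t"
    "\<And>t u. (\<And>i. i < n \<Longrightarrow> t i = u i) \<Longrightarrow> h t = h u"
  using assms by (auto simp: krivine_functions_def)

lemma krivine_functions_lin: "lin n a \<in> krivine_functions n"
proof (rule krivine_functionsI)
  show "lin n a (\<lambda>i. c * t i) = c * lin n a t" for c and t :: "nat \<Rightarrow> real"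
    by (simp add: lin_def sum_distrib_left mult.left_commute)
qed (use continuous_on_lin in \<open>auto simp: lin_def\<close>)

lemma krivine_functions_combine:
  assumes "g \<in> krivine_functions n" "h \<in> krivine_functions n"
  shows "(\<lambda>t. a * g t + b * h t) \<in> krivine_functions n"
proof (rule krivine_functionsI)
  show "continuous_on UNIV (\<lambda>t. a * g t + b * h t)"
    by (intro continuous_intros krivine_functionsD(1)[OF assms(1)] krivine_functionsD(1)[OF assms(2)])
  show "a * g (\<lambda>i. c * t i) + b * h (\<lambda>i. c * t i) = c * (a * g t + b * h t)" if "0 \<le> c" for c t
    using krivine_functionsD(2)[OF assms(1) that, of t] krivine_functionsD(2)[OF assms(2) that, of t]
    by (simp add: algebra_simps)
  show "a * g t + b * h t = a * g u + b * h u" if "\<And>i. i < n \<Longrightarrow> t i = u i" for t u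
    using krivine_functionsD(3)[OF assms(1), of t u] krivine_functionsD(3)[OF assms(2), of t u] that
    by simp
qed

lemma krivine_functions_max:
  assumes "g \<in> krivine_functions n" "h \<in> krivine_functions n"
  shows "(\<lambda>t. max (g t) (h t)) \<in> krivine_functions n"
proof (rule krivine_functionsI)
  show "continuous_on UNIV (\<lambda>t. max (g t) (h t))"
    by (intro continuous_intros krivine_functionsD(1)[OF assms(1)] krivine_functionsD(1)[OF assms(2)])
  show "max (g (\<lambda>i. c * t i)) (h (\<lambda>i. c * t i)) = c * max (g t) (h t)" if "0 \<le> c" for c t
    using krivine_functionsD(2)[OF assms(1) that, of t] krivine_functionsD(2)[OF assms(2) that, of t] that
    by (simp add: max_mult_distrib_left)
  show "max (g t) (h t) = max (g u) (h u)" if "\<And>i. i < n \<Longrightarrow> t i = u i" for t u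
    using krivine_functionsD(3)[OF assms(1), of t u] krivine_functionsD(3)[OF assms(2), of t u] that
    by simp
qed

lemma krivine_functions_zero: "(\<lambda>t. 0) \<in> krivine_functions n"
  by (rule krivine_functionsI) auto

lemma krivine_functions_coord: "i < n \<Longrightarrow> (\<lambda>t. t i) \<in> krivine_functions n"
  by (rule krivine_functionsI) (auto intro: continuous_on_product_coordinates)

lemma supl_insert:
  "finite P \<Longrightarrow> P \<noteq> {} \<Longrightarrow> supl n (insert a P) e = sup (lin n a e) (supl n P e)"
  by (simp add: supl_def)

lemma krivine_functions_supl:
  assumes "finite P" "P \<noteq> {}"
  shows "supl n P \<in> krivine_functions n"
  using assms
proof (induction rule: finite_ne_induct)
  case (singleton a)
  then show ?case using krivine_functions_lin[of n a] by (simp add: supl_def[abs_def])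
next
  case (insert a P)
  have "supl n (insert a P) = (\<lambda>t :: nat \<Rightarrow> real. max (lin n a t) (supl n P t))"
    using insert by (simp add: fun_eq_iff supl_insert sup_max)
  then show ?case using krivine_functions_max[OF krivine_functions_lin insert.IH] by simp
qed

lemma lattice_term_krivine:
  assumes "lattice_term n e F x"
  shows "F \<in> krivine_functions n"
proof -
  obtain P Q where *: "finite P" "P \<noteq> {}" "finite Q" "Q \<noteq> {}"
    "F = (\<lambda>t. supl n P t - supl n Q t)"
    using assms unfolding lattice_term_def by blast
  show ?thesis
    using krivine_functions_combine[OF krivine_functions_supl[OF *(1,2)] krivine_functions_supl[OF *(3,4)], where a = 1 and b = "-1"]
      * by simp
qed

text \<open>The \<open>l^1\<close>-norm is chosen because it is itself a lattice term, with value
  \<open>\<Sum>i<n. \<bar>e i\<bar>\<close>; error bounds in terms of \<open>nrm\<close> thus turn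
  into order bounds by that vector.\<close>

definition nrm :: "nat \<Rightarrow> (nat \<Rightarrow> real) \<Rightarrow> real" where
  "nrm n t = (\<Sum>i<n. \<bar>t i\<bar>)"

lemma lattice_term_nrm: "lattice_term n e (nrm n) (\<Sum>i<n. \<bar>e i\<bar>)"
  unfolding nrm_def by (intro lattice_term_sum lattice_term_abs lattice_term_coord) auto

text \<open>Coordinates from \<open>n\<close> on are set to \<open>0\<close> so that the sphere is
  compact in the product space of all sequences.\<close>

definition unit_sphere :: "nat \<Rightarrow> (nat \<Rightarrow> real) set" where
  "unit_sphere n = {t. (\<forall>i\<ge>n. t i = 0) \<and> nrm n t = 1}"

lemma continuous_on_nrm: "continuous_on UNIV (nrm n)"
  using lattice_term_krivine[OF lattice_term_nrm[of n "\<lambda>_. 0 :: real"]] by (rule krivine_functionsD)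

lemma compact_unit_sphere: "compact (unit_sphere n)"
proof -
  have "compact (PiE UNIV (\<lambda>i::nat. {-1..1::real}))"
    using compactin_PiE[of "\<lambda>i::nat. euclideanreal" UNIV "\<lambda>i. {-1..1}"]
    by (simp add: euclidean_product_topology)
  moreover have "closed (unit_sphere n)"
  proof -
    have "unit_sphere n = {t. \<forall>i\<in>{n..}. t i = 0} \<inter> {t. nrm n t = 1}"
      by (auto simp: unit_sphere_def)
    moreover have "closed {t :: nat \<Rightarrow> real. \<forall>i\<in>{n..}. t i = 0}"
    proof -
      have "{t :: nat \<Rightarrow> real. \<forall>i\<in>{n..}. t i = 0} = (\<Inter>i\<in>{n..}. {t. t i = 0})" by auto
      also have "closed \<dots>"
        by (intro closed_INT ballI closed_Collect_eq continuous_on_product_coordinates continuous_on_const)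
      finally show ?thesis .
    qed
    moreover have "closed {t. nrm n t = 1}"
      by (intro closed_Collect_eq continuous_on_nrm continuous_on_const)
    ultimately show ?thesis by (simp add: closed_Int)
  qed
  ultimately have "compact (PiE UNIV (\<lambda>i::nat. {-1..1::real}) \<inter> unit_sphere n)"
    by (rule compact_Int_closed)
  moreover have "unit_sphere n \<subseteq> PiE UNIV (\<lambda>i::nat. {-1..1::real})"
  proof
    fix t assume t: "t \<in> unit_sphere n"
    have "\<bar>t i\<bar> \<le> 1" for i
    proof (cases "i < n")
      case True
      hence "\<bar>t i\<bar> \<le> nrm n t" unfolding nrm_def by (intro member_le_sum) auto
      then show ?thesis using t by (simp add: unit_sphere_def)
    qed (use t in \<open>auto simp: unit_sphere_def\<close>)
    thus "t \<in> PiE UNIV (\<lambda>i::nat. {-1..1::real})" by (auto simp: abs_le_iff minus_le_iff)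
  qed
  ultimately show ?thesis by (metis Int_absorb1)
qed

text \<open>The witness is the cone \<open>(h s + \<epsilon>) \<bar>t\<bar> + N \<bar>t - \<bar>t\<bar> s\<bar>\<close> with the \<open>l\<^sup>1\<close>-norm and a large slope \<open>N\<close>.\<close>

lemma lattice_term_cone:
  fixes e :: "nat \<Rightarrow> 'e::banach_lattice"
  assumes h: "h \<in> krivine_functions n" and s: "s \<in> unit_sphere n" and "\<epsilon> > 0"
  shows "\<exists>F x. lattice_term n e F x \<and> F s = h s + \<epsilon> \<and> (\<forall>t\<in>unit_sphere n. h t \<le> F t)"
proof -
  define d where "d = (\<lambda>t. \<Sum>i<n. \<bar>t i - nrm n t * s i\<bar>)"
  have cont_h: "continuous_on A h" for A
    using krivine_functionsD(1)[OF h] by (rule continuous_on_subset) simp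
  have cont_d: "continuous_on A d" for A
    unfolding d_def
    by (intro continuous_intros continuous_on_subset[OF continuous_on_product_coordinates]
        continuous_on_subset[OF continuous_on_nrm]) auto
  define U where "U = {t. h t < h s + \<epsilon>}"
  have "open U" unfolding U_def by (intro open_Collect_less cont_h continuous_on_const)
  hence comp: "compact (unit_sphere n - U)"
    by (intro compact_diff compact_unit_sphere)
  have "bounded (h ` unit_sphere n)"
    by (intro compact_imp_bounded compact_continuous_image cont_h compact_unit_sphere)
  then obtain B where B: "B > 0" "\<And>t. t \<in> unit_sphere n \<Longrightarrow> \<bar>h t\<bar> \<le> B"
    unfolding bounded_pos by auto
  have d_pos: "d t > 0" if "t \<in> unit_sphere n - U" for t
  proof (rule ccontr)
    assume "\<not> d t > 0"
    moreover have "d t \<ge> 0" unfolding d_def by (intro sum_nonneg) auto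
    ultimately have "d t = 0" by simp
    hence "\<forall>i<n. t i = s i"
      using that by (simp add: d_def sum_nonneg_eq_0_iff unit_sphere_def)
    hence "h t = h s" by (intro krivine_functionsD(3)[OF h]) auto
    thus False using that \<open>\<epsilon> > 0\<close> by (simp add: U_def)
  qed
  obtain \<delta> where \<delta>: "\<delta> > 0" "\<And>t. t \<in> unit_sphere n - U \<Longrightarrow> \<delta> \<le> d t"
  proof (cases "unit_sphere n - U = {}")
    case True
    then show ?thesis using that[of 1] by auto
  next
    case False
    obtain t0 where "t0 \<in> unit_sphere n - U" "\<And>t. t \<in> unit_sphere n - U \<Longrightarrow> d t0 \<le> d t"
      using continuous_attains_inf[OF comp False cont_d] by blast
    then show ?thesis using that[of "d t0"] d_pos by blast
  qed
  \<comment> \<open>Outside \<open>U\<close> the point \<open>t\<close> keeps the distance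
    \<open>\<delta>\<close> from \<open>s\<close> in the sense of \<open>d\<close>, so the slope
    \<open>2 * B / \<delta>\<close> raises the cone by at least the oscillation \<open>2 * B\<close>
    of \<open>h\<close>.\<close>
  define F where "F = (\<lambda>t. (h s + \<epsilon>) * nrm n t + (2 * B / \<delta>) * d t)"
  have "\<exists>x. lattice_term n e d x"
    unfolding d_def
    using lattice_term_sum[of "{..<n}" n e, OF lattice_term_abs[OF lattice_term_diff[OF lattice_term_coord lattice_term_scale[OF lattice_term_nrm]]]]
    by (fastforce simp: mult.commute)
  then obtain x where "lattice_term n e d x" by blast
  hence "lattice_term n e F ((h s + \<epsilon>) *\<^sub>R (\<Sum>i<n. \<bar>e i\<bar>) + (2 * B / \<delta>) *\<^sub>R x)"
    unfolding F_def by (intro lattice_term_add lattice_term_scale lattice_term_nrm)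
  moreover have "F s = h s + \<epsilon>"
    using s by (simp add: F_def d_def unit_sphere_def)
  moreover have "h t \<le> F t" if t: "t \<in> unit_sphere n" for t
  proof (cases "t \<in> U")
    case True
    have "d t \<ge> 0" unfolding d_def by (intro sum_nonneg) auto
    hence "(2 * B / \<delta>) * d t \<ge> 0" using B \<delta> by simp
    then show ?thesis using True t unfolding F_def U_def unit_sphere_def by simp
  next
    case False
    hence "\<delta> \<le> d t" using \<delta> t by auto
    hence "2 * B \<le> (2 * B / \<delta>) * d t"
      using \<delta>(1) B(1) by (simp add: field_simps)
    moreover have "h t \<le> B" "- B \<le> h s" using B(2)[OF t] B(2)[OF s] by auto
    ultimately show ?thesis using t \<open>\<epsilon> > 0\<close> unfolding F_def unit_sphere_def by simp
  qed
  ultimately show ?thesis by blast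
qed

lemma nrm_nonneg: "0 \<le> nrm n t"
  by (simp add: nrm_def sum_nonneg)

text \<open>A Stone--Weierstrass argument. The cones lie above \<open>h\<close> on the whole sphere
  and close to \<open>h\<close> near their apex, so a single finite subcover and one minimum
  suffice; homogeneity carries the estimate from the sphere to all tuples.\<close>

lemma lattice_term_dense:
  fixes e :: "nat \<Rightarrow> 'e::banach_lattice"
  assumes h: "h \<in> krivine_functions n" and "\<epsilon> > 0"
  shows "\<exists>F x. lattice_term n e F x \<and> (\<forall>t. \<bar>F t - h t\<bar> \<le> \<epsilon> * nrm n t)"
proof -
  have "\<exists>F x. lattice_term n e F x \<and> (\<forall>t\<in>unit_sphere n. \<bar>F t - h t\<bar> \<le> \<epsilon>)"
  proof (cases "unit_sphere n = {}")
    case True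
    then show ?thesis using lattice_term_zero by blast
  next
    case False
    define \<eta> where "\<eta> = \<epsilon> / 2"
    have \<eta>: "\<eta> > 0" using assms by (simp add: \<eta>_def)
    obtain F where F: "\<And>s. s \<in> unit_sphere n \<Longrightarrow> \<exists>x. lattice_term n e (F s) x"
        "\<And>s. s \<in> unit_sphere n \<Longrightarrow> F s s = h s + \<eta>"
        "\<And>s t. s \<in> unit_sphere n \<Longrightarrow> t \<in> unit_sphere n \<Longrightarrow> h t \<le> F s t"
      using lattice_term_cone[OF h _ \<eta>] by metis
    define U where "U = (\<lambda>s. {t. F s t < h t + \<epsilon>})"
    have "open (U s)" if "s \<in> unit_sphere n" for s
      unfolding U_def
      using F(1)[OF that] krivine_functionsD(1)[OF h] krivine_functionsD(1)[OF lattice_term_krivine]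
      by (auto intro!: open_Collect_less continuous_intros)
    moreover have "s \<in> U s" if "s \<in> unit_sphere n" for s
      using F(2)[OF that] \<eta> by (simp add: U_def \<eta>_def)
    ultimately have "unit_sphere n \<subseteq> (\<Union>s\<in>unit_sphere n. U s)" "\<And>s. s \<in> unit_sphere n \<Longrightarrow> open (U s)"
      by auto
    then obtain T where T: "T \<subseteq> unit_sphere n" "finite T" "unit_sphere n \<subseteq> (\<Union>s\<in>T. U s)"
      by (metis compactE_image[OF compact_unit_sphere])
    have "T \<noteq> {}" using T(3) False by auto
    have "\<exists>G x. lattice_term n e G x \<and> (\<forall>t\<in>unit_sphere n. h t \<le> G t) \<and> (\<forall>s\<in>T. \<forall>t. G t \<le> F s t)"
      using T(2) \<open>T \<noteq> {}\<close> T(1)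
    proof (induction rule: finite_ne_induct)
      case (singleton s)
      then show ?case using F(1,3)[of s] by auto
    next
      case (insert s T)
      hence "T \<subseteq> unit_sphere n" by simp
      from insert.IH[OF this] obtain G x where G: "lattice_term n e G x"
        "\<And>t. t \<in> unit_sphere n \<Longrightarrow> h t \<le> G t" "\<And>s t. s \<in> T \<Longrightarrow> G t \<le> F s t" by blast
      obtain y where "lattice_term n e (F s) y" using F(1)[of s] insert.prems by auto
      then obtain z where "lattice_term n e (\<lambda>t. min (F s t) (G t)) z"
        using lattice_term_min[OF _ G(1)] by blast
      thus ?case using G F(3)[of s] insert
        by (intro exI[of _ "\<lambda>t. min (F s t) (G t)"] exI[of _ z]) (auto simp: min.coboundedI2)
    qed
    then obtain G x where G: "lattice_term n e G x" "\<And>t. t \<in> unit_sphere n \<Longrightarrow> h t \<le> G t"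
        "\<And>s t. s \<in> T \<Longrightarrow> G t \<le> F s t" by auto
    have "\<bar>G t - h t\<bar> \<le> \<epsilon>" if t: "t \<in> unit_sphere n" for t
    proof -
      obtain s where "s \<in> T" "t \<in> U s" using T(3) t by auto
      hence "G t < h t + \<epsilon>" using G(3)[of s t] by (simp add: U_def)
      thus ?thesis using G(2)[OF t] by simp
    qed
    thus ?thesis using G(1) by blast
  qed
  then obtain F x where F: "lattice_term n e F x" "\<And>t. t \<in> unit_sphere n \<Longrightarrow> \<bar>F t - h t\<bar> \<le> \<epsilon>"
    by blast
  have "\<bar>F t - h t\<bar> \<le> \<epsilon> * nrm n t" for t
  proof -
    define u where "u = (\<lambda>i. if i < n then t i / nrm n t else 0)"
    have *: "g t = nrm n t * g u" if "g \<in> krivine_functions n" for g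
    proof (cases "nrm n t = 0")
      case True
      hence "\<forall>i<n. t i = 0" by (simp add: nrm_def sum_nonneg_eq_0_iff)
      hence "g t = g (\<lambda>i. 0 * t i)" by (intro krivine_functionsD(3)[OF that]) auto
      also have "\<dots> = 0" by (subst krivine_functionsD(2)[OF that]) auto
      finally show ?thesis using True by simp
    next
      case False
      have "g t = g (\<lambda>i. nrm n t * u i)"
        using False by (intro krivine_functionsD(3)[OF that]) (simp add: u_def)
      thus ?thesis using krivine_functionsD(2)[OF that nrm_nonneg] by simp
    qed
    show ?thesis
    proof (cases "nrm n t = 0")
      case True
      then show ?thesis using *[OF h] *[OF lattice_term_krivine[OF F(1)]] by simp
    next
      case False
      have "nrm n u = (\<Sum>i<n. \<bar>t i\<bar> / nrm n t)"
        unfolding nrm_def[of n u] using nrm_nonneg[of n t] by (intro sum.cong) (auto simp: u_def)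
      also have "\<dots> = 1" using False by (simp add: sum_divide_distrib[symmetric] nrm_def)
      finally have "u \<in> unit_sphere n" by (simp add: unit_sphere_def u_def)
      hence "\<bar>F u - h u\<bar> \<le> \<epsilon>" by (rule F)
      hence "nrm n t * \<bar>F u - h u\<bar> \<le> nrm n t * \<epsilon>"
        by (intro mult_left_mono nrm_nonneg)
      moreover have "F t - h t = nrm n t * (F u - h u)"
        unfolding right_diff_distrib using *[OF h] *[OF lattice_term_krivine[OF F(1)]] by simp
      ultimately show ?thesis
        using nrm_nonneg[of n t] by (simp add: abs_mult mult.commute)
    qed
  qed
  thus ?thesis using F(1) by blast
qed


text \<open>The value of the calculus at \<open>h\<close> is the limit of the values of lattice terms approximating \<open>h\<close>.\<close>

definition calculus_value :: "nat \<Rightarrow> (nat \<Rightarrow> 'e::banach_lattice) \<Rightarrow> ((nat \<Rightarrow> real) \<Rightarrow> real) \<Rightarrow> 'e \<Rightarrow> bool" where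
  "calculus_value n e h y \<longleftrightarrow> (\<forall>\<epsilon>\<ge>0. \<forall>F x. lattice_term n e F x \<longrightarrow>
     (\<forall>t. \<bar>F t - h t\<bar> \<le> \<epsilon> * nrm n t) \<longrightarrow> norm (y - x) \<le> \<epsilon> * norm (\<Sum>i<n. \<bar>e i\<bar>))"

lemma calculus_valueD:
  "\<lbrakk>calculus_value n e h y; lattice_term n e F x; \<And>t. \<bar>F t - h t\<bar> \<le> \<epsilon> * nrm n t; 0 \<le> \<epsilon>\<rbrakk>
     \<Longrightarrow> norm (y - x) \<le> \<epsilon> * norm (\<Sum>i<n. \<bar>e i\<bar>)"
  unfolding calculus_value_def by blast

lemma eq_if_norm_diff_le:
  fixes y y' :: "'e::real_normed_vector"
  assumes "\<And>\<epsilon>. \<epsilon> > 0 \<Longrightarrow> norm (y - y') \<le> \<epsilon> * B"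
  shows "y = y'"
proof -
  have "((\<lambda>\<epsilon>. \<epsilon> * B) \<longlongrightarrow> 0 * B) (at_right 0)"
    by (intro tendsto_intros)
  hence "norm (y - y') \<le> 0"
    using assms by (intro tendsto_lowerbound[of "\<lambda>\<epsilon>. \<epsilon> * B" _ "at_right 0"])
      (auto simp: eventually_at_right_less intro: eventually_mono[OF eventually_at_right_less])
  thus ?thesis by simp
qed

lemma calculus_value_unique:
  assumes "h \<in> krivine_functions n" "calculus_value n e h y" "calculus_value n e h y'"
  shows "y = y'"
proof (rule eq_if_norm_diff_le)
  fix \<epsilon> :: real assume "\<epsilon> > 0"
  then obtain F x where F: "lattice_term n e F x" "\<And>t. \<bar>F t - h t\<bar> \<le> \<epsilon> * nrm n t"
    using lattice_term_dense[OF assms(1)] by blast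
  have "norm (y - y') \<le> norm (y - x) + norm (y' - x)"
    by (metis norm_triangle_ineq4 diff_diff_eq2 diff_add_cancel)
  also have "\<dots> \<le> \<epsilon> * norm (\<Sum>i<n. \<bar>e i\<bar>) + \<epsilon> * norm (\<Sum>i<n. \<bar>e i\<bar>)"
    using \<open>\<epsilon> > 0\<close> by (intro add_mono calculus_valueD[OF assms(2) F] calculus_valueD[OF assms(3) F]) auto
  finally show "norm (y - y') \<le> \<epsilon> * (2 * norm (\<Sum>i<n. \<bar>e i\<bar>))" by simp
qed

lemma lattice_term_norm_diff:
  fixes e :: "nat \<Rightarrow> 'e::banach_lattice"
  assumes F: "lattice_term n e F x" "\<And>t. \<bar>F t - h t\<bar> \<le> \<delta> * nrm n t"
    and G: "lattice_term n e G y" "\<And>t. \<bar>G t - h t\<bar> \<le> \<epsilon> * nrm n t" and "0 \<le> \<delta> + \<epsilon>"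
  shows "norm (x - y) \<le> (\<delta> + \<epsilon>) * norm (\<Sum>i<n. \<bar>e i\<bar>)"
proof -
  have "\<bar>F t - G t\<bar> \<le> (\<delta> + \<epsilon>) * nrm n t" for t
    using F(2)[of t] G(2)[of t] by (simp add: distrib_right)
  hence "\<bar>x - y\<bar> \<le> (\<delta> + \<epsilon>) *\<^sub>R (\<Sum>i<n. \<bar>e i\<bar>)"
    by (intro lattice_term_mono[OF lattice_term_abs[OF lattice_term_diff[OF F(1) G(1)]]
          lattice_term_scale[OF lattice_term_nrm]])
  hence "norm \<bar>x - y\<bar> \<le> norm ((\<delta> + \<epsilon>) *\<^sub>R (\<Sum>i<n. \<bar>e i\<bar>))"
    by (intro norm_mono_nonneg) simp_all
  thus ?thesis using assms(5) by simp
qed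

text \<open>Approximants with errors \<open>1 / (k + 1)\<close> form a Cauchy sequence, and
  completeness supplies the limit. Comparison with any further approximant shows that the limit
  obeys all error bounds, not only those along the sequence.\<close>

lemma calculus_value_exists:
  fixes e :: "nat \<Rightarrow> 'e::banach_lattice"
  assumes h: "h \<in> krivine_functions n"
  shows "\<exists>y. calculus_value n e h y"
proof -
  define B where "B = norm (\<Sum>i<n. \<bar>e i\<bar>)"
  have "\<exists>F x. lattice_term n e F x \<and> (\<forall>t. \<bar>F t - h t\<bar> \<le> inverse (real (Suc k)) * nrm n t)" for k
    by (intro lattice_term_dense[OF h]) simp
  then obtain F X where F: "\<And>k. lattice_term n e (F k) (X k)"
      "\<And>k t. \<bar>F k t - h t\<bar> \<le> inverse (real (Suc k)) * nrm n t" by metis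
  have lim0: "(\<lambda>k. inverse (real (Suc k))) \<longlonglongrightarrow> 0" by (rule LIMSEQ_inverse_real_of_nat)
  have "Cauchy X"
  proof (rule CauchyI)
    fix r :: real assume "r > 0"
    have "(\<lambda>k. inverse (real (Suc k)) * B) \<longlonglongrightarrow> 0 * B" by (intro tendsto_intros lim0)
    hence "\<forall>\<^sub>F k in sequentially. inverse (real (Suc k)) * B < r / 2"
      using \<open>r > 0\<close> by (intro order_tendstoD) auto
    then obtain K where K: "\<And>k. k \<ge> K \<Longrightarrow> inverse (real (Suc k)) * B < r / 2"
      unfolding eventually_sequentially by blast
    have "norm (X k - X m) < r" if "k \<ge> K" "m \<ge> K" for k m
    proof -
      have "norm (X k - X m) \<le> (inverse (real (Suc k)) + inverse (real (Suc m))) * B"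
        unfolding B_def by (rule lattice_term_norm_diff[OF F F]) simp
      also have "\<dots> < r" using K[OF that(1)] K[OF that(2)] by (simp only: distrib_right)
      finally show ?thesis .
    qed
    thus "\<exists>M. \<forall>m\<ge>M. \<forall>n\<ge>M. norm (X m - X n) < r" by blast
  qed
  then obtain y where y: "X \<longlonglongrightarrow> y" using Cauchy_convergent convergent_def by blast
  have "calculus_value n e h y"
    unfolding calculus_value_def
  proof (intro allI impI)
    fix \<epsilon> :: real and G x
    assume \<epsilon>: "0 \<le> \<epsilon>" and G: "lattice_term n e G x" "\<forall>t. \<bar>G t - h t\<bar> \<le> \<epsilon> * nrm n t"
    have "norm (X k - x) \<le> (inverse (real (Suc k)) + \<epsilon>) * B" for k
      unfolding B_def using G(2) \<epsilon> by (intro lattice_term_norm_diff[OF F G(1)]) auto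
    moreover have "(\<lambda>k. (inverse (real (Suc k)) + \<epsilon>) * B) \<longlonglongrightarrow> (0 + \<epsilon>) * B"
      by (intro tendsto_intros lim0)
    moreover have "(\<lambda>k. norm (X k - x)) \<longlonglongrightarrow> norm (y - x)"
      by (intro tendsto_intros y)
    ultimately have "norm (y - x) \<le> (0 + \<epsilon>) * B"
      by (intro LIMSEQ_le) auto
    thus "norm (y - x) \<le> \<epsilon> * norm (\<Sum>i<n. \<bar>e i\<bar>)" by (simp add: B_def)
  qed
  thus ?thesis ..
qed

lemma calculus_value_lattice_term:
  assumes "lattice_term n e F x"
  shows "calculus_value n e F x"
  unfolding calculus_value_def
proof (intro allI impI)
  fix \<epsilon> :: real and G y
  assume "0 \<le> \<epsilon>" "lattice_term n e G y" "\<forall>t. \<bar>G t - F t\<bar> \<le> \<epsilon> * nrm n t"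
  thus "norm (x - y) \<le> \<epsilon> * norm (\<Sum>i<n. \<bar>e i\<bar>)"
    using lattice_term_norm_diff[OF assms, of F 0 G y \<epsilon>] by simp
qed

lemma calculus_value_combine:
  assumes g: "g \<in> krivine_functions n" and h: "h \<in> krivine_functions n"
    and x: "calculus_value n e g x" and y: "calculus_value n e h y"
    and z: "calculus_value n e (\<lambda>t. a * g t + b * h t) z"
  shows "z = a *\<^sub>R x + b *\<^sub>R y"
proof (rule eq_if_norm_diff_le)
  fix \<epsilon> :: real assume \<epsilon>: "\<epsilon> > 0"
  let ?B = "norm (\<Sum>i<n. \<bar>e i\<bar>)"
  obtain F X where F: "lattice_term n e F X" "\<And>t. \<bar>F t - g t\<bar> \<le> \<epsilon> * nrm n t"
    using lattice_term_dense[OF g \<epsilon>] by blast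
  obtain G Y where G: "lattice_term n e G Y" "\<And>t. \<bar>G t - h t\<bar> \<le> \<epsilon> * nrm n t"
    using lattice_term_dense[OF h \<epsilon>] by blast
  have "\<bar>(a * F t + b * G t) - (a * g t + b * h t)\<bar> \<le> ((\<bar>a\<bar> + \<bar>b\<bar>) * \<epsilon>) * nrm n t" for t
  proof -
    have "\<bar>(a * F t + b * G t) - (a * g t + b * h t)\<bar> = \<bar>a * (F t - g t) + b * (G t - h t)\<bar>"
      by (simp add: algebra_simps)
    also have "\<dots> \<le> \<bar>a\<bar> * \<bar>F t - g t\<bar> + \<bar>b\<bar> * \<bar>G t - h t\<bar>"
      by (metis abs_mult abs_triangle_ineq)
    also have "\<dots> \<le> \<bar>a\<bar> * (\<epsilon> * nrm n t) + \<bar>b\<bar> * (\<epsilon> * nrm n t)"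
      by (intro add_mono mult_left_mono F G) auto
    finally show ?thesis by (simp add: algebra_simps)
  qed
  hence 1: "norm (z - (a *\<^sub>R X + b *\<^sub>R Y)) \<le> ((\<bar>a\<bar> + \<bar>b\<bar>) * \<epsilon>) * ?B"
    using \<epsilon> by (intro calculus_valueD[OF z lattice_term_add[OF lattice_term_scale[OF F(1)] lattice_term_scale[OF G(1)]]]) auto
  have "norm (x - X) \<le> \<epsilon> * ?B" "norm (y - Y) \<le> \<epsilon> * ?B"
    using \<epsilon> by (auto intro!: calculus_valueD[OF x F] calculus_valueD[OF y G])
  hence 2: "norm (a *\<^sub>R (x - X) + b *\<^sub>R (y - Y)) \<le> \<bar>a\<bar> * (\<epsilon> * ?B) + \<bar>b\<bar> * (\<epsilon> * ?B)"
    by (intro order_trans[OF norm_triangle_ineq] add_mono) (auto intro: mult_left_mono)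
  have "norm (z - (a *\<^sub>R x + b *\<^sub>R y))
      = norm ((z - (a *\<^sub>R X + b *\<^sub>R Y)) - (a *\<^sub>R (x - X) + b *\<^sub>R (y - Y)))"
    by (simp add: algebra_simps)
  also have "\<dots> \<le> ((\<bar>a\<bar> + \<bar>b\<bar>) * \<epsilon>) * ?B + (\<bar>a\<bar> * (\<epsilon> * ?B) + \<bar>b\<bar> * (\<epsilon> * ?B))"
    by (intro order_trans[OF norm_triangle_ineq4] add_mono 1 2)
  finally show "norm (z - (a *\<^sub>R x + b *\<^sub>R y)) \<le> \<epsilon> * (2 * (\<bar>a\<bar> + \<bar>b\<bar>) * ?B)"
    by (simp add: algebra_simps)
qed

lemma calculus_value_max:
  assumes g: "g \<in> krivine_functions n" and h: "h \<in> krivine_functions n"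
    and x: "calculus_value n e g x" and y: "calculus_value n e h y"
    and z: "calculus_value n e (\<lambda>t. max (g t) (h t)) z"
  shows "z = sup x y"
proof (rule eq_if_norm_diff_le)
  fix \<epsilon> :: real assume \<epsilon>: "\<epsilon> > 0"
  let ?B = "norm (\<Sum>i<n. \<bar>e i\<bar>)"
  obtain F X where F: "lattice_term n e F X" "\<And>t. \<bar>F t - g t\<bar> \<le> \<epsilon> * nrm n t"
    using lattice_term_dense[OF g \<epsilon>] by blast
  obtain G Y where G: "lattice_term n e G Y" "\<And>t. \<bar>G t - h t\<bar> \<le> \<epsilon> * nrm n t"
    using lattice_term_dense[OF h \<epsilon>] by blast
  have "\<bar>max (F t) (G t) - max (g t) (h t)\<bar> \<le> \<epsilon> * nrm n t" for t
    using F(2)[of t] G(2)[of t] by linarith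
  hence 1: "norm (z - sup X Y) \<le> \<epsilon> * ?B"
    using \<epsilon> by (intro calculus_valueD[OF z lattice_term_max[OF F(1) G(1)]]) auto
  have 2: "norm (x - X) \<le> \<epsilon> * ?B" "norm (y - Y) \<le> \<epsilon> * ?B"
    using \<epsilon> by (auto intro!: calculus_valueD[OF x F] calculus_valueD[OF y G])
  have "norm (z - sup x y) = norm ((z - sup X Y) - (sup x y - sup X Y))" by simp
  also have "\<dots> \<le> \<epsilon> * ?B + (\<epsilon> * ?B + \<epsilon> * ?B)"
    by (intro order_trans[OF norm_triangle_ineq4] add_mono 1 order_trans[OF norm_sup_diff_le] 2)
  finally show "norm (z - sup x y) \<le> \<epsilon> * (3 * ?B)" by simp
qed

section \<open>Every functional calculus agrees with the limits of lattice terms\<close>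

context
  fixes n :: nat and e :: "nat \<Rightarrow> 'e::banach_lattice" and \<tau>
  assumes calc: "is_krivine_calculus n e \<tau>"
begin

lemma calculus_coord: "i < n \<Longrightarrow> \<tau> (\<lambda>t. t i) = e i"
  using calc by (simp add: is_krivine_calculus_def)

lemma calculus_combine:
  "\<lbrakk>g \<in> krivine_functions n; h \<in> krivine_functions n\<rbrakk>
     \<Longrightarrow> \<tau> (\<lambda>t. a * g t + b * h t) = a *\<^sub>R \<tau> g + b *\<^sub>R \<tau> h"
  using calc by (simp add: is_krivine_calculus_def)

lemma calculus_max:
  "\<lbrakk>g \<in> krivine_functions n; h \<in> krivine_functions n\<rbrakk>
     \<Longrightarrow> \<tau> (\<lambda>t. max (g t) (h t)) = sup (\<tau> g) (\<tau> h)"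
  using calc by (simp add: is_krivine_calculus_def)

lemma calculus_zero: "\<tau> (\<lambda>t. 0) = 0"
  using calculus_combine[OF krivine_functions_zero krivine_functions_zero, of 0 0] by simp

lemma calculus_mono:
  assumes "g \<in> krivine_functions n" "h \<in> krivine_functions n" "\<And>t. g t \<le> h t"
  shows "\<tau> g \<le> \<tau> h"
proof -
  have "(\<lambda>t. max (g t) (h t)) = h" using assms(3) by (auto simp: fun_eq_iff max_def)
  thus ?thesis using calculus_max[OF assms(1,2)] by (metis sup_ge1)
qed

lemma calculus_lin: "\<tau> (lin n a) = lin n a e"
proof -
  have "m \<le> n \<Longrightarrow> (\<lambda>t. \<Sum>k<m. a k *\<^sub>R t k) \<in> krivine_functions n \<and>
      \<tau> (\<lambda>t. \<Sum>k<m. a k *\<^sub>R t k) = (\<Sum>k<m. a k *\<^sub>R e k)" for m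
  proof (induction m)
    case 0
    then show ?case using krivine_functions_zero calculus_zero by simp
  next
    case (Suc m)
    then show ?case
      using krivine_functions_combine[OF _ krivine_functions_coord[of m n], of _ 1 "a m"]
        calculus_combine[OF _ krivine_functions_coord[of m n], of _ 1 "a m"] calculus_coord[of m]
      by simp
  qed
  from this[of n] show ?thesis by (simp add: lin_def[abs_def])
qed

lemma calculus_supl:
  assumes "finite P" "P \<noteq> {}"
  shows "\<tau> (supl n P) = supl n P e"
  using assms
proof (induction rule: finite_ne_induct)
  case (singleton a)
  then show ?case using calculus_lin[of a] by (simp add: supl_def[abs_def])
next
  case (insert a P)
  have "supl n (insert a P) = (\<lambda>t :: nat \<Rightarrow> real. max (lin n a t) (supl n P t))"
    using insert by (simp add: fun_eq_iff supl_insert sup_max)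
  then show ?case
    using calculus_max[OF krivine_functions_lin krivine_functions_supl, of P a] insert
    by (simp add: calculus_lin supl_insert)
qed

lemma calculus_lattice_term:
  assumes "lattice_term n e F x"
  shows "\<tau> F = x"
proof -
  obtain P Q where *: "finite P" "P \<noteq> {}" "finite Q" "Q \<noteq> {}"
    "F = (\<lambda>t. supl n P t - supl n Q t)" "x = supl n P e - supl n Q e"
    using assms unfolding lattice_term_def by blast
  show ?thesis
    using calculus_combine[OF krivine_functions_supl[OF *(1,2)] krivine_functions_supl[OF *(3,4)], where a = 1 and b = "-1"]
    by (simp add: * calculus_supl)
qed

text \<open>Monotonicity squeezes \<open>\<tau> h\<close> between the values of the lattice terms
  \<open>F t - \<epsilon> * nrm n t\<close> and \<open>F t + \<epsilon> * nrm n t\<close>. Lattice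
  homomorphisms are therefore automatically continuous here, and two of them coincide on
  \<open>krivine_functions n\<close>.\<close>

lemma calculus_value_calculus:
  assumes "h \<in> krivine_functions n"
  shows "calculus_value n e h (\<tau> h)"
  unfolding calculus_value_def
proof (intro allI impI)
  fix \<epsilon> :: real and F x
  assume \<epsilon>: "0 \<le> \<epsilon>" and F: "lattice_term n e F x" "\<forall>t. \<bar>F t - h t\<bar> \<le> \<epsilon> * nrm n t"
  let ?u = "\<Sum>i<n. \<bar>e i\<bar>"
  have up: "lattice_term n e (\<lambda>t. F t + \<epsilon> * nrm n t) (x + \<epsilon> *\<^sub>R ?u)"
    by (intro lattice_term_add lattice_term_scale lattice_term_nrm F(1))
  have lo: "lattice_term n e (\<lambda>t. F t - \<epsilon> * nrm n t) (x - \<epsilon> *\<^sub>R ?u)"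
    by (intro lattice_term_diff lattice_term_scale lattice_term_nrm F(1))
  have bd: "h t \<le> F t + \<epsilon> * nrm n t" "F t - \<epsilon> * nrm n t \<le> h t" for t
    using F(2)[rule_format, of t] by linarith+
  have "\<tau> h \<le> x + \<epsilon> *\<^sub>R ?u"
    unfolding calculus_lattice_term[OF up, symmetric]
    by (intro calculus_mono assms lattice_term_krivine[OF up] bd)
  moreover have "x - \<epsilon> *\<^sub>R ?u \<le> \<tau> h"
    unfolding calculus_lattice_term[OF lo, symmetric]
    by (intro calculus_mono assms lattice_term_krivine[OF lo] bd)
  ultimately have "\<bar>\<tau> h - x\<bar> \<le> \<epsilon> *\<^sub>R ?u"
    by (intro abs_leI) (simp_all add: diff_le_eq add.commute)
  hence "norm \<bar>\<tau> h - x\<bar> \<le> norm (\<epsilon> *\<^sub>R ?u)"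
    by (intro norm_mono_nonneg) auto
  thus "norm (\<tau> h - x) \<le> \<epsilon> * norm ?u" using \<epsilon> by simp
qed

end

text \<open>A calculus is determined on \<open>krivine_functions n\<close> only, so no unique map
  \<tau> exists. The description in \<open>krivine\<close> is therefore resolved for each function
  \<open>h\<close> separately, and the resulting values are those of the calculus \<sigma> obtained
  by approximation.\<close>

theorem krivine_is_calculus: "is_krivine_calculus n e (krivine n e)"
proof -
  define \<sigma> where "\<sigma> = (\<lambda>h. THE y. calculus_value n e h y)"
  have \<sigma>: "calculus_value n e h (\<sigma> h)" if "h \<in> krivine_functions n" for h
  proof -
    have "\<exists>!y. calculus_value n e h y"
      using calculus_value_exists[OF that] calculus_value_unique[OF that] by blast
    thus ?thesis unfolding \<sigma>_def by (rule theI')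
  qed
  have calc: "is_krivine_calculus n e \<sigma>"
    unfolding is_krivine_calculus_def
  proof (intro conjI allI impI ballI)
    show "\<sigma> (\<lambda>t. t i) = e i" if "i < n" for i
      using calculus_value_unique[OF krivine_functions_coord[OF that] \<sigma>[OF krivine_functions_coord[OF that]]
          calculus_value_lattice_term[OF lattice_term_coord[OF that]]] .
    fix g h assume gh: "g \<in> krivine_functions n" "h \<in> krivine_functions n"
    show "\<sigma> (\<lambda>t. a * g t + b * h t) = a *\<^sub>R \<sigma> g + b *\<^sub>R \<sigma> h" for a b
      by (rule calculus_value_combine[OF gh \<sigma>[OF gh(1)] \<sigma>[OF gh(2)] \<sigma>[OF krivine_functions_combine[OF gh]]])
    show "\<sigma> (\<lambda>t. max (g t) (h t)) = sup (\<sigma> g) (\<sigma> h)"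
      by (rule calculus_value_max[OF gh \<sigma>[OF gh(1)] \<sigma>[OF gh(2)] \<sigma>[OF krivine_functions_max[OF gh]]])
  qed
  have eq: "krivine n e h = \<sigma> h" if "h \<in> krivine_functions n" for h
    unfolding krivine_def
  proof (rule the_equality)
    show "\<exists>\<tau>. is_krivine_calculus n e \<tau> \<and> \<tau> h = \<sigma> h" using calc by blast
    show "y = \<sigma> h" if "\<exists>\<tau>. is_krivine_calculus n e \<tau> \<and> \<tau> h = y" for y
      using that calculus_value_unique[OF \<open>h \<in> krivine_functions n\<close>] calculus_value_calculus \<sigma>
        \<open>h \<in> krivine_functions n\<close> by metis
  qed
  show ?thesis
    using calc unfolding is_krivine_calculus_def
    by (simp add: eq krivine_functions_coord krivine_functions_combine krivine_functions_max)
qed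

subsection \<open>Convexity and upper estimates\<close>

definition lq_norm :: "nat \<Rightarrow> real \<Rightarrow> (nat \<Rightarrow> real) \<Rightarrow> real" where
  "lq_norm n q t = (\<Sum>k<n. \<bar>t k\<bar> powr q) powr (1 / q)"

lemma krivine_functions_lq_norm:
  assumes "0 < q"
  shows "lq_norm n q \<in> krivine_functions n"
proof (rule krivine_functionsI)
  show "continuous_on UNIV (lq_norm n q)"
    unfolding lq_norm_def using assms
    by (intro continuous_on_powr' continuous_on_sum continuous_on_rabs
        continuous_on_product_coordinates continuous_on_const) (auto intro: sum_nonneg)
  show "lq_norm n q (\<lambda>i. c * t i) = c * lq_norm n q t" if "0 \<le> c" for c t
  proof -
    have "(\<Sum>k<n. \<bar>c * t k\<bar> powr q) = c powr q * (\<Sum>k<n. \<bar>t k\<bar> powr q)"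
      using that by (simp add: abs_mult powr_mult sum_distrib_left)
    thus ?thesis using that assms
      by (simp add: lq_norm_def powr_mult sum_nonneg powr_powr)
  qed
qed (auto simp: lq_norm_def)

lemma abs_le_lq_norm:
  assumes "0 < q" "k < n"
  shows "\<bar>t k\<bar> \<le> lq_norm n q t"
proof -
  have "\<bar>t k\<bar> powr q \<le> (\<Sum>k<n. \<bar>t k\<bar> powr q)"
    using assms(2) by (intro member_le_sum) auto
  hence "(\<bar>t k\<bar> powr q) powr (1 / q) \<le> lq_norm n q t"
    unfolding lq_norm_def using assms(1) by (intro powr_mono2) auto
  thus ?thesis using assms(1) by (simp add: powr_powr)
qed

lemma q_convex_lq_norm:
  "q_convex TYPE('e::banach_lattice) q \<longleftrightarrow>
     (\<exists>C. \<forall>n. \<forall>e :: nat \<Rightarrow> 'e.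
        norm (krivine n e (lq_norm n q)) \<le> C * (\<Sum>k<n. norm (e k) powr q) powr (1 / q))"
  by (simp add: q_convex_def lq_norm_def[abs_def])

text \<open>Each coordinate is pointwise at most the \<open>l^q\<close>-norm, and the calculus
  preserves order.\<close>

lemma upper_estimate_of_q_convex:
  assumes "q_convex TYPE('e::banach_lattice) q" "0 < q"
  shows "\<exists>C. upper_estimate TYPE('e) q C"
proof -
  obtain C where C: "\<And>n (e :: nat \<Rightarrow> 'e). norm (krivine n e (lq_norm n q))
      \<le> C * (\<Sum>k<n. norm (e k) powr q) powr (1 / q)"
    using assms(1) unfolding q_convex_lq_norm by blast
  have "norm (psup e {..<n}) \<le> C * (\<Sum>i<n. norm (e i) powr q) powr (1 / q)"
    if e: "\<And>i. i < n \<Longrightarrow> 0 \<le> e i" for n and e :: "nat \<Rightarrow> 'e"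
  proof -
    note calc = krivine_is_calculus[of n e]
    note N = krivine_functions_lq_norm[OF assms(2), of n]
    have "psup e {..<n} \<le> krivine n e (lq_norm n q)"
    proof (rule psup_least)
      show "0 \<le> krivine n e (lq_norm n q)"
        using calculus_mono[OF calc krivine_functions_zero N] calculus_zero[OF calc]
        by (simp add: lq_norm_def)
      show "e i \<le> krivine n e (lq_norm n q)" if "i \<in> {..<n}" for i
        using that calculus_mono[OF calc krivine_functions_coord N, of i] calculus_coord[OF calc, of i]
          abs_le_lq_norm[OF assms(2), of i n] by (simp add: abs_le_iff)
    qed auto
    hence "norm (psup e {..<n}) \<le> norm (krivine n e (lq_norm n q))"
      by (intro norm_mono_nonneg psup_nonneg) auto
    thus ?thesis using C[of n e] by linarith
  qed
  thus ?thesis unfolding upper_estimate_def by blast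
qed

text \<open>The expectation of \<open>sup s (max of L independent samples of x)\<close>, where \<open>x k\<close> is drawn with
  probability \<open>p k\<close>.\<close>

primrec sample_sup :: "nat \<Rightarrow> (nat \<Rightarrow> real) \<Rightarrow> (nat \<Rightarrow> 'e::banach_lattice) \<Rightarrow> nat \<Rightarrow> 'e \<Rightarrow> 'e" where
  "sample_sup n p x 0 s = s"
| "sample_sup n p x (Suc L) s = (\<Sum>k<n. p k *\<^sub>R sample_sup n p x L (sup s (x k)))"

text \<open>Keeps expected suprema within lattice terms, so that inequalities for maxima of real
  samples transfer to the lattice.\<close>

lemma lattice_term_sample_sup:
  assumes "\<And>k. k < n \<Longrightarrow> lattice_term m e (\<lambda>t. F t k) (X k)" "lattice_term m e G s"
  shows "lattice_term m e (\<lambda>t. sample_sup n p (F t) L (G t)) (sample_sup n p X L s)"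
  using assms(2)
proof (induction L arbitrary: G s)
  case (Suc L)
  have "lattice_term m e (\<lambda>t. sup (G t) (F t k)) (sup s (X k))" if "k < n" for k
    using lattice_term_max[OF Suc.prems assms(1)[OF that]] by (simp add: sup_max)
  thus ?case
    by (auto intro!: lattice_term_sum lattice_term_scale Suc.IH)
qed simp

text \<open>The factor of \<open>u\<close> is the probability that one of \<open>L\<close>
  independent samples reaches the level \<open>u\<close>. The induction conditions on the first
  sample; the second claim takes over once the level has been reached.\<close>

lemma sample_sup_ge:
  fixes x :: "nat \<Rightarrow> real"
  assumes p: "\<And>k. k < n \<Longrightarrow> 0 \<le> p k" "(\<Sum>k<n. p k) = 1" and "0 \<le> u" "0 \<le> s"
  shows "u * (1 - (1 - (\<Sum>k\<in>{k\<in>{..<n}. u \<le> x k}. p k)) ^ L) \<le> sample_sup n p x L s"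
    and "u \<le> s \<Longrightarrow> u \<le> sample_sup n p x L s"
proof -
  define P where "P = (\<Sum>k\<in>{k\<in>{..<n}. u \<le> x k}. p k)"
  have P: "0 \<le> P" "P \<le> 1"
    unfolding P_def p(2)[symmetric] using p(1) by (auto intro!: sum_nonneg sum_mono2)
  have 2: "u \<le> s \<Longrightarrow> u \<le> sample_sup n p x L s" for s L
  proof (induction L arbitrary: s)
    case (Suc L)
    have "u = (\<Sum>k<n. p k * u)" using p(2) by (simp add: sum_distrib_right[symmetric])
    also have "\<dots> \<le> (\<Sum>k<n. p k * sample_sup n p x L (sup s (x k)))"
      using p(1) Suc.prems by (intro sum_mono mult_left_mono Suc.IH) (auto intro: le_supI1)
    finally show ?case by simp
  qed simp
  show "u \<le> s \<Longrightarrow> u \<le> sample_sup n p x L s" by (rule 2)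
  show "u * (1 - (1 - (\<Sum>k\<in>{k\<in>{..<n}. u \<le> x k}. p k)) ^ L) \<le> sample_sup n p x L s"
    unfolding P_def[symmetric] using \<open>0 \<le> s\<close>
  proof (induction L arbitrary: s)
    case (Suc L)
    let ?c = "u * (1 - (1 - P) ^ L)"
    have disj: "{..<n} = {k\<in>{..<n}. u \<le> x k} \<union> {k\<in>{..<n}. \<not> u \<le> x k}" by auto
    have Pc: "(\<Sum>k\<in>{k\<in>{..<n}. \<not> u \<le> x k}. p k) = 1 - P"
      unfolding P_def p(2)[symmetric] by (subst (2) disj, subst sum.union_disjoint) auto
    have "u * (1 - (1 - P) ^ Suc L) = P * u + (1 - P) * ?c" by (simp add: algebra_simps)
    also have "\<dots> = (\<Sum>k\<in>{k\<in>{..<n}. u \<le> x k}. p k * u) + (\<Sum>k\<in>{k\<in>{..<n}. \<not> u \<le> x k}. p k * ?c)"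
      by (simp only: sum_distrib_right[symmetric] Pc P_def)
    also have "\<dots> \<le> (\<Sum>k\<in>{k\<in>{..<n}. u \<le> x k}. p k * sample_sup n p x L (sup s (x k)))
        + (\<Sum>k\<in>{k\<in>{..<n}. \<not> u \<le> x k}. p k * sample_sup n p x L (sup s (x k)))"
      using p(1) Suc.prems
      by (intro add_mono sum_mono mult_left_mono 2 Suc.IH) (auto intro: le_supI1 le_supI2)
    also have "\<dots> = (\<Sum>k<n. p k * sample_sup n p x L (sup s (x k)))"
      by (subst (3) disj, subst sum.union_disjoint) auto
    finally show ?case by simp
  qed simp
qed

text \<open>Every outcome is a supremum of \<open>l + L\<close> vectors of norm at most
  \<open>1\<close>, and averaging preserves the bound. The initial family \<open>e\<close> is there
  for the induction, which moves one sample at a time into it.\<close>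

lemma norm_sample_sup_le:
  fixes x :: "nat \<Rightarrow> 'e::banach_lattice"
  assumes U: "upper_estimate TYPE('e) r C" and "0 < r"
    and p: "\<And>k. k < n \<Longrightarrow> 0 \<le> p k" "(\<Sum>k<n. p k) = 1"
    and x: "\<And>k. k < n \<Longrightarrow> 0 \<le> x k" "\<And>k. k < n \<Longrightarrow> norm (x k) \<le> 1"
    and e: "\<And>k. k < l \<Longrightarrow> 0 \<le> e k" "\<And>k. k < l \<Longrightarrow> norm (e k) \<le> 1"
  shows "norm (sample_sup n p x L (psup e {..<l})) \<le> \<bar>C\<bar> * real (l + L) powr (1 / r)"
  using e
proof (induction L arbitrary: l e)
  case 0
  have "norm (psup e {..<l}) \<le> C * (\<Sum>i<l. norm (e i) powr r) powr (1 / r)"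
    using 0 by (intro upper_estimateD[OF U]) auto
  also have "\<dots> \<le> \<bar>C\<bar> * (\<Sum>i<l. norm (e i) powr r) powr (1 / r)"
    by (intro mult_right_mono) auto
  also have "\<dots> \<le> \<bar>C\<bar> * (\<Sum>i<l. 1) powr (1 / r)"
    using 0 \<open>0 < r\<close> by (intro mult_left_mono powr_mono2 sum_mono)
      (auto intro: sum_nonneg powr_le1)
  finally show ?case by simp
next
  case (Suc L)
  have "norm (sample_sup n p x L (sup (psup e {..<l}) (x k))) \<le> \<bar>C\<bar> * real (l + Suc L) powr (1 / r)"
    if k: "k < n" for k
  proof -
    have "psup (e(l := x k)) {..<Suc l} = sup (x k) (psup (e(l := x k)) {..<l})"
      by (simp add: lessThan_Suc psup_insert)
    also have "psup (e(l := x k)) {..<l} = psup e {..<l}" by (intro psup_cong) auto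
    finally have "sup (psup e {..<l}) (x k) = psup (e(l := x k)) {..<Suc l}"
      by (simp only: sup_commute)
    moreover have "norm (sample_sup n p x L (psup (e(l := x k)) {..<Suc l}))
        \<le> \<bar>C\<bar> * real (Suc l + L) powr (1 / r)"
      using Suc.prems x k by (intro Suc.IH) (auto simp: less_Suc_eq)
    ultimately show ?thesis by simp
  qed
  hence "norm (sample_sup n p x (Suc L) (psup e {..<l}))
      \<le> (\<Sum>k<n. p k * (\<bar>C\<bar> * real (l + Suc L) powr (1 / r)))"
    using p(1) by (auto intro!: order_trans[OF norm_sum] sum_mono mult_left_mono)
  also have "\<dots> = \<bar>C\<bar> * real (l + Suc L) powr (1 / r)"
    using p(2) by (simp add: sum_distrib_right[symmetric])
  finally show ?case .
qed

lemma sum_powr_le_powr_sum: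
  fixes b :: "'i \<Rightarrow> real"
  assumes "finite A" "\<And>i. i \<in> A \<Longrightarrow> 0 \<le> b i" "1 \<le> q"
  shows "(\<Sum>i\<in>A. b i powr q) \<le> (\<Sum>i\<in>A. b i) powr q"
proof -
  let ?B = "\<Sum>i\<in>A. b i"
  have powr_split: "a powr q = a * a powr (q - 1)" if "0 \<le> a" for a :: real
    using that by (cases "a = 0") (auto simp: powr_mult_base)
  have B: "0 \<le> ?B" using assms by (intro sum_nonneg)
  have "(\<Sum>i\<in>A. b i powr q) \<le> (\<Sum>i\<in>A. b i * ?B powr (q - 1))"
  proof (rule sum_mono)
    fix i assume i: "i \<in> A"
    hence "b i \<le> ?B" using assms by (intro member_le_sum) auto
    hence "b i powr (q - 1) \<le> ?B powr (q - 1)"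
      using assms(2)[OF i] assms(3) by (intro powr_mono2) auto
    thus "b i powr q \<le> b i * ?B powr (q - 1)"
      using assms(2)[OF i] by (simp add: powr_split mult_left_mono)
  qed
  also have "\<dots> = ?B powr q" using B by (simp add: powr_split sum_distrib_right)
  finally show ?thesis .
qed

text \<open>A quantile of level \<open>2 ^ - j\<close> is at most twice the expected maximum of \<open>2 ^ j\<close> samples.\<close>

lemma weighted_lq_le_sample_sup:
  fixes y :: "nat \<Rightarrow> real"
  assumes p: "\<And>k. k < n \<Longrightarrow> (1 / 2) ^ J \<le> p k" "(\<Sum>k<n. p k) = 1"
    and y: "\<And>k. k < n \<Longrightarrow> 0 \<le> y k" and q: "1 \<le> q"
  shows "(\<Sum>k<n. p k * y k powr q) powr (1 / q)
     \<le> (\<Sum>j\<le>J. 4 * (1 / 2) powr (real j / q) * sample_sup n p y (2 ^ j) 0)"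
proof -
  define P where "P = (\<lambda>k. \<Sum>i\<in>{i\<in>{..<n}. y k \<le> y i}. p i)"
  define S where "S = (\<lambda>j. sample_sup n p y (2 ^ j) 0)"
  \<comment> \<open>The dyadic scale of the tail probability \<open>P k\<close>. Tails are at least
    \<open>(1 / 2) ^ J\<close>, so only the levels up to \<open>J\<close> occur.\<close>
  define lev where "lev = (\<lambda>k. LEAST j. (1 / 2) ^ j \<le> P k)"
  have p_pos: "0 < p k" if "k < n" for k
    using p(1)[OF that] by (rule less_le_trans[rotated]) simp
  have PJ: "(1 / 2) ^ J \<le> P k" if "k < n" for k
  proof -
    have "p k \<le> P k" unfolding P_def
      using that p_pos by (intro member_le_sum) (auto intro: less_imp_le)
    thus ?thesis using p(1)[OF that] by simp
  qed
  have P1: "P k \<le> 1" for k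
    unfolding P_def p(2)[symmetric] using p_pos by (intro sum_mono2) (auto intro: less_imp_le)
  have lev: "(1 / 2) ^ lev k \<le> P k" "lev k \<le> J" if "k < n" for k
    using LeastI[of "\<lambda>j. (1 / 2) ^ j \<le> P k", OF PJ[OF that]]
      Least_le[of "\<lambda>j. (1 / 2) ^ j \<le> P k", OF PJ[OF that]] by (auto simp: lev_def)
  have S0: "0 \<le> S j" for j
    unfolding S_def using sample_sup_ge(2)[of n p 0 0 y "2 ^ j"] p_pos p(2) by (auto intro: less_imp_le)
  have y_le: "y k \<le> 2 * S (lev k)" if k: "k < n" for k
  proof -
    let ?L = "2 ^ lev k :: nat"
    have "1 \<le> real ?L * P k"
      using lev(1)[OF k] by (simp add: field_simps power_divide)
    \<comment> \<open>With \<open>2 ^ lev k\<close> samples the expected number of hits is at least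
      \<open>1\<close>, so all of them miss with probability at most \<open>exp (- 1)\<close>, hence
      at most \<open>1 / 2\<close>. This is the factor \<open>2\<close> in the bound for a
      quantile.\<close>
    have "(1 - P k) ^ ?L \<le> exp (- P k) ^ ?L"
      using P1[of k] exp_ge_add_one_self[of "- P k"] by (intro power_mono) auto
    also have "\<dots> = exp (- (real ?L * P k))" by (simp add: exp_of_nat_mult[symmetric])
    also have "\<dots> \<le> exp (- 1)" using \<open>1 \<le> real ?L * P k\<close> by simp
    also have "\<dots> \<le> 1 / 2" using exp_ge_add_one_self[of 1] by (simp add: exp_minus field_simps)
    finally have "y k * (1 / 2) \<le> y k * (1 - (1 - P k) ^ ?L)"
      using y[OF k] by (intro mult_left_mono) auto
    also have "\<dots> \<le> S (lev k)"
      unfolding S_def P_def using p_pos p(2) y[OF k]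
      by (intro sample_sup_ge(1)) (auto intro: less_imp_le)
    finally show ?thesis by simp
  qed
  have level_mass: "(\<Sum>k\<in>{k\<in>{..<n}. lev k = j}. p k) \<le> 2 * (1 / 2) ^ j" for j
  proof (cases "j = 0 \<or> {k\<in>{..<n}. lev k = j} = {}")
    case True
    then show ?thesis
    proof
      assume "j = 0"
      have "(\<Sum>k\<in>{k\<in>{..<n}. lev k = j}. p k) \<le> (\<Sum>k<n. p k)"
        using p_pos by (intro sum_mono2) (auto intro: less_imp_le)
      thus ?thesis using p(2) \<open>j = 0\<close> by simp
    next
      assume "{k\<in>{..<n}. lev k = j} = {}"
      thus ?thesis by (simp only: sum.empty) simp
    qed
  next
    case False
    define A where "A = {k\<in>{..<n}. lev k = j}"
    have A: "finite A" "A \<noteq> {}" using False by (auto simp: A_def)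
    \<comment> \<open>The tail of the smallest value in a level contains the whole level, and
      minimality of \<open>lev k\<close> bounds that tail by
      \<open>(1 / 2) ^ (j - 1)\<close>.\<close>
    obtain k where k: "k \<in> A" "y k = Min (y ` A)" by (metis (no_types, lifting) A Min_in finite_imageI image_iff image_is_empty)
    have "(\<Sum>k\<in>A. p k) \<le> P k"
      unfolding P_def using A k p_pos by (intro sum_mono2) (auto simp: A_def intro: less_imp_le)
    also have "P k < (1 / 2) ^ (j - 1)"
    proof (rule ccontr)
      assume "\<not> ?thesis"
      hence "lev k \<le> j - 1" unfolding lev_def by (intro Least_le) simp
      thus False using k False by (auto simp: A_def)
    qed
    also have "(1 / 2) ^ (j - 1) = 2 * (1 / 2 :: real) ^ j" using False by (cases j) auto
    finally show ?thesis by (simp add: A_def)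
  qed
  have "(\<Sum>k<n. p k * y k powr q) = (\<Sum>j\<le>J. \<Sum>k\<in>{k\<in>{..<n}. lev k = j}. p k * y k powr q)"
    using lev(2) by (intro sum.group[symmetric]) auto
  also have "\<dots> \<le> (\<Sum>j\<le>J. \<Sum>k\<in>{k\<in>{..<n}. lev k = j}. p k * (2 * S j) powr q)"
    using p_pos y y_le q by (intro sum_mono mult_left_mono powr_mono2) (auto intro: less_imp_le)
  also have "\<dots> \<le> (\<Sum>j\<le>J. (2 * (1 / 2) ^ j) * (2 * S j) powr q)"
    unfolding sum_distrib_right[symmetric] by (intro sum_mono mult_right_mono level_mass) auto
  also have "\<dots> = (\<Sum>j\<le>J. ((2 * (1 / 2) ^ j) powr (1 / q) * (2 * S j)) powr q)"
    using q S0 by (simp add: powr_mult powr_powr)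
  \<comment> \<open>Passing from the \<open>l^q\<close>-sum to the \<open>l^1\<close>-sum over the
    levels makes the bound linear in the expected maxima, hence a lattice term.\<close>
  also have "\<dots> \<le> (\<Sum>j\<le>J. (2 * (1 / 2) ^ j) powr (1 / q) * (2 * S j)) powr q"
    using q S0 by (intro sum_powr_le_powr_sum) auto
  finally have "(\<Sum>k<n. p k * y k powr q) powr (1 / q)
      \<le> ((\<Sum>j\<le>J. (2 * (1 / 2) ^ j) powr (1 / q) * (2 * S j)) powr q) powr (1 / q)"
    using q by (intro powr_mono2 sum_nonneg mult_nonneg_nonneg) (auto simp: p_pos less_imp_le)
  also have "\<dots> = (\<Sum>j\<le>J. (2 * (1 / 2) ^ j) powr (1 / q) * (2 * S j))"
    using q S0 by (simp add: powr_powr sum_nonneg)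
  \<comment> \<open>The \<open>4\<close> is the factor \<open>2\<close> of the quantile bound times
    \<open>2 powr (1 / q)\<close>, which is at most \<open>2\<close>.\<close>
  also have "\<dots> \<le> (\<Sum>j\<le>J. 4 * (1 / 2) powr (real j / q) * S j)"
  proof (rule sum_mono)
    fix j
    have "(2 * (1 / 2) ^ j) powr (1 / q) = 2 powr (1 / q) * (1 / 2) powr (real j / q)"
      by (simp add: powr_mult powr_realpow[symmetric] powr_powr del: powr_realpow)
    also have "\<dots> \<le> 2 powr 1 * (1 / 2) powr (real j / q)"
      using q by (intro mult_right_mono powr_mono) auto
    finally show "(2 * (1 / 2) ^ j) powr (1 / q) * (2 * S j) \<le> 4 * (1 / 2) powr (real j / q) * S j"
      using S0[of j] mult_right_mono[of "(2 * (1 / 2) ^ j) powr (1 / q)" "2 powr 1 * (1 / 2) powr (real j / q)" "2 * S j"]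
      by simp
  qed
  finally show ?thesis by (simp add: S_def)
qed

text \<open>Lets norms be replaced by slightly larger numbers: once to normalise vectors that may
  vanish, once to absorb the error in averages that are only almost correct.\<close>

lemma lq_bound_limit:
  fixes a :: "nat \<Rightarrow> real"
  assumes q: "0 < q" and a: "\<And>k. k < n \<Longrightarrow> 0 \<le> a k"
    and le: "\<And>\<epsilon>. 0 < \<epsilon> \<Longrightarrow> y \<le> K * (\<Sum>k<n. (a k + \<epsilon>) powr q) powr (1 / q)"
  shows "y \<le> K * (\<Sum>k<n. a k powr q) powr (1 / q)"
proof (rule tendsto_lowerbound)
  have nonneg: "\<forall>\<^sub>F \<epsilon> in at_right 0. 0 \<le> a k + \<epsilon>" if "k < n" for k
    using eventually_at_right_less[of "0::real"]
    by eventually_elim (simp add: add_nonneg_nonneg less_imp_le a that)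
  have "((\<lambda>\<epsilon>. \<Sum>k<n. (a k + \<epsilon>) powr q) \<longlongrightarrow> (\<Sum>k<n. (a k + 0) powr q)) (at_right 0)"
    using q nonneg by (intro tendsto_sum tendsto_powr' tendsto_add tendsto_const tendsto_ident_at) auto
  hence "((\<lambda>\<epsilon>. K * (\<Sum>k<n. (a k + \<epsilon>) powr q) powr (1 / q)) \<longlongrightarrow>
      K * (\<Sum>k<n. (a k + 0) powr q) powr (1 / q)) (at_right 0)"
    using q by (intro tendsto_mult tendsto_const tendsto_powr') (auto intro!: sum_nonneg always_eventually)
  thus "((\<lambda>\<epsilon>. K * (\<Sum>k<n. (a k + \<epsilon>) powr q) powr (1 / q)) \<longlongrightarrow>
      K * (\<Sum>k<n. a k powr q) powr (1 / q)) (at_right 0)" by simp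
  show "\<forall>\<^sub>F \<epsilon> in at_right 0. y \<le> K * (\<Sum>k<n. (a k + \<epsilon>) powr q) powr (1 / q)"
    using eventually_at_right_less[of "0::real"] by eventually_elim (rule le)
qed simp

text \<open>Level \<open>j\<close> enters with the factor \<open>2 powr (- j / q)\<close> and needs
  \<open>2 ^ j\<close> samples, whose supremum costs \<open>2 powr (j / r)\<close>. Since
  \<open>q < r\<close>, the levels sum to a geometric series with ratio
  \<open>\<rho>\<close>.\<close>

lemma q_convex_of_upper_estimate:
  assumes U: "upper_estimate TYPE('e::banach_lattice) r C" and q: "1 \<le> q" "q < r"
  shows "q_convex TYPE('e) q"
proof -
  define \<rho> where "\<rho> = (2::real) powr (1 / r - 1 / q)"
  have "1 / r < 1 / q" using q by (intro divide_strict_left_mono) auto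
  hence \<rho>: "0 < \<rho>" "\<rho> < 1"
    using powr_less_mono[of "1 / r - 1 / q" 0 2] by (auto simp: \<rho>_def)
  define K where "K = 4 * \<bar>C\<bar> / (1 - \<rho>)"
  have main: "norm (krivine n e (lq_norm n q)) \<le> K * (\<Sum>k<n. a k powr q) powr (1 / q)"
    if a: "\<And>k. k < n \<Longrightarrow> 0 < a k" "\<And>k. k < n \<Longrightarrow> norm (e k) \<le> a k" for n a and e :: "nat \<Rightarrow> 'e"
  proof (cases "n = 0")
    case True
    have "lq_norm n q = (\<lambda>t. 0)" using True by (simp add: fun_eq_iff lq_norm_def)
    then show ?thesis using True calculus_zero[OF krivine_is_calculus] by simp
  next
    case False
    define A where "A = (\<Sum>k<n. a k powr q)"
    have A: "A > 0" unfolding A_def using False less_imp_neq[OF a(1)] by (intro sum_pos) force+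
    \<comment> \<open>With weights proportional to \<open>a k powr q\<close>, the normalised vectors
      have norm at most \<open>1\<close>, and their weighted \<open>l^q\<close>-mean is the
      \<open>l^q\<close>-norm of the original ones up to the factor
      \<open>A powr (1 / q)\<close>.\<close>
    define p where "p = (\<lambda>k. a k powr q / A)"
    have p1: "(\<Sum>k<n. p k) = 1"
      using A by (simp add: p_def sum_divide_distrib[symmetric] A_def[symmetric])
    have p_pos: "0 < p k" if "k < n" for k using a(1)[OF that] A by (simp add: p_def)
    have "Min (p ` {..<n}) > 0" using False p_pos by (subst Min_gr_iff) auto
    \<comment> \<open>\<open>J\<close> depends on the weights, but the geometric series gives a
      bound that does not depend on it.\<close>
    then obtain J where J: "(1 / 2) ^ J < Min (p ` {..<n})"
      using real_arch_pow_inv[of "Min (p ` {..<n})" "1/2"] by auto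
    have pJ: "(1 / 2) ^ J \<le> p k" if "k < n" for k
    proof -
      have "Min (p ` {..<n}) \<le> p k" using that by (intro Min_le) auto
      thus ?thesis by (meson J less_imp_le less_le_trans)
    qed
    define x where "x = (\<lambda>k. (1 / a k) *\<^sub>R \<bar>e k\<bar>)"
    define G where "G = (\<lambda>t. A powr (1 / q) * (\<Sum>j\<le>J. (4 * (1 / 2) powr (real j / q)) *
       sample_sup n p (\<lambda>k. (1 / a k) * \<bar>t k\<bar>) (2 ^ j) 0))"
    define y where "y = A powr (1 / q) *\<^sub>R (\<Sum>j\<le>J. (4 * (1 / 2) powr (real j / q)) *\<^sub>R
       sample_sup n p x (2 ^ j) 0)"
    have G: "lattice_term n e G y"
      unfolding G_def y_def x_def
      by (intro lattice_term_scale lattice_term_sum lattice_term_sample_sup lattice_term_abs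
          lattice_term_coord lattice_term_zero)
    have "lq_norm n q t \<le> G t" for t
    proof -
      have "p k * ((1 / a k) * \<bar>t k\<bar>) powr q = \<bar>t k\<bar> powr q / A" if "k < n" for k
        using a(1)[OF that] by (simp add: p_def powr_mult powr_divide)
      hence "(\<Sum>k<n. \<bar>t k\<bar> powr q) = A * (\<Sum>k<n. p k * ((1 / a k) * \<bar>t k\<bar>) powr q)"
        using A by (simp add: sum_divide_distrib[symmetric])
      hence "lq_norm n q t = A powr (1 / q) * (\<Sum>k<n. p k * ((1 / a k) * \<bar>t k\<bar>) powr q) powr (1 / q)"
        unfolding lq_norm_def using A p_pos
        by (simp add: powr_mult sum_nonneg less_imp_le)
      also have "\<dots> \<le> G t"
        unfolding G_def using pJ p1 a(1)[THEN less_imp_le] q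
        by (intro mult_left_mono weighted_lq_le_sample_sup) auto
      finally show ?thesis .
    qed
    note le = this
    have q0: "0 < q" using q by simp
    have "0 \<le> krivine n e (lq_norm n q)"
      using calculus_mono[OF krivine_is_calculus krivine_functions_zero krivine_functions_lq_norm[OF q0]]
        calculus_zero[OF krivine_is_calculus] by (metis lq_norm_def powr_ge_zero)
    moreover have "krivine n e (lq_norm n q) \<le> y"
      unfolding calculus_lattice_term[OF krivine_is_calculus G, symmetric]
      by (intro calculus_mono[OF krivine_is_calculus] krivine_functions_lq_norm q0
          lattice_term_krivine[OF G] le)
    ultimately have "norm (krivine n e (lq_norm n q)) \<le> norm y" by (rule norm_mono_nonneg)
    also have "\<dots> \<le> A powr (1 / q) * (\<Sum>j\<le>J. 4 * (1 / 2) powr (real j / q) * norm (sample_sup n p x (2 ^ j) 0))"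
      unfolding y_def norm_scaleR by (intro mult_mono order_trans[OF norm_sum] sum_mono) auto
    also have "\<dots> \<le> A powr (1 / q) * (\<Sum>j\<le>J. 4 * (1 / 2) powr (real j / q) * (\<bar>C\<bar> * (2 ^ j) powr (1 / r)))"
    proof (intro mult_left_mono sum_mono)
      fix j
      show "norm (sample_sup n p x (2 ^ j) 0) \<le> \<bar>C\<bar> * (2 ^ j) powr (1 / r)"
        using norm_sample_sup_le[OF U, of n p x 0 x "2 ^ j"] q p_pos p1 a
        by (simp add: x_def scaleR_nonneg_nonneg less_imp_le divide_le_eq)
    qed auto
    also have "(\<Sum>j\<le>J. 4 * (1 / 2) powr (real j / q) * (\<bar>C\<bar> * (2 ^ j) powr (1 / r))) = 4 * \<bar>C\<bar> * (\<Sum>j\<le>J. \<rho> ^ j)"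
    proof -
      have "(1 / 2) powr (real j / q) * (2 ^ j) powr (1 / r) = \<rho> ^ j" for j
      proof -
        have "(1 / 2) powr (real j / q) = 2 powr (- (real j / q))"
          by (simp add: powr_divide powr_minus_divide)
        moreover have "(2 ^ j) powr (1 / r) = (2::real) powr (real j / r)"
          by (simp add: powr_realpow[symmetric] powr_powr)
        moreover have "\<rho> ^ j = 2 powr (real j / r + - (real j / q))"
          using \<rho>(1) unfolding \<rho>_def
          by (simp add: powr_realpow[symmetric] powr_powr algebra_simps del: powr_realpow)
        ultimately show ?thesis by (simp add: powr_add[symmetric] add.commute)
      qed
      hence "4 * (1 / 2) powr (real j / q) * (\<bar>C\<bar> * (2 ^ j) powr (1 / r)) = 4 * \<bar>C\<bar> * \<rho> ^ j" for j
        by (metis mult.assoc mult.left_commute)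
      thus ?thesis by (simp only: sum_distrib_left)
    qed
    also have "A powr (1 / q) * (4 * \<bar>C\<bar> * (\<Sum>j\<le>J. \<rho> ^ j)) \<le> A powr (1 / q) * K"
    proof (rule mult_left_mono)
      have "(\<Sum>j\<le>J. \<rho> ^ j) \<le> (\<Sum>j. \<rho> ^ j)"
        using \<rho> by (intro sum_le_suminf summable_geometric) auto
      also have "\<dots> = 1 / (1 - \<rho>)" using \<rho> by (intro suminf_geometric) auto
      finally have "4 * \<bar>C\<bar> * (\<Sum>j\<le>J. \<rho> ^ j) \<le> 4 * \<bar>C\<bar> * (1 / (1 - \<rho>))"
        by (intro mult_left_mono) auto
      thus "4 * \<bar>C\<bar> * (\<Sum>j\<le>J. \<rho> ^ j) \<le> K" by (simp add: K_def)
    qed simp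
    finally show ?thesis by (simp add: A_def mult.commute)
  qed
  have "norm (krivine n e (lq_norm n q)) \<le> K * (\<Sum>k<n. norm (e k) powr q) powr (1 / q)" for n and e :: "nat \<Rightarrow> 'e"
    by (rule lq_bound_limit) (use q in \<open>auto intro!: main simp: add_nonneg_pos\<close>)
  thus ?thesis unfolding q_convex_lq_norm by blast
qed

lemma upper_estimate_mono:
  assumes "upper_estimate TYPE('e::banach_lattice) r C" "1 \<le> q" "q \<le> r"
  shows "upper_estimate TYPE('e) q \<bar>C\<bar>"
  unfolding upper_estimate_def
proof (intro allI impI)
  fix n and e :: "nat \<Rightarrow> 'e" assume e: "\<forall>i<n. 0 \<le> e i"
  have "(\<Sum>i<n. norm (e i) powr r) = (\<Sum>i<n. (norm (e i) powr q) powr (r / q))"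
    using assms by (simp add: powr_powr)
  also have "\<dots> \<le> (\<Sum>i<n. norm (e i) powr q) powr (r / q)"
    using assms by (intro sum_powr_le_powr_sum) auto
  finally have "(\<Sum>i<n. norm (e i) powr r) powr (1 / r) \<le> ((\<Sum>i<n. norm (e i) powr q) powr (r / q)) powr (1 / r)"
    using assms by (intro powr_mono2) (auto intro: sum_nonneg)
  also have "\<dots> = (\<Sum>i<n. norm (e i) powr q) powr (1 / q)"
    using assms by (simp add: powr_powr)
  finally have "C * (\<Sum>i<n. norm (e i) powr r) powr (1 / r) \<le> \<bar>C\<bar> * (\<Sum>i<n. norm (e i) powr q) powr (1 / q)"
    by (intro mult_mono) auto
  moreover have "norm (psup e {..<n}) \<le> C * (\<Sum>i<n. norm (e i) powr r) powr (1 / r)"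
    using e by (intro upper_estimateD[OF assms(1)]) auto
  ultimately show "norm (psup e {..<n}) \<le> \<bar>C\<bar> * (\<Sum>i<n. norm (e i) powr q) powr (1 / q)" by linarith
qed

subsection \<open>The strong integral\<close>

abbreviation "sbi \<equiv> Bochner_Integration.simple_bochner_integral"
abbreviation "sb_integrable \<equiv> Bochner_Integration.simple_bochner_integrable"

lemma strongly_measurable_simple: "simple_function M f \<Longrightarrow> strongly_measurable M f"
  unfolding strongly_measurable_def by (intro exI[of _ "\<lambda>_. f"]) auto

lemma strongly_measurable_compose:
  assumes "strongly_measurable M f" "strongly_measurable M g"
    and cont: "\<And>x y. isCont (\<lambda>p. \<phi> (fst p) (snd p)) (x, y)"
  shows "strongly_measurable M (\<lambda>x. \<phi> (f x) (g x))"
proof -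
  obtain s where s: "\<And>i. simple_function M (s i)" "AE x in M. (\<lambda>i. s i x) \<longlonglongrightarrow> f x"
    using assms(1) unfolding strongly_measurable_def by blast
  obtain t where t: "\<And>i. simple_function M (t i)" "AE x in M. (\<lambda>i. t i x) \<longlonglongrightarrow> g x"
    using assms(2) unfolding strongly_measurable_def by blast
  have "AE x in M. (\<lambda>i. \<phi> (s i x) (t i x)) \<longlonglongrightarrow> \<phi> (f x) (g x)"
    using s(2) t(2)
  proof eventually_elim
    case (elim x)
    have "(\<lambda>i. (\<lambda>p. \<phi> (fst p) (snd p)) (s i x, t i x)) \<longlonglongrightarrow> (\<lambda>p. \<phi> (fst p) (snd p)) (f x, g x)"
      by (intro isCont_tendsto_compose[OF cont] tendsto_Pair elim)
    thus ?case by simp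
  qed
  moreover have "simple_function M (\<lambda>x. \<phi> (s i x) (t i x))" for i
    using s(1) t(1) by (rule simple_function_compose2)
  ultimately show ?thesis unfolding strongly_measurable_def by (intro exI[of _ "\<lambda>i x. \<phi> (s i x) (t i x)"]) auto
qed

lemma strongly_measurable_diff:
  "strongly_measurable M f \<Longrightarrow> strongly_measurable M g \<Longrightarrow> strongly_measurable M (\<lambda>x. f x - g x)"
  by (rule strongly_measurable_compose) (auto intro: continuous_intros)

lemma strongly_measurable_add:
  "strongly_measurable M f \<Longrightarrow> strongly_measurable M g \<Longrightarrow> strongly_measurable M (\<lambda>x. f x + g x)"
  by (rule strongly_measurable_compose) (auto intro: continuous_intros)

text \<open>The approximation holds almost everywhere only, so the norm of \<open>f\<close> need not
  itself be measurable. A measurable version is enough for additivity of the nonnegative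
  integral.\<close>

lemma strongly_measurable_norm_AE:
  assumes "strongly_measurable M f"
  shows "\<exists>h. h \<in> borel_measurable M \<and> (AE x in M. ennreal (norm (f x)) = h x)"
proof -
  obtain s where s: "\<And>i. simple_function M (s i)" "AE x in M. (\<lambda>i. s i x) \<longlonglongrightarrow> f x"
    using assms unfolding strongly_measurable_def by blast
  define h where "h = (\<lambda>x. liminf (\<lambda>i. ennreal (norm (s i x))))"
  have "AE x in M. ennreal (norm (f x)) = h x"
    using s(2)
  proof eventually_elim
    case (elim x)
    hence "(\<lambda>i. ennreal (norm (s i x))) \<longlonglongrightarrow> ennreal (norm (f x))"
      by (intro tendsto_intros)
    thus ?case unfolding h_def by (metis lim_imp_Liminf sequentially_bot)
  qed
  moreover have "h \<in> borel_measurable M"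
  proof -
    have "(\<lambda>x. ennreal (norm (s i x))) \<in> borel_measurable M" for i
      using simple_function_compose1[OF s(1)[of i], of "\<lambda>v. ennreal (norm v)"]
      by (rule borel_measurable_simple_function)
    thus ?thesis unfolding h_def by measurable
  qed
  ultimately show ?thesis by blast
qed

lemma nn_integral_norm_triangle:
  fixes f g h :: "'a \<Rightarrow> 'b::real_normed_vector"
  assumes "strongly_measurable M f" "strongly_measurable M g"
    and le: "\<And>x. norm (h x) \<le> norm (f x) + norm (g x)"
  shows "(\<integral>\<^sup>+x. ennreal (norm (h x)) \<partial>M) \<le> (\<integral>\<^sup>+x. ennreal (norm (f x)) \<partial>M) + (\<integral>\<^sup>+x. ennreal (norm (g x)) \<partial>M)"
proof -
  obtain f' where f': "f' \<in> borel_measurable M" "AE x in M. ennreal (norm (f x)) = f' x"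
    using strongly_measurable_norm_AE[OF assms(1)] by blast
  obtain g' where g': "g' \<in> borel_measurable M" "AE x in M. ennreal (norm (g x)) = g' x"
    using strongly_measurable_norm_AE[OF assms(2)] by blast
  have "(\<integral>\<^sup>+x. ennreal (norm (h x)) \<partial>M) \<le> (\<integral>\<^sup>+x. f' x + g' x \<partial>M)"
  proof (rule nn_integral_mono_AE)
    show "AE x in M. ennreal (norm (h x)) \<le> f' x + g' x"
      using f'(2) g'(2)
    proof eventually_elim
      case (elim x)
      have "ennreal (norm (h x)) \<le> ennreal (norm (f x) + norm (g x))" by (intro ennreal_leI le)
      thus ?case using elim by simp
    qed
  qed
  also have "\<dots> = (\<integral>\<^sup>+x. f' x \<partial>M) + (\<integral>\<^sup>+x. g' x \<partial>M)"
    using f'(1) g'(1) by (rule nn_integral_add)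
  also have "(\<integral>\<^sup>+x. f' x \<partial>M) = (\<integral>\<^sup>+x. ennreal (norm (f x)) \<partial>M)"
    using f'(2) by (intro nn_integral_cong_AE) auto
  also have "(\<integral>\<^sup>+x. g' x \<partial>M) = (\<integral>\<^sup>+x. ennreal (norm (g x)) \<partial>M)"
    using g'(2) by (intro nn_integral_cong_AE) auto
  finally show ?thesis .
qed

lemma sb_integrable_simple: "sb_integrable M f \<Longrightarrow> simple_function M f"
  by (erule Bochner_Integration.simple_bochner_integrable.cases)

lemma norm_sbi_le: "sb_integrable M s \<Longrightarrow> ennreal (norm (sbi M s)) \<le> (\<integral>\<^sup>+x. ennreal (norm (s x)) \<partial>M)"
proof -
  assume s: "sb_integrable M s"
  have "sb_integrable M (\<lambda>x. norm (s x))"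
    using Bochner_Integration.simple_bochner_integrable_compose2[of "\<lambda>x y. norm x" M s s] s by simp
  hence "ennreal (sbi M (\<lambda>x. norm (s x))) = (\<integral>\<^sup>+x. ennreal (norm (s x)) \<partial>M)"
    by (intro Bochner_Integration.simple_bochner_integral_eq_nn_integral) auto
  thus ?thesis
    using Bochner_Integration.simple_bochner_integral_norm_bound[OF s] by (metis ennreal_leI)
qed

lemma sb_integrable_diff: "sb_integrable M s \<Longrightarrow> sb_integrable M t \<Longrightarrow> sb_integrable M (\<lambda>x. s x - t x)"
  using Bochner_Integration.simple_bochner_integrable_compose2[of "(-)" M s t] by simp

lemma norm_sbi_diff_le:
  assumes f: "strongly_measurable M f" and s: "sb_integrable M s" and t: "sb_integrable M t"
  shows "ennreal (norm (sbi M s - sbi M t))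
     \<le> (\<integral>\<^sup>+x. ennreal (norm (f x - s x)) \<partial>M) + (\<integral>\<^sup>+x. ennreal (norm (f x - t x)) \<partial>M)"
proof -
  have "ennreal (norm (sbi M s - sbi M t)) = ennreal (norm (sbi M (\<lambda>x. s x - t x)))"
    by (simp add: Bochner_Integration.simple_bochner_integral_diff s t)
  also have "\<dots> \<le> (\<integral>\<^sup>+x. ennreal (norm (s x - t x)) \<partial>M)"
    by (intro norm_sbi_le sb_integrable_diff s t)
  also have "\<dots> \<le> (\<integral>\<^sup>+x. ennreal (norm (f x - s x)) \<partial>M) + (\<integral>\<^sup>+x. ennreal (norm (f x - t x)) \<partial>M)"
  proof (intro nn_integral_norm_triangle strongly_measurable_diff f)
    show "norm (s x - t x) \<le> norm (f x - s x) + norm (f x - t x)" for x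
      using norm_triangle_ineq4[of "f x - t x" "f x - s x"] by simp
  qed (use s t in \<open>auto intro: strongly_measurable_simple sb_integrable_simple\<close>)
  finally show ?thesis .
qed

lemma has_strong_integral_unique:
  assumes "has_strong_integral M f I" "has_strong_integral M f J"
  shows "I = J"
proof -
  obtain s where s: "\<And>i. sb_integrable M (s i)" "(\<lambda>i. \<integral>\<^sup>+x. ennreal (norm (f x - s i x)) \<partial>M) \<longlonglongrightarrow> 0"
      "(\<lambda>i. sbi M (s i)) \<longlonglongrightarrow> I"
    using assms(1) unfolding has_strong_integral_def by blast
  obtain t where t: "\<And>i. sb_integrable M (t i)" "(\<lambda>i. \<integral>\<^sup>+x. ennreal (norm (f x - t i x)) \<partial>M) \<longlonglongrightarrow> 0"
      "(\<lambda>i. sbi M (t i)) \<longlonglongrightarrow> J"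
    using assms(2) unfolding has_strong_integral_def by blast
  have f: "strongly_measurable M f" using assms(1) by (simp add: has_strong_integral_def)
  have "(\<lambda>i. ennreal (norm (sbi M (s i) - sbi M (t i)))) \<longlonglongrightarrow> 0"
  proof (rule tendsto_sandwich[OF always_eventually always_eventually tendsto_const])
    show "(\<lambda>i. (\<integral>\<^sup>+x. ennreal (norm (f x - s i x)) \<partial>M) + (\<integral>\<^sup>+x. ennreal (norm (f x - t i x)) \<partial>M)) \<longlonglongrightarrow> 0"
      using tendsto_add[OF s(2) t(2)] by simp
  qed (auto intro: norm_sbi_diff_le f s t)
  moreover have "(\<lambda>i. ennreal (norm (sbi M (s i) - sbi M (t i)))) \<longlonglongrightarrow> ennreal (norm (I - J))"
    by (intro tendsto_intros s t)
  ultimately have "ennreal (norm (I - J)) = 0" using LIMSEQ_unique by blast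
  thus ?thesis by (simp add: ennreal_eq_0_iff)
qed

lemma strong_integral_eq: "has_strong_integral M f I \<Longrightarrow> strong_integral M f = I"
  unfolding strong_integral_def using has_strong_integral_unique by blast

section \<open>Existence of integrals and operations on them\<close>

lemma has_strong_integralI:
  fixes f :: "'a \<Rightarrow> 'b::banach"
  assumes f: "strongly_measurable M f" and s: "\<And>i. sb_integrable M (s i)"
    and lim: "(\<lambda>i. \<integral>\<^sup>+x. ennreal (norm (f x - s i x)) \<partial>M) \<longlonglongrightarrow> 0"
  shows "\<exists>I. has_strong_integral M f I \<and> (\<lambda>i. sbi M (s i)) \<longlonglongrightarrow> I"
proof -
  have "Cauchy (\<lambda>i. sbi M (s i))"
  proof (rule CauchyI)
    fix r :: real assume "r > 0"
    hence "\<forall>\<^sub>F i in sequentially. (\<integral>\<^sup>+x. ennreal (norm (f x - s i x)) \<partial>M) < ennreal (r / 2)"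
      by (intro order_tendstoD(2)[OF lim]) (simp add: ennreal_zero_less_divide)
    then obtain N where N: "\<And>i. i \<ge> N \<Longrightarrow> (\<integral>\<^sup>+x. ennreal (norm (f x - s i x)) \<partial>M) < ennreal (r / 2)"
      unfolding eventually_sequentially by blast
    have "norm (sbi M (s i) - sbi M (s j)) < r" if "i \<ge> N" "j \<ge> N" for i j
    proof -
      have "ennreal (norm (sbi M (s i) - sbi M (s j))) < ennreal (r / 2) + ennreal (r / 2)"
        using norm_sbi_diff_le[OF f s s, of i j] add_strict_mono[OF N[OF that(1)] N[OF that(2)]]
        by (rule le_less_trans)
      also have "\<dots> = ennreal r" using \<open>r > 0\<close> by (subst ennreal_plus[symmetric]) auto
      finally show ?thesis using \<open>r > 0\<close> by (simp add: ennreal_less_iff)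
    qed
    thus "\<exists>N. \<forall>i\<ge>N. \<forall>j\<ge>N. norm (sbi M (s i) - sbi M (s j)) < r" by blast
  qed
  then obtain I where I: "(\<lambda>i. sbi M (s i)) \<longlonglongrightarrow> I" using Cauchy_convergent convergent_def by blast
  thus ?thesis using f s lim unfolding has_strong_integral_def by blast
qed

text \<open>A map that is 1-Lipschitz in the value and fixes \<open>0\<close> preserves
  approximation by integrable simple functions. Its instances are the norm, the lattice modulus and
  the restriction to a set; the sequence \<open>s\<close> is part of the conclusion because sign and
  size of the new integral are read off from it.\<close>

lemma has_strong_integral_compose:
  fixes f :: "'a \<Rightarrow> 'b::real_normed_vector" and \<phi> :: "'a \<Rightarrow> 'b \<Rightarrow> 'c::banach"
  assumes I: "has_strong_integral M f I"
    and \<phi>: "\<And>x u v. norm (\<phi> x u - \<phi> x v) \<le> norm (u - v)" "\<And>x. \<phi> x 0 = 0"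
    and simple: "\<And>s. simple_function M s \<Longrightarrow> simple_function M (\<lambda>x. \<phi> x (s x))"
  shows "\<exists>J s. has_strong_integral M (\<lambda>x. \<phi> x (f x)) J \<and> (\<forall>i. sb_integrable M (s i)) \<and>
     (\<forall>i. sb_integrable M (\<lambda>x. \<phi> x (s i x))) \<and>
     (\<lambda>i. \<integral>\<^sup>+x. ennreal (norm (f x - s i x)) \<partial>M) \<longlonglongrightarrow> 0 \<and>
     (\<lambda>i. sbi M (\<lambda>x. \<phi> x (s i x))) \<longlonglongrightarrow> J"
proof -
  obtain s where s: "\<And>i. sb_integrable M (s i)" "(\<lambda>i. \<integral>\<^sup>+x. ennreal (norm (f x - s i x)) \<partial>M) \<longlonglongrightarrow> 0"
    using I unfolding has_strong_integral_def by blast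
  obtain t where t: "\<And>i. simple_function M (t i)" "AE x in M. (\<lambda>i. t i x) \<longlonglongrightarrow> f x"
    using I unfolding has_strong_integral_def strongly_measurable_def by blast
  have meas: "strongly_measurable M (\<lambda>x. \<phi> x (f x))"
    unfolding strongly_measurable_def
  proof (intro exI[of _ "\<lambda>i x. \<phi> x (t i x)"] conjI allI simple t(1))
    show "AE x in M. (\<lambda>i. \<phi> x (t i x)) \<longlonglongrightarrow> \<phi> x (f x)"
      using t(2)
    proof eventually_elim
      case (elim x)
      show ?case
      proof (rule Lim_null_comparison[THEN LIM_zero_cancel])
        show "(\<lambda>i. norm (t i x - f x)) \<longlonglongrightarrow> 0"
          using elim by (intro tendsto_norm_zero LIM_zero)
      qed (intro always_eventually allI \<phi>)
    qed
  qed
  have s': "sb_integrable M (\<lambda>x. \<phi> x (s i x))" for i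
  proof (rule Bochner_Integration.simple_bochner_integrable.intros)
    show sf: "simple_function M (\<lambda>x. \<phi> x (s i x))" by (intro simple sb_integrable_simple s)
    have "{x \<in> space M. s i x \<noteq> 0} \<in> sets M"
      using simple_functionD(2)[OF sb_integrable_simple[OF s(1)[of i]], of "- {0}"]
      by (simp add: vimage_def Collect_conj_eq Int_commute)
    hence "emeasure M {x \<in> space M. \<phi> x (s i x) \<noteq> 0} \<le> emeasure M {x \<in> space M. s i x \<noteq> 0}"
      using \<phi>(2) by (intro emeasure_mono) auto
    also have "\<dots> < \<infinity>"
      using s(1)[of i] by (auto simp: Bochner_Integration.simple_bochner_integrable.simps less_top)
    finally show "emeasure M {x \<in> space M. \<phi> x (s i x) \<noteq> 0} \<noteq> \<infinity>" by simp
  qed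
  have "(\<lambda>i. \<integral>\<^sup>+x. ennreal (norm (\<phi> x (f x) - \<phi> x (s i x))) \<partial>M) \<longlonglongrightarrow> 0"
    by (rule tendsto_sandwich[OF always_eventually always_eventually tendsto_const s(2)])
      (auto intro!: nn_integral_mono ennreal_leI \<phi>)
  from has_strong_integralI[OF meas s' this] show ?thesis using s s' by blast
qed

lemma has_strong_integral_simple:
  assumes "sb_integrable M s"
  shows "has_strong_integral M s (sbi M s)"
  unfolding has_strong_integral_def using assms
  by (intro conjI exI[of _ "\<lambda>_. s"]) (auto intro: strongly_measurable_simple sb_integrable_simple)

lemma has_strong_integral_add:
  assumes f: "has_strong_integral M f I" and g: "has_strong_integral M g J"
  shows "has_strong_integral M (\<lambda>x. f x + g x) (I + J)"
proof -
  obtain s where s: "\<And>i. sb_integrable M (s i)" "(\<lambda>i. \<integral>\<^sup>+x. ennreal (norm (f x - s i x)) \<partial>M) \<longlonglongrightarrow> 0"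
      "(\<lambda>i. sbi M (s i)) \<longlonglongrightarrow> I"
    using f unfolding has_strong_integral_def by blast
  obtain t where t: "\<And>i. sb_integrable M (t i)" "(\<lambda>i. \<integral>\<^sup>+x. ennreal (norm (g x - t i x)) \<partial>M) \<longlonglongrightarrow> 0"
      "(\<lambda>i. sbi M (t i)) \<longlonglongrightarrow> J"
    using g unfolding has_strong_integral_def by blast
  have meas: "strongly_measurable M f" "strongly_measurable M g"
    using f g by (auto simp: has_strong_integral_def)
  have smeas: "strongly_measurable M (s i)" "strongly_measurable M (t i)" for i
    using s(1) t(1) by (auto intro: strongly_measurable_simple sb_integrable_simple)
  have "(\<lambda>i. \<integral>\<^sup>+x. ennreal (norm ((f x + g x) - (s i x + t i x))) \<partial>M) \<longlonglongrightarrow> 0"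
  proof (rule tendsto_sandwich[OF always_eventually always_eventually tendsto_const])
    show "(\<lambda>i. (\<integral>\<^sup>+x. ennreal (norm (f x - s i x)) \<partial>M) + (\<integral>\<^sup>+x. ennreal (norm (g x - t i x)) \<partial>M)) \<longlonglongrightarrow> 0"
      using tendsto_add[OF s(2) t(2)] by simp
    show "\<forall>i. (\<integral>\<^sup>+x. ennreal (norm ((f x + g x) - (s i x + t i x))) \<partial>M)
        \<le> (\<integral>\<^sup>+x. ennreal (norm (f x - s i x)) \<partial>M) + (\<integral>\<^sup>+x. ennreal (norm (g x - t i x)) \<partial>M)"
      by (intro allI nn_integral_norm_triangle strongly_measurable_diff meas smeas norm_diff_triangle_ineq)
  qed simp
  moreover have "sb_integrable M (\<lambda>x. s i x + t i x)" for i
    using Bochner_Integration.simple_bochner_integrable_compose2[of "(+)" M "s i" "t i"] s t by simp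
  moreover have "(\<lambda>i. sbi M (\<lambda>x. s i x + t i x)) \<longlonglongrightarrow> I + J"
    using tendsto_add[OF s(3) t(3)] s(1) t(1)
    by (simp add: Bochner_Integration.simple_bochner_integral_add)
  ultimately show ?thesis
    unfolding has_strong_integral_def using strongly_measurable_add[OF meas]
    by (intro conjI exI[of _ "\<lambda>i x. s i x + t i x"]) auto
qed

lemma has_strong_integral_zero: "has_strong_integral M (\<lambda>x. 0) 0"
proof -
  have "sb_integrable M (\<lambda>x. 0)" by (intro Bochner_Integration.simple_bochner_integrable.intros) auto
  from has_strong_integral_simple[OF this] show ?thesis
    by (simp add: Bochner_Integration.simple_bochner_integral_def image_constant_conv split: if_splits)
qed

lemma has_strong_integral_sum:
  "(\<And>i. i \<in> A \<Longrightarrow> has_strong_integral M (f i) (I i)) \<Longrightarrow>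
     has_strong_integral M (\<lambda>x. \<Sum>i\<in>A. f i x) (\<Sum>i\<in>A. I i)"
  by (induction A rule: infinite_finite_induct)
    (auto intro: has_strong_integral_zero has_strong_integral_add)

lemma norm_strong_integral_le:
  assumes "has_strong_integral M f I"
  shows "ennreal (norm I) \<le> (\<integral>\<^sup>+x. ennreal (norm (f x)) \<partial>M)"
proof -
  obtain s where s: "\<And>i. sb_integrable M (s i)" "(\<lambda>i. \<integral>\<^sup>+x. ennreal (norm (f x - s i x)) \<partial>M) \<longlonglongrightarrow> 0"
      "(\<lambda>i. sbi M (s i)) \<longlonglongrightarrow> I"
    using assms unfolding has_strong_integral_def by blast
  have meas: "strongly_measurable M f" "strongly_measurable M (s i)" for i
    using assms s(1) by (auto simp: has_strong_integral_def intro: strongly_measurable_simple sb_integrable_simple)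
  have "ennreal (norm (sbi M (s i))) \<le> (\<integral>\<^sup>+x. ennreal (norm (f x)) \<partial>M) + (\<integral>\<^sup>+x. ennreal (norm (f x - s i x)) \<partial>M)" for i
  proof (rule order_trans[OF norm_sbi_le[OF s(1)]])
    show "(\<integral>\<^sup>+x. ennreal (norm (s i x)) \<partial>M) \<le> (\<integral>\<^sup>+x. ennreal (norm (f x)) \<partial>M) + (\<integral>\<^sup>+x. ennreal (norm (f x - s i x)) \<partial>M)"
    proof (intro nn_integral_norm_triangle meas strongly_measurable_diff)
      show "norm (s i x) \<le> norm (f x) + norm (f x - s i x)" for x
        using norm_triangle_ineq4[of "f x" "f x - s i x"] by simp
    qed
  qed
  moreover have "(\<lambda>i. (\<integral>\<^sup>+x. ennreal (norm (f x)) \<partial>M) + (\<integral>\<^sup>+x. ennreal (norm (f x - s i x)) \<partial>M))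
      \<longlonglongrightarrow> (\<integral>\<^sup>+x. ennreal (norm (f x)) \<partial>M) + 0"
    by (intro tendsto_add tendsto_const s)
  moreover have "(\<lambda>i. ennreal (norm (sbi M (s i)))) \<longlonglongrightarrow> ennreal (norm I)"
    by (intro tendsto_intros s)
  ultimately show ?thesis
    using LIMSEQ_le[of "\<lambda>i. ennreal (norm (sbi M (s i)))"] by auto
qed

lemma has_strong_integral_norm:
  fixes f :: "'a \<Rightarrow> 'b::real_normed_vector"
  assumes f: "has_strong_integral M f I"
  shows "\<exists>J. has_strong_integral M (\<lambda>x. norm (f x)) J \<and> 0 \<le> J \<and>
     ennreal J = (\<integral>\<^sup>+x. ennreal (norm (f x)) \<partial>M)"
proof -
  obtain J s where J: "has_strong_integral M (\<lambda>x. norm (f x)) J" and s: "\<And>i. sb_integrable M (s i)"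
      "\<And>i. sb_integrable M (\<lambda>x. norm (s i x))"
      "(\<lambda>i. \<integral>\<^sup>+x. ennreal (norm (f x - s i x)) \<partial>M) \<longlonglongrightarrow> 0" "(\<lambda>i. sbi M (\<lambda>x. norm (s i x))) \<longlonglongrightarrow> J"
    using has_strong_integral_compose[OF f, of "\<lambda>x. norm"] simple_function_compose1[of M _ norm]
      norm_triangle_ineq3 by auto
  have J0: "0 \<le> J" by (rule LIMSEQ_le_const[OF s(4)]) (auto intro: exI[of _ 0])
  have meas: "strongly_measurable M f" "strongly_measurable M (s i)" for i
    using f s(1) by (auto simp: has_strong_integral_def intro: strongly_measurable_simple sb_integrable_simple)
  have "(\<integral>\<^sup>+x. ennreal (norm (f x)) \<partial>M) \<le> ennreal (sbi M (\<lambda>x. norm (s i x))) + (\<integral>\<^sup>+x. ennreal (norm (f x - s i x)) \<partial>M)" for i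
  proof -
    have "(\<integral>\<^sup>+x. ennreal (norm (f x)) \<partial>M) \<le> (\<integral>\<^sup>+x. ennreal (norm (s i x)) \<partial>M) + (\<integral>\<^sup>+x. ennreal (norm (f x - s i x)) \<partial>M)"
    proof (intro nn_integral_norm_triangle meas strongly_measurable_diff)
      show "norm (f x) \<le> norm (s i x) + norm (f x - s i x)" for x
        using norm_triangle_ineq[of "s i x" "f x - s i x"] by simp
    qed
    also have "(\<integral>\<^sup>+x. ennreal (norm (s i x)) \<partial>M) = ennreal (sbi M (\<lambda>x. norm (s i x)))"
      using s(2) by (intro Bochner_Integration.simple_bochner_integral_eq_nn_integral[symmetric]) auto
    finally show ?thesis .
  qed
  moreover have "(\<lambda>i. ennreal (sbi M (\<lambda>x. norm (s i x))) + (\<integral>\<^sup>+x. ennreal (norm (f x - s i x)) \<partial>M)) \<longlonglongrightarrow> ennreal J + 0"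
    by (intro tendsto_add tendsto_ennrealI s)
  ultimately have "(\<integral>\<^sup>+x. ennreal (norm (f x)) \<partial>M) \<le> ennreal J"
    using LIMSEQ_le_const[of _ "ennreal J + 0"] by force
  moreover have "ennreal J \<le> (\<integral>\<^sup>+x. ennreal (norm (f x)) \<partial>M)"
    using norm_strong_integral_le[OF J] J0 by simp
  ultimately show ?thesis using J J0 by (intro exI[of _ J]) auto
qed

text \<open>Positivity is visible on simple functions and survives the limit because the cone is
  closed.\<close>

lemma has_strong_integral_abs:
  fixes f :: "'a \<Rightarrow> 'e::banach_lattice"
  assumes f: "has_strong_integral M f I"
  shows "\<exists>J. has_strong_integral M (\<lambda>x. \<bar>f x\<bar>) J \<and> 0 \<le> J"
proof -
  obtain J s where J: "has_strong_integral M (\<lambda>x. \<bar>f x\<bar>) J" and s: "(\<lambda>i. sbi M (\<lambda>x. \<bar>s i x\<bar>)) \<longlonglongrightarrow> J"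
    using has_strong_integral_compose[OF f, of "\<lambda>x u. \<bar>u\<bar>"] simple_function_compose1[of M _ abs]
      norm_abs_diff_le by auto
  have "0 \<le> sbi M (\<lambda>x. \<bar>s i x\<bar>)" for i
    unfolding Bochner_Integration.simple_bochner_integral_def
    by (intro sum_nonneg) (auto intro: scaleR_nonneg_nonneg)
  thus ?thesis using tendsto_nonneg_lattice[OF s] J by auto
qed

lemma has_strong_integral_restrict:
  fixes f :: "'a \<Rightarrow> 'b::banach"
  assumes f: "has_strong_integral M f I" and A: "A \<in> sets M"
  shows "\<exists>J. has_strong_integral M (\<lambda>x. indicator A x *\<^sub>R f x) J"
proof -
  have "simple_function M (\<lambda>x. indicator A x *\<^sub>R s x)" if "simple_function M s" for s :: "'a \<Rightarrow> 'b"
    using simple_function_compose2[OF simple_function_indicator[OF A] that, of "\<lambda>a b. a *\<^sub>R b"] by simp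
  moreover have "norm (indicat_real A x *\<^sub>R u - indicator A x *\<^sub>R v) \<le> norm (u - v)" for x and u v :: 'b
    by (auto split: split_indicator)
  ultimately show ?thesis
    using has_strong_integral_compose[OF f, of "\<lambda>x u. indicator A x *\<^sub>R u"] by auto
qed

lemma has_strong_integral_indicator:
  fixes c :: "'b::real_normed_vector"
  assumes A: "A \<in> sets M" "emeasure M A < \<infinity>"
  shows "has_strong_integral M (\<lambda>x. indicator A x *\<^sub>R c) (measure M A *\<^sub>R c)"
proof -
  have sf: "simple_function M (indicator A :: _ \<Rightarrow> real)" using A by simp
  have sf': "simple_function M (\<lambda>x. indicat_real A x *\<^sub>R c)"
    using simple_function_compose1[OF sf, of "\<lambda>a. a *\<^sub>R c"] by simp
  have sb: "sb_integrable M (\<lambda>x. indicat_real A x *\<^sub>R c)"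
  proof (rule Bochner_Integration.simple_bochner_integrable.intros[OF sf'])
    have "emeasure M {y \<in> space M. indicat_real A y *\<^sub>R c \<noteq> 0} \<le> emeasure M A"
      using A by (intro emeasure_mono) (auto simp: indicator_def)
    thus "emeasure M {y \<in> space M. indicat_real A y *\<^sub>R c \<noteq> 0} \<noteq> \<infinity>" using A by (auto simp: top_unique)
  qed
  have "sbi M (\<lambda>x. indicat_real A x *\<^sub>R c)
      = (\<Sum>y\<in>indicat_real A ` space M. measure M {x\<in>space M. indicat_real A x = y} *\<^sub>R (y *\<^sub>R c))"
    by (intro Bochner_Integration.simple_bochner_integral_partition[OF sb sf]) auto
  also have "\<dots> = (\<Sum>y\<in>{1}. measure M {x\<in>space M. indicat_real A x = y} *\<^sub>R (y *\<^sub>R c))"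
  proof (rule sum.mono_neutral_cong)
    show "measure M {x\<in>space M. indicat_real A x = i} *\<^sub>R (i *\<^sub>R c) = 0" if "i \<in> {1} - indicat_real A ` space M" for i
    proof -
      have "{x\<in>space M. indicat_real A x = i} = {}" using that by auto
      thus ?thesis by (simp only: measure_empty) simp
    qed
    show "finite (indicat_real A ` space M)" by (rule simple_functionD(1)[OF sf])
  qed (auto simp: indicator_def)
  also have "\<dots> = measure M {x\<in>space M. indicat_real A x = 1} *\<^sub>R c" by simp
  also have "{x\<in>space M. indicat_real A x = 1} = A"
    using sets.sets_into_space[OF A(1)] by (auto simp: indicator_def)
  finally have "sbi M (\<lambda>x. indicat_real A x *\<^sub>R c) = measure M A *\<^sub>R c" .
  thus ?thesis using has_strong_integral_simple[OF sb] by simp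
qed

subsection \<open>The Bellman function of the dyadic maximal operator\<close>

primrec dyadic_mean :: "nat \<Rightarrow> (nat \<Rightarrow> 'b::real_vector) \<Rightarrow> 'b" where
  "dyadic_mean 0 g = g 0"
| "dyadic_mean (Suc N) g = (1/2) *\<^sub>R (dyadic_mean N g + dyadic_mean N (\<lambda>j. g (j + 2 ^ N)))"

text \<open>The mean over the \<open>2 ^ N\<close> leaves of the \<open>p\<close>-th power of the
  norm of the maximal function along the path from the root, started from \<open>m\<close>. The
  recursion into the two half trees is the shape that the Bellman function needs.\<close>

primrec dyadic_payoff :: "real \<Rightarrow> nat \<Rightarrow> (nat \<Rightarrow> 'e::banach_lattice) \<Rightarrow> 'e \<Rightarrow> real" where
  "dyadic_payoff p 0 g m = norm (sup m (g 0)) powr p"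
| "dyadic_payoff p (Suc N) g m =
     (dyadic_payoff p N g (sup m (dyadic_mean (Suc N) g)) +
      dyadic_payoff p N (\<lambda>j. g (j + 2 ^ N)) (sup m (dyadic_mean (Suc N) g))) / 2"

lemma dyadic_mean_cong: "(\<And>j. j < 2 ^ N \<Longrightarrow> g j = h j) \<Longrightarrow> dyadic_mean N g = dyadic_mean N h"
proof (induction N arbitrary: g h)
  case (Suc N)
  have "dyadic_mean N g = dyadic_mean N h"
    by (intro Suc.IH Suc.prems) (simp add: trans_less_add1)
  moreover have "dyadic_mean N (\<lambda>j. g (j + 2 ^ N)) = dyadic_mean N (\<lambda>j. h (j + 2 ^ N))"
    by (intro Suc.IH Suc.prems) simp
  ultimately show ?case by simp
qed simp

lemma dyadic_payoff_cong:
  "(\<And>j. j < 2 ^ N \<Longrightarrow> g j = h j) \<Longrightarrow> dyadic_payoff p N g m = dyadic_payoff p N h m"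
proof (induction N arbitrary: g h m)
  case (Suc N)
  have "dyadic_payoff p N g m = dyadic_payoff p N h m" for m
    by (intro Suc.IH Suc.prems) (simp add: trans_less_add1)
  moreover have "dyadic_payoff p N (\<lambda>j. g (j + 2 ^ N)) m = dyadic_payoff p N (\<lambda>j. h (j + 2 ^ N)) m" for m
    by (intro Suc.IH Suc.prems) simp
  moreover have "dyadic_mean (Suc N) g = dyadic_mean (Suc N) h"
    by (intro dyadic_mean_cong Suc.prems)
  ultimately show ?case by (simp del: dyadic_mean.simps)
qed simp

lemma dyadic_mean_const: "dyadic_mean N (\<lambda>_. c) = c"
  by (induction N) (simp_all flip: scaleR_2)

lemma dyadic_payoff_const: "dyadic_payoff p N (\<lambda>_. c) m = norm (sup m c) powr p"
proof (induction N arbitrary: m)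
  case (Suc N)
  have "dyadic_mean (Suc N) (\<lambda>_. c) = c" by (rule dyadic_mean_const)
  then show ?case by (simp add: Suc.IH sup_assoc del: dyadic_mean.simps)
qed simp

text \<open>\<open>bellman p x a m r\<close>: on some finite binary tree there is a nonnegative function with mean \<open>x\<close>
  and mean \<open>p\<close>-th power of the norm at most \<open>a\<close>, whose maximal function, started from \<open>m\<close>, has mean
  \<open>p\<close>-th power of the norm \<open>r\<close>.\<close>

inductive bellman :: "real \<Rightarrow> 'e::banach_lattice \<Rightarrow> real \<Rightarrow> 'e \<Rightarrow> real \<Rightarrow> bool" for p where
  leaf: "0 \<le> x \<Longrightarrow> norm x powr p \<le> a \<Longrightarrow> bellman p x a m (norm (sup m x) powr p)"
| node: "bellman p x1 a1 (sup m ((1/2) *\<^sub>R (x1 + x2))) r1 \<Longrightarrow>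
    bellman p x2 a2 (sup m ((1/2) *\<^sub>R (x1 + x2))) r2 \<Longrightarrow>
    bellman p ((1/2) *\<^sub>R (x1 + x2)) ((a1 + a2) / 2) m ((r1 + r2) / 2)"

text \<open>The conclusion concerns all large depths because two subtrees have to be brought to a
  common depth before they are joined. Extending a leaf by constants changes neither the means nor
  the payoff.\<close>

lemma bellman_realize:
  "bellman p x a m r \<Longrightarrow> \<exists>N0. \<forall>N\<ge>N0. \<exists>g. (\<forall>j. 0 \<le> g j) \<and> dyadic_mean N g = x \<and>
     dyadic_mean N (\<lambda>j. norm (g j) powr p) \<le> a \<and> dyadic_payoff p N g m = r"
proof (induction rule: bellman.induct)
  case (leaf x a m)
  then show ?case
    by (intro exI[of _ 0] allI impI exI[of _ "\<lambda>_. x"])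
      (auto simp: dyadic_mean_const dyadic_payoff_const)
next
  case (node x1 a1 m x2 r1 a2 r2)
  define m' where "m' = sup m ((1/2) *\<^sub>R (x1 + x2))"
  obtain N1 where N1: "\<And>N. N \<ge> N1 \<Longrightarrow> \<exists>g. (\<forall>j. 0 \<le> g j) \<and> dyadic_mean N g = x1 \<and>
     dyadic_mean N (\<lambda>j. norm (g j) powr p) \<le> a1 \<and> dyadic_payoff p N g m' = r1"
    using node.IH(1) unfolding m'_def by blast
  obtain N2 where N2: "\<And>N. N \<ge> N2 \<Longrightarrow> \<exists>g. (\<forall>j. 0 \<le> g j) \<and> dyadic_mean N g = x2 \<and>
     dyadic_mean N (\<lambda>j. norm (g j) powr p) \<le> a2 \<and> dyadic_payoff p N g m' = r2"
    using node.IH(2) unfolding m'_def by blast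
  show ?case
  proof (intro exI[of _ "Suc (max N1 N2)"] allI impI)
    fix N' assume "N' \<ge> Suc (max N1 N2)"
    then obtain N where N: "N' = Suc N" "N \<ge> N1" "N \<ge> N2" by (cases N') auto
    obtain g where g: "\<forall>j. 0 \<le> g j" "dyadic_mean N g = x1"
      "dyadic_mean N (\<lambda>j. norm (g j) powr p) \<le> a1" "dyadic_payoff p N g m' = r1"
      using N1[OF N(2)] by blast
    obtain h where h: "\<forall>j. 0 \<le> h j" "dyadic_mean N h = x2"
      "dyadic_mean N (\<lambda>j. norm (h j) powr p) \<le> a2" "dyadic_payoff p N h m' = r2"
      using N2[OF N(3)] by blast
    define f where "f = (\<lambda>j. if j < 2 ^ N then g j else h (j - 2 ^ N))"
    have f1: "dyadic_mean N f = x1" "dyadic_mean N (\<lambda>j. norm (f j) powr p) \<le> a1" "dyadic_payoff p N f m' = r1"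
      using g dyadic_mean_cong[of N f g] dyadic_payoff_cong[of N f g p m']
        dyadic_mean_cong[of N "\<lambda>j. norm (f j) powr p" "\<lambda>j. norm (g j) powr p"] by (auto simp: f_def)
    have f2: "(\<lambda>j. f (j + 2 ^ N)) = h" by (simp add: f_def)
    have f2': "(\<lambda>j. norm (f (j + 2 ^ N)) powr p) = (\<lambda>j. norm (h j) powr p)" by (simp add: f_def)
    have m: "dyadic_mean N' f = (1/2) *\<^sub>R (x1 + x2)"
      using f1 f2 h by (simp add: N(1))
    have "dyadic_payoff p N' f m = (r1 + r2) / 2"
      using f1(3) h(4) m unfolding N(1) dyadic_payoff.simps f2 by (simp add: m'_def)
    moreover have "dyadic_mean N' (\<lambda>j. norm (f j) powr p) \<le> (a1 + a2) / 2"
      using f1(2) h(3) unfolding N(1) dyadic_mean.simps f2' by simp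
    ultimately show "\<exists>g. (\<forall>j. 0 \<le> g j) \<and> dyadic_mean N' g = (1/2) *\<^sub>R (x1 + x2) \<and>
        dyadic_mean N' (\<lambda>j. norm (g j) powr p) \<le> (a1 + a2) / 2 \<and> dyadic_payoff p N' g m = (r1 + r2) / 2"
      using g(1) h(1) m by (intro exI[of _ f]) (auto simp: f_def)
  qed
qed

lemma bellman_mono:
  assumes "bellman p x a m r" "0 \<le> m" "m \<le> m'" "0 \<le> p"
  shows "\<exists>r'\<ge>r. bellman p x a m' r'"
  using assms(1-3)
proof (induction arbitrary: m' rule: bellman.induct)
  case (leaf x a m)
  have "norm (sup m x) \<le> norm (sup m' x)"
    using leaf by (intro norm_mono_nonneg sup_mono) (auto intro: le_supI1)
  thus ?case using bellman.leaf[OF leaf(1,2), of m'] assms(4)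
    by (intro exI[of _ "norm (sup m' x) powr p"]) (auto intro: powr_mono2)
next
  case (node x1 a1 m x2 r1 a2 r2)
  let ?x = "(1/2) *\<^sub>R (x1 + x2)"
  have le: "0 \<le> sup m ?x" "sup m ?x \<le> sup m' ?x"
    using node.prems by (auto intro: le_supI1 sup_mono)
  obtain r1' where "r1' \<ge> r1" "bellman p x1 a1 (sup m' ?x) r1'" using node.IH(1)[OF le] by blast
  moreover obtain r2' where "r2' \<ge> r2" "bellman p x2 a2 (sup m' ?x) r2'" using node.IH(2)[OF le] by blast
  ultimately show ?case
    by (intro exI[of _ "(r1' + r2') / 2"] conjI bellman.node) auto
qed

text \<open>The root contributes its own mean \<open>x\<close> to the running supremum anyway, so
  \<open>x\<close> may be dropped from the starting value.\<close>

lemma bellman_sup_mean: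
  assumes "bellman p x a m r" "m = sup m0 x"
  shows "bellman p x a m0 r"
  using assms
proof cases
  case leaf
  then show ?thesis using bellman.leaf[of x p a m0] assms(2) by (simp add: sup_assoc)
next
  case (node x1 a1 x2 r1 a2 r2)
  have "sup m ((1/2) *\<^sub>R (x1 + x2)) = sup m0 ((1/2) *\<^sub>R (x1 + x2))"
    using assms(2) node(1) by (simp add: sup_assoc)
  hence "bellman p ((1/2) *\<^sub>R (x1 + x2)) ((a1 + a2) / 2) m0 ((r1 + r2) / 2)"
    using node(4,5) by (intro bellman.node) simp_all
  thus ?thesis by (simp only: node(1-3))
qed

lemma powr_convex_nonneg:
  fixes a b u v p :: real
  assumes "1 \<le> p" "0 \<le> a" "0 \<le> b" "0 \<le> u" "0 \<le> v" "u + v = 1"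
  shows "(u * a + v * b) powr p \<le> u * a powr p + v * b powr p"
proof -
  have small: "(v * b) powr p \<le> v * b powr p" if "0 \<le> v" "v \<le> 1" "0 \<le> b" for v b :: real
  proof -
    have "v powr p \<le> v" using that assms(1)
      by (cases "v = 0") (auto intro!: powr_le_one_le)
    thus ?thesis using that by (simp add: powr_mult mult_right_mono)
  qed
  consider "a = 0" | "b = 0" | "a > 0" "b > 0" using assms by linarith
  then show ?thesis
  proof cases
    case 1
    then show ?thesis using small[of v b] assms by simp
  next
    case 2
    then show ?thesis using small[of u a] assms by simp
  next
    case 3
    have "convex_on {0<..} (\<lambda>x. x powr p)" by (rule powr_convex[OF assms(1)])
    from convex_onD[OF this, of v a b] 3 assms show ?thesis
      by (auto simp: eq_diff_eq[symmetric] add.commute)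
  qed
qed

text \<open>By Jensen's inequality, for \<open>1 \<le> p\<close> these are the only pairs that can
  occur as a mean and a bound for the mean \<open>p\<close>-th power of the norm.\<close>

definition bellman_domain :: "real \<Rightarrow> ('e::banach_lattice \<times> real) set" where
  "bellman_domain p = {(x, a). 0 \<le> x \<and> norm x powr p \<le> a}"

lemma convex_bellman_domain:
  assumes "1 \<le> p"
  shows "convex (bellman_domain p :: ('e::banach_lattice \<times> real) set)"
proof (rule convexI)
  fix y z :: "'e \<times> real" and u v :: real
  assume yz: "y \<in> bellman_domain p" "z \<in> bellman_domain p" and uv: "0 \<le> u" "0 \<le> v" "u + v = 1"
  have "norm (u *\<^sub>R fst y + v *\<^sub>R fst z) powr p \<le> (u * norm (fst y) + v * norm (fst z)) powr p"
    using uv assms norm_triangle_ineq[of "u *\<^sub>R fst y" "v *\<^sub>R fst z"] by (intro powr_mono2) auto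
  also have "\<dots> \<le> u * norm (fst y) powr p + v * norm (fst z) powr p"
    using uv assms by (intro powr_convex_nonneg) auto
  also have "\<dots> \<le> u * snd y + v * snd z"
    using yz uv by (intro add_mono mult_left_mono) (auto simp: bellman_domain_def)
  finally show "u *\<^sub>R y + v *\<^sub>R z \<in> bellman_domain p"
    using yz uv by (auto simp: bellman_domain_def intro!: add_nonneg_nonneg scaleR_nonneg_nonneg)
qed

section \<open>The Bellman function and its concavity\<close>

definition bellman_value :: "real \<Rightarrow> 'e::banach_lattice \<Rightarrow> 'e \<times> real \<Rightarrow> real" where
  "bellman_value p m z = Sup {r. bellman p (fst z) (snd z) m r}"

text \<open>No continuity is known for the Bellman function; nonnegativity takes its place. The
  difference \<open>g\<close> from the chord vanishes at both ends and is at least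
  \<open>- B\<close>, and each doubling of \<open>t\<close> towards one of the ends halves this
  lower bound.\<close>

lemma midpoint_concave_ge:
  fixes f :: "real \<Rightarrow> real"
  assumes mid: "\<And>s t. s \<in> {0..1} \<Longrightarrow> t \<in> {0..1} \<Longrightarrow> f s + f t \<le> 2 * f ((s + t) / 2)"
    and nonneg: "\<And>t. t \<in> {0..1} \<Longrightarrow> 0 \<le> f t" and t: "t \<in> {0..1}"
  shows "(1 - t) * f 0 + t * f 1 \<le> f t"
proof -
  define g where "g = (\<lambda>t. f t - ((1 - t) * f 0 + t * f 1))"
  have g_mid: "g s + g t \<le> 2 * g ((s + t) / 2)" if "s \<in> {0..1}" "t \<in> {0..1}" for s t
    using mid[OF that] by (simp add: g_def field_simps)
  have g01: "g 0 = 0" "g 1 = 0" by (simp_all add: g_def)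
  define B where "B = f 0 + f 1"
  have bd: "- (B * (1/2) ^ n) \<le> g t" if "t \<in> {0..1}" for t n
    using that
  proof (induction n arbitrary: t)
    case 0
    have "0 \<le> f 0" "0 \<le> f 1" using nonneg by simp_all
    hence "(1 - t) * f 0 \<le> 1 * f 0" "t * f 1 \<le> 1 * f 1"
      using 0 by (intro mult_right_mono; simp)+
    thus ?case using nonneg[OF 0] by (simp add: g_def B_def)
  next
    case (Suc n)
    show ?case
    proof (cases "t \<le> 1/2")
      case True
      have "g 0 + g (2 * t) \<le> 2 * g ((0 + 2 * t) / 2)" using True Suc.prems by (intro g_mid) auto
      moreover have "- (B * (1/2) ^ n) \<le> g (2 * t)" using True Suc.prems by (intro Suc.IH) auto
      ultimately show ?thesis using g01 by simp
    next
      case False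
      have "g (2 * t - 1) + g 1 \<le> 2 * g (((2 * t - 1) + 1) / 2)" using False Suc.prems by (intro g_mid) auto
      moreover have "- (B * (1/2) ^ n) \<le> g (2 * t - 1)" using False Suc.prems by (intro Suc.IH) auto
      ultimately show ?thesis using g01 by simp
    qed
  qed
  have "(\<lambda>n. - (B * (1/2) ^ n)) \<longlonglongrightarrow> - (B * 0)"
    by (intro tendsto_intros LIMSEQ_realpow_zero) auto
  hence "- (B * 0) \<le> g t" using bd[OF t] by (intro LIMSEQ_le_const2) auto
  thus ?thesis by (simp add: g_def)
qed

text \<open>Isolates what the later arguments take from the Hardy--Littlewood property: an
  inequality on binary trees whose constant \<open>K\<close> does not depend on the depth.\<close>

locale dyadic_maximal_bound =
  fixes E :: "'e::banach_lattice itself" and p K :: real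
  assumes p: "1 \<le> p"
    and max_ineq: "\<And>N (g :: nat \<Rightarrow> 'e). (\<And>j. 0 \<le> g j) \<Longrightarrow>
      dyadic_payoff p N g 0 \<le> K * dyadic_mean N (\<lambda>j. norm (g j) powr p)"
    and K: "0 \<le> K"
begin

lemma bellman_bound0: "bellman p (x::'e) a 0 r \<Longrightarrow> r \<le> K * a"
proof -
  assume "bellman p x a 0 r"
  then obtain N and g :: "nat \<Rightarrow> 'e" where g: "\<And>j. 0 \<le> g j"
    "dyadic_mean N (\<lambda>j. norm (g j) powr p) \<le> a" "dyadic_payoff p N g 0 = r"
    using bellman_realize by blast
  show ?thesis
    using max_ineq[of g N] g mult_left_mono[OF g(2) K] by simp
qed

text \<open>The hypothesis speaks of the starting value \<open>0\<close> only. With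
  \<open>m1 = 0\<close> this lemma makes the Bellman function finite at every positive starting
  value; a general \<open>m1\<close> is needed because in the induction the averages accumulate
  there while \<open>m0\<close> stays fixed.\<close>

lemma bellman_shift:
  assumes "bellman p (x::'e) a m r" "0 \<le> m" "m \<le> m0 + m1" "0 \<le> m0" "0 \<le> m1"
  shows "\<exists>r'. bellman p x a m1 r' \<and> r \<le> 2 powr p * (norm m0 powr p + r')"
  using assms
proof (induction arbitrary: m1 rule: bellman.induct)
  case (leaf x a m)
  have "sup m x \<le> m0 + sup m1 x"
    using leaf(4-6) by (intro sup_least order_trans[OF leaf(4)] add_left_mono)
      (auto intro: add_increasing le_supI2)
  hence "norm (sup m x) \<le> norm (m0 + sup m1 x)"
    using leaf by (intro norm_mono_nonneg) (auto intro: le_supI1)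
  also have "\<dots> \<le> norm m0 + norm (sup m1 x)" by (rule norm_triangle_ineq)
  also have "\<dots> \<le> 2 * max (norm m0) (norm (sup m1 x))" by simp
  finally have "norm (sup m x) powr p \<le> (2 * max (norm m0) (norm (sup m1 x))) powr p"
    using p by (intro powr_mono2) auto
  also have "\<dots> = 2 powr p * max (norm m0) (norm (sup m1 x)) powr p"
    by (intro powr_mult)
  also have "max (norm m0) (norm (sup m1 x)) powr p \<le> norm m0 powr p + norm (sup m1 x) powr p"
    by (simp add: max_def)
  finally show ?case using bellman.leaf[OF leaf(1,2), of m1] by (auto simp: mult_left_mono)
next
  case (node x1 a1 m x2 r1 a2 r2)
  let ?x = "(1/2) *\<^sub>R (x1 + x2)"
  have le: "0 \<le> sup m ?x" "sup m ?x \<le> m0 + sup m1 ?x" "0 \<le> sup m1 ?x"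
    using node.prems by (auto intro: le_supI1 intro!: sup_least order_trans[OF node.prems(2)] add_left_mono
        add_increasing)
  obtain r1' where r1: "bellman p x1 a1 (sup m1 ?x) r1'" "r1 \<le> 2 powr p * (norm m0 powr p + r1')"
    using node.IH(1)[OF le(1,2) node.prems(3) le(3)] by blast
  obtain r2' where r2: "bellman p x2 a2 (sup m1 ?x) r2'" "r2 \<le> 2 powr p * (norm m0 powr p + r2')"
    using node.IH(2)[OF le(1,2) node.prems(3) le(3)] by blast
  have "(r1 + r2) / 2 \<le> 2 powr p * (norm m0 powr p + (r1' + r2') / 2)"
  proof -
    have "2 powr p * (norm m0 powr p + (r1' + r2') / 2)
        = (2 powr p * (norm m0 powr p + r1') + 2 powr p * (norm m0 powr p + r2')) / 2"
      by (simp add: field_simps)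
    thus ?thesis using r1(2) r2(2) by simp
  qed
  thus ?case using bellman.node[OF r1(1) r2(1)] by blast
qed

lemma bellman_bdd:
  assumes "0 \<le> m"
  shows "bdd_above {r. bellman p (x::'e) a m r}"
proof (rule bdd_aboveI)
  fix r assume "r \<in> {r. bellman p x a m r}"
  then obtain r' where r': "bellman p x a 0 r'" "r \<le> 2 powr p * (norm m powr p + r')"
    using bellman_shift[of x a m r m 0] assms by auto
  have "2 powr p * (norm m powr p + r') \<le> 2 powr p * (norm m powr p + K * a)"
    using bellman_bound0[OF r'(1)] by (intro mult_left_mono) auto
  thus "r \<le> 2 powr p * (norm m powr p + K * a)" using r'(2) by linarith
qed

lemma bellman_value_upper:
  "0 \<le> m \<Longrightarrow> bellman p (fst z) (snd z) m r \<Longrightarrow> r \<le> bellman_value p m (z :: 'e \<times> real)"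
  unfolding bellman_value_def by (intro cSup_upper bellman_bdd) auto

lemma bellman_value_least:
  assumes "z \<in> bellman_domain p" "\<And>r. bellman p (fst z) (snd z) m r \<Longrightarrow> r \<le> y"
  shows "bellman_value p m (z :: 'e \<times> real) \<le> y"
proof -
  have "bellman p (fst z) (snd z) m (norm (sup m (fst z)) powr p)"
    using assms(1) by (intro bellman.leaf) (auto simp: bellman_domain_def)
  thus ?thesis unfolding bellman_value_def using assms(2) by (intro cSup_least) auto
qed

lemma bellman_value_ge_leaf:
  assumes "0 \<le> m" "z \<in> bellman_domain p"
  shows "norm (sup m (fst z)) powr p \<le> bellman_value p m (z :: 'e \<times> real)"
  using assms by (intro bellman_value_upper bellman.leaf) (auto simp: bellman_domain_def)

lemma bellman_value_sup_mean:
  assumes "0 \<le> m" "z \<in> bellman_domain p"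
  shows "bellman_value p (sup m (fst z)) (z :: 'e \<times> real) \<le> bellman_value p m z"
proof (rule bellman_value_least[OF assms(2)])
  fix r assume "bellman p (fst z) (snd z) (sup m (fst z)) r"
  from bellman_sup_mean[OF this refl] show "r \<le> bellman_value p m z"
    by (rule bellman_value_upper[OF assms(1)])
qed

lemma bellman_value_bound:
  "z \<in> bellman_domain p \<Longrightarrow> bellman_value p 0 (z :: 'e \<times> real) \<le> K * snd z"
  by (intro bellman_value_least bellman_bound0)

text \<open>Joining two trees at a new root raises their starting value by the mean at the root,
  which can only increase the payoffs.\<close>

lemma bellman_value_midpoint:
  assumes m: "0 \<le> m" and y: "y \<in> bellman_domain p" and z: "z \<in> bellman_domain p"
  shows "bellman_value p m y + bellman_value p m z \<le> 2 * bellman_value p m ((1/2) *\<^sub>R (y + z :: 'e \<times> real))"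
proof -
  let ?v = "(1/2) *\<^sub>R (y + z)"
  have *: "r + s \<le> 2 * bellman_value p m ?v"
    if r: "bellman p (fst y) (snd y) m r" and s: "bellman p (fst z) (snd z) m s" for r s
  proof -
    let ?m = "sup m ((1/2) *\<^sub>R (fst y + fst z))"
    obtain r' where r': "r' \<ge> r" "bellman p (fst y) (snd y) ?m r'"
      using bellman_mono[OF r m, of ?m] p by auto
    obtain s' where s': "s' \<ge> s" "bellman p (fst z) (snd z) ?m s'"
      using bellman_mono[OF s m, of ?m] p by auto
    have "bellman p (fst ?v) (snd ?v) m ((r' + s') / 2)"
      using bellman.node[OF r'(2) s'(2)] by simp
    from bellman_value_upper[OF m this] show ?thesis using r'(1) s'(1) by simp
  qed
  have "bellman_value p m y \<le> 2 * bellman_value p m ?v - bellman_value p m z"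
  proof (rule bellman_value_least[OF y])
    fix r assume r: "bellman p (fst y) (snd y) m r"
    have "bellman_value p m z \<le> 2 * bellman_value p m ?v - r"
      by (rule bellman_value_least[OF z]) (use *[OF r] in fastforce)
    thus "r \<le> 2 * bellman_value p m ?v - bellman_value p m z" by simp
  qed
  thus ?thesis by simp
qed

lemma concave_on_bellman_value:
  assumes m: "0 \<le> m"
  shows "concave_on (bellman_domain p) (bellman_value p (m :: 'e))"
  unfolding concave_on_iff
proof (intro conjI ballI allI impI convex_bellman_domain p)
  fix y z :: "'e \<times> real" and u v :: real
  assume yz: "y \<in> bellman_domain p" "z \<in> bellman_domain p" and uv: "0 \<le> u" "0 \<le> v" "u + v = 1"
  define f where "f = (\<lambda>t. bellman_value p m ((1 - t) *\<^sub>R y + t *\<^sub>R z))"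
  have dom: "(1 - t) *\<^sub>R y + t *\<^sub>R z \<in> bellman_domain p" if "t \<in> {0..1}" for t
    using that yz by (intro convexD[OF convex_bellman_domain[OF p]]) auto
  have "(1 - v) * f 0 + v * f 1 \<le> f v"
  proof (rule midpoint_concave_ge)
    fix s t :: real assume st: "s \<in> {0..1}" "t \<in> {0..1}"
    have "(1/2) *\<^sub>R (((1 - s) *\<^sub>R y + s *\<^sub>R z) + ((1 - t) *\<^sub>R y + t *\<^sub>R z))
        = (1/2 * ((1 - s) + (1 - t))) *\<^sub>R y + (1/2 * (s + t)) *\<^sub>R z"
      by (simp only: scaleR_add_right scaleR_add_left scaleR_scaleR[symmetric] add_ac)
    also have "\<dots> = (1 - (s + t) / 2) *\<^sub>R y + ((s + t) / 2) *\<^sub>R z"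
      by (intro arg_cong2[of _ _ _ _ "(+)"] arg_cong2[of _ _ _ _ scaleR]) (auto simp: field_simps)
    finally show "f s + f t \<le> 2 * f ((s + t) / 2)"
      using bellman_value_midpoint[OF m dom[OF st(1)] dom[OF st(2)]] by (simp add: f_def)
  next
    show "0 \<le> f t" if "t \<in> {0..1}" for t
      using bellman_value_ge_leaf[OF m dom[OF that]] unfolding f_def
      by (rule order_trans[rotated]) simp
  qed (use uv in auto)
  moreover have "u = 1 - v" using uv by simp
  ultimately show "u * bellman_value p m y + v * bellman_value p m z \<le> bellman_value p m (u *\<^sub>R y + v *\<^sub>R z)"
    by (simp add: f_def)
qed

text \<open>One node with children of arbitrary weights: concavity is applied with the mean already
  included in the starting value, and the mean is then dropped. The point \<open>y\<close> is given
  by an equation without division, so single weights may vanish.\<close>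

lemma bellman_value_jensen:
  fixes z :: "'i \<Rightarrow> 'e \<times> real"
  assumes "finite I" "\<And>i. i \<in> I \<Longrightarrow> 0 \<le> w i" "0 < sum w I" "\<And>i. i \<in> I \<Longrightarrow> z i \<in> bellman_domain p"
    and m: "0 \<le> m" and y: "sum w I *\<^sub>R y = (\<Sum>i\<in>I. w i *\<^sub>R z i)"
  shows "(\<Sum>i\<in>I. w i * bellman_value p (sup m (fst y)) (z i)) \<le> sum w I * bellman_value p m y"
    and "y \<in> bellman_domain p"
proof -
  define W where "W = sum w I"
  define m' where "m' = sup m (fst y)"
  have m': "0 \<le> m'" using m by (auto simp: m'_def intro: le_supI1)
  have W: "W > 0" using assms(3) by (simp add: W_def)
  have y_eq: "y = (\<Sum>i\<in>I. (w i / W) *\<^sub>R z i)"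
  proof -
    have "y = (1 / W) *\<^sub>R (W *\<^sub>R y)" using W by simp
    also have "\<dots> = (\<Sum>i\<in>I. (w i / W) *\<^sub>R z i)"
      unfolding W_def y by (simp add: scaleR_sum_right)
    finally show ?thesis .
  qed
  have one: "(\<Sum>i\<in>I. w i / W) = 1" using W by (simp add: sum_divide_distrib[symmetric] W_def)
  have ne: "I \<noteq> {}" using assms(3) by auto
  show dom: "y \<in> bellman_domain p"
    unfolding y_eq using assms W one by (intro convex_sum convex_bellman_domain p) auto
  have "(\<Sum>i\<in>I. w i / W * bellman_value p m' (z i)) \<le> bellman_value p m' y"
    unfolding y_eq using assms W one
    by (intro concave_on_sum[OF _ ne concave_on_bellman_value[OF m']]) auto
  also have "\<dots> \<le> bellman_value p m y"
    unfolding m'_def using m dom by (rule bellman_value_sup_mean)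
  finally have "W * (\<Sum>i\<in>I. w i / W * bellman_value p m' (z i)) \<le> W * bellman_value p m y"
    using W by (intro mult_left_mono) auto
  moreover have "W * (\<Sum>i\<in>I. w i / W * bellman_value p m' (z i)) = (\<Sum>i\<in>I. w i * bellman_value p m' (z i))"
    using W by (simp add: sum_distrib_left)
  ultimately show "(\<Sum>i\<in>I. w i * bellman_value p (sup m (fst y)) (z i)) \<le> sum w I * bellman_value p m y"
    by (simp add: m'_def W_def)
qed

end

subsection \<open>Maximal inequalities on laminar families\<close>

text \<open>The empty set is excluded so that two members with a common submember are always
  comparable.\<close>

definition laminar :: "'a set set \<Rightarrow> bool" where
  "laminar D \<longleftrightarrow> {} \<notin> D \<and> (\<forall>A\<in>D. \<forall>B\<in>D. A \<subseteq> B \<or> B \<subseteq> A \<or> A \<inter> B = {})"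

definition maxl :: "'a set set \<Rightarrow> 'a set set" where
  "maxl F = {Q\<in>F. \<forall>R\<in>F. Q \<subseteq> R \<longrightarrow> R = Q}"

definition below_sum :: "'a set set \<Rightarrow> ('a set \<Rightarrow> 'b::comm_monoid_add) \<Rightarrow> 'a set \<Rightarrow> 'b" where
  "below_sum D f Q = (\<Sum>i\<in>{i\<in>D. i \<subseteq> Q}. f i)"

lemma maxl_above:
  assumes "finite F" "Q \<in> F"
  shows "\<exists>c\<in>maxl F. Q \<subseteq> c"
proof -
  obtain m where "m \<in> F" "Q \<subseteq> m" "\<forall>R\<in>F. m \<subseteq> R \<longrightarrow> m = R"
    using finite_has_maximal2[OF assms] by auto
  thus ?thesis by (intro bexI[of _ m]) (simp_all add: maxl_def eq_commute)
qed

lemma laminar_nested: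
  assumes "laminar D" "i \<in> D" "A \<in> D" "B \<in> D" "i \<subseteq> A" "i \<subseteq> B"
  shows "A \<subseteq> B \<or> B \<subseteq> A"
proof -
  have "i \<noteq> {}" using assms(1,2) by (auto simp: laminar_def)
  hence "A \<inter> B \<noteq> {}" using assms(5,6) by (metis le_inf_iff subset_empty)
  moreover have "A \<subseteq> B \<or> B \<subseteq> A \<or> A \<inter> B = {}" using assms(1,3,4) unfolding laminar_def by blast
  ultimately show ?thesis by blast
qed

lemma maxlD: "c \<in> maxl F \<Longrightarrow> c \<in> F" "c \<in> maxl F \<Longrightarrow> R \<in> F \<Longrightarrow> c \<subseteq> R \<Longrightarrow> R = c"
  by (simp_all add: maxl_def)

text \<open>Every member below \<open>G\<close> lies below exactly one maximal member of
  \<open>G\<close>.\<close>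

lemma laminar_sum_maxl:
  assumes "finite D" "laminar D" "G \<subseteq> D"
  shows "(\<Sum>i\<in>{i\<in>D. \<exists>Q\<in>G. i \<subseteq> Q}. f i) = (\<Sum>c\<in>maxl G. below_sum D f c)"
proof -
  have fin: "finite G" using assms(1,3) by (rule finite_subset[rotated])
  have "{i\<in>D. \<exists>Q\<in>G. i \<subseteq> Q} = (\<Union>c\<in>maxl G. {i\<in>D. i \<subseteq> c})"
  proof (intro antisym subsetI)
    fix i assume "i \<in> {i\<in>D. \<exists>Q\<in>G. i \<subseteq> Q}"
    then obtain Q where "i \<in> D" "Q \<in> G" "i \<subseteq> Q" by blast
    moreover obtain c where "c \<in> maxl G" "Q \<subseteq> c" using maxl_above[OF fin \<open>Q \<in> G\<close>] by blast
    ultimately show "i \<in> (\<Union>c\<in>maxl G. {i\<in>D. i \<subseteq> c})" by (blast intro: order_trans)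
  next
    fix i assume "i \<in> (\<Union>c\<in>maxl G. {i\<in>D. i \<subseteq> c})"
    thus "i \<in> {i\<in>D. \<exists>Q\<in>G. i \<subseteq> Q}" by (blast dest: maxlD(1))
  qed
  moreover have "{i\<in>D. i \<subseteq> c} \<inter> {i\<in>D. i \<subseteq> c'} = {}" if c: "c \<in> maxl G" "c' \<in> maxl G" "c \<noteq> c'" for c c'
  proof (rule ccontr)
    assume "\<not> ?thesis"
    then obtain i where i: "i \<in> D" "i \<subseteq> c" "i \<subseteq> c'" by auto
    have "c \<subseteq> c' \<or> c' \<subseteq> c"
      using maxlD(1)[OF c(1)] maxlD(1)[OF c(2)] assms(3)
      by (intro laminar_nested[OF assms(2) i(1) _ _ i(2,3)]) auto
    thus False using maxlD[OF c(1)] maxlD[OF c(2)] c(3) by metis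
  qed
  ultimately show ?thesis
    unfolding below_sum_def using assms(1) fin
    by (simp only:) (subst sum.UNION_disjoint, auto simp: maxl_def)
qed

lemma below_sum_split:
  assumes D: "finite D" "laminar D" and Q: "Q \<in> D"
  shows "below_sum D f Q = f Q + (\<Sum>c\<in>maxl {R\<in>D. R \<subset> Q}. below_sum D f c)"
proof -
  have "{i\<in>D. i \<subseteq> Q} = insert Q {i\<in>D. \<exists>R\<in>{R\<in>D. R \<subset> Q}. i \<subseteq> R}" using Q by blast
  hence "below_sum D f Q = f Q + (\<Sum>i\<in>{i\<in>D. \<exists>R\<in>{R\<in>D. R \<subset> Q}. i \<subseteq> R}. f i)"
    unfolding below_sum_def using D(1) by (simp only:) (subst sum.insert, auto)
  thus ?thesis using laminar_sum_maxl[OF D, of "{R\<in>D. R \<subset> Q}" f] by simp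
qed

lemma below_sum_nonneg:
  fixes f :: "'a set \<Rightarrow> 'b::ordered_comm_monoid_add"
  shows "(\<And>i. i \<in> D \<Longrightarrow> 0 \<le> f i) \<Longrightarrow> 0 \<le> below_sum D f Q"
  unfolding below_sum_def by (intro sum_nonneg) auto

lemma below_sum_eq_0D:
  fixes w :: "'a set \<Rightarrow> real"
  assumes "finite D" "\<And>i. i \<in> D \<Longrightarrow> 0 \<le> w i" "below_sum D w Q = 0" "i \<in> D" "i \<subseteq> Q"
  shows "w i = 0"
  using assms sum_nonneg_eq_0_iff[of "{i\<in>D. i \<subseteq> Q}" w] unfolding below_sum_def by auto

text \<open>Weights \<open>w\<close> and masses \<open>u\<close> sit on the members of the family; \<open>w i\<close> stands for the measure of
  the part of \<open>i\<close> that is not covered by smaller members.\<close>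

definition laminar_average :: "'a set set \<Rightarrow> ('a set \<Rightarrow> real) \<Rightarrow> ('a set \<Rightarrow> 'b::real_vector) \<Rightarrow> 'a set \<Rightarrow> 'b" where
  "laminar_average D w u Q = (1 / below_sum D w Q) *\<^sub>R below_sum D u Q"

context dyadic_maximal_bound
begin

text \<open>The family is climbed as a tree: the children of \<open>Q\<close> are its maximal proper
  submembers, weighted by their total weights. These weights are arbitrary, and this is the place
  where genuine concavity, beyond midpoints, is used.\<close>

lemma laminar_bellman:
  fixes w :: "'a set \<Rightarrow> real" and u :: "'a set \<Rightarrow> 'e"
  assumes D: "finite D" "laminar D"
    and w: "\<And>i. i \<in> D \<Longrightarrow> 0 \<le> w i" and u: "\<And>i. i \<in> D \<Longrightarrow> 0 \<le> u i"
    and wu: "\<And>i. i \<in> D \<Longrightarrow> w i = 0 \<Longrightarrow> u i = 0"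
    and Q: "Q \<in> D" and m: "0 \<le> m"
  defines "a \<equiv> \<lambda>i. w i * norm ((1 / w i) *\<^sub>R u i) powr p"
  defines "z \<equiv> \<lambda>Q. (laminar_average D w u Q, laminar_average D w a Q)"
  shows "z Q \<in> bellman_domain p \<and>
    (\<Sum>i\<in>{i\<in>D. i \<subseteq> Q}. w i * norm (sup m (psup (laminar_average D w u) {R\<in>D. i \<subseteq> R \<and> R \<subseteq> Q})) powr p)
      \<le> below_sum D w Q * bellman_value p m (z Q)"
  using Q m
proof (induction "card {i\<in>D. i \<subseteq> Q}" arbitrary: Q m rule: less_induct)
  case less
  define avg where "avg = laminar_average D w u"
  define F where "F = (\<lambda>m Q i. w i * norm (sup m (psup avg {R\<in>D. i \<subseteq> R \<and> R \<subseteq> Q})) powr p)"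
  define ch where "ch = maxl {R\<in>D. R \<subset> Q}"
  define m' where "m' = sup m (avg Q)"
  \<comment> \<open>Here \<open>Q\<close> itself indexes the uncovered part of \<open>Q\<close>, an
    additional child of weight \<open>w Q\<close> on which the density is constant.\<close>
  define \<omega> where "\<omega> = (\<lambda>c. if c = Q then w Q else below_sum D w c)"
  define \<zeta> where "\<zeta> = (\<lambda>c. if c = Q then ((1 / w Q) *\<^sub>R u Q, norm ((1 / w Q) *\<^sub>R u Q) powr p) else z c)"
  have m': "0 \<le> m'" using less.prems by (auto simp: m'_def intro: le_supI1)
  have fin_ch: "finite ch" using D(1) by (simp add: ch_def maxl_def)
  have ch: "c \<in> D" "c \<subset> Q" if "c \<in> ch" for c using that by (auto simp: ch_def maxl_def)
  have Q_ch: "Q \<notin> ch" using ch by blast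
  have IH: "z c \<in> bellman_domain p" "sum (F m' c) {i\<in>D. i \<subseteq> c} \<le> below_sum D w c * bellman_value p m' (z c)"
    if "c \<in> ch" for c
  proof -
    have "{i\<in>D. i \<subseteq> c} \<subset> {i\<in>D. i \<subseteq> Q}" using ch[OF that] less.prems(1) by auto
    hence "card {i\<in>D. i \<subseteq> c} < card {i\<in>D. i \<subseteq> Q}" using D(1) by (intro psubset_card_mono) auto
    from less.hyps[OF this ch(1)[OF that] m']
    show "z c \<in> bellman_domain p" "sum (F m' c) {i\<in>D. i \<subseteq> c} \<le> below_sum D w c * bellman_value p m' (z c)"
      by (auto simp: F_def avg_def)
  qed
  have split: "below_sum D f Q = f Q + (\<Sum>c\<in>ch. below_sum D f c)" for f :: "'a set \<Rightarrow> 'z::comm_monoid_add"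
    unfolding ch_def by (rule below_sum_split[OF D less.prems(1)])
  have W: "sum \<omega> (insert Q ch) = below_sum D w Q"
  proof -
    have "sum \<omega> ch = (\<Sum>c\<in>ch. below_sum D w c)"
      using Q_ch by (intro sum.cong) (auto simp: \<omega>_def)
    thus ?thesis using fin_ch Q_ch unfolding below_sum_split[OF D less.prems(1), of w] ch_def[symmetric]
      by (simp add: \<omega>_def)
  qed
  have \<zeta>: "\<zeta> c \<in> bellman_domain p" if "c \<in> insert Q ch" for c
  proof (cases "c = Q")
    case True
    then show ?thesis using w[OF less.prems(1)] u[OF less.prems(1)]
      by (auto simp: \<zeta>_def bellman_domain_def intro!: scaleR_nonneg_nonneg)
  next
    case False
    then show ?thesis using that IH(1)[of c] by (simp add: \<zeta>_def)
  qed
  have \<omega>: "0 \<le> \<omega> c" if "c \<in> insert Q ch" for c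
    unfolding \<omega>_def using w less.prems(1) by (auto intro: below_sum_nonneg)
  have a0: "0 \<le> a i" if "i \<in> D" for i using w[OF that] by (simp add: a_def)
  have wa: "a i = 0" if "w i = 0" for i using that by (simp add: a_def)
  have zero: "below_sum D u c = 0" "below_sum D a c = 0" if "below_sum D w c = 0" for c
  proof -
    have "w i = 0" if "i \<in> {i\<in>D. i \<subseteq> c}" for i
      using below_sum_eq_0D[OF D(1) w \<open>below_sum D w c = 0\<close>] that by auto
    thus "below_sum D u c = 0" "below_sum D a c = 0"
      unfolding below_sum_def by (auto intro!: sum.neutral wu wa)
  qed
  have avg_eq: "below_sum D w c *\<^sub>R z c = (below_sum D u c, below_sum D a c)" for c
    using zero[of c] by (cases "below_sum D w c = 0") (auto simp: z_def laminar_average_def)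
  have bary: "sum \<omega> (insert Q ch) *\<^sub>R z Q = (\<Sum>c\<in>insert Q ch. \<omega> c *\<^sub>R \<zeta> c)"
  proof -
    have "(\<Sum>c\<in>ch. \<omega> c *\<^sub>R \<zeta> c) = (\<Sum>c\<in>ch. (below_sum D u c, below_sum D a c))"
      using Q_ch by (intro sum.cong) (auto simp: \<omega>_def \<zeta>_def avg_eq[symmetric])
    also have "\<dots> = ((\<Sum>c\<in>ch. below_sum D u c), (\<Sum>c\<in>ch. below_sum D a c))"
      by (simp add: sum_prod)
    finally have "(\<Sum>c\<in>insert Q ch. \<omega> c *\<^sub>R \<zeta> c) = (u Q + (\<Sum>c\<in>ch. below_sum D u c), a Q + (\<Sum>c\<in>ch. below_sum D a c))"
      using fin_ch Q_ch wu[OF less.prems(1)] by (cases "w Q = 0") (auto simp: \<omega>_def \<zeta>_def a_def)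
    thus ?thesis
      unfolding W avg_eq below_sum_split[OF D less.prems(1), of u] below_sum_split[OF D less.prems(1), of a] ch_def[symmetric]
      by simp
  qed
  show ?case
  proof (cases "below_sum D w Q = 0")
    case True
    \<comment> \<open>Division by zero yields averages \<open>0\<close>, a point of the domain, and
      both sides of the inequality vanish.\<close>
    have "z Q = 0" using True by (simp add: z_def laminar_average_def zero_prod_def)
    moreover have "w i = 0" if "i \<in> {i\<in>D. i \<subseteq> Q}" for i
      using below_sum_eq_0D[OF D(1) w True] that by auto
    ultimately show ?thesis using True p
      by (auto simp: bellman_domain_def zero_prod_def intro!: sum_nonpos)
  next
    case False
    hence pos: "0 < sum \<omega> (insert Q ch)"
      unfolding W using below_sum_nonneg[of D w Q] w by simp
    note J = bellman_value_jensen[OF _ \<omega> pos \<zeta> less.prems(2) bary]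
    have own: "F m Q Q \<le> \<omega> Q * bellman_value p m' (\<zeta> Q)"
    proof -
      have "{R\<in>D. Q \<subseteq> R \<and> R \<subseteq> Q} = {Q}" using less.prems(1) by auto
      moreover have "0 \<le> avg Q"
        unfolding avg_def laminar_average_def
        using w u by (intro scaleR_nonneg_nonneg below_sum_nonneg) (auto intro: below_sum_nonneg)
      ultimately have "F m Q Q = w Q * norm m' powr p"
        by (simp add: F_def psup_insert m'_def sup_absorb1)
      also have "\<dots> \<le> w Q * norm (sup m' (fst (\<zeta> Q))) powr p"
        using p m' w[OF less.prems(1)] by (intro mult_left_mono powr_mono2 norm_mono_nonneg) auto
      also have "\<dots> \<le> w Q * bellman_value p m' (\<zeta> Q)"
        using w[OF less.prems(1)] by (intro mult_left_mono bellman_value_ge_leaf m' \<zeta>) auto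
      finally show ?thesis by (simp add: \<omega>_def)
    qed
    have child: "sum (F m Q) {i\<in>D. i \<subseteq> c} \<le> \<omega> c * bellman_value p m' (\<zeta> c)" if c: "c \<in> ch" for c
    proof -
      have "F m Q i = F m' c i" if i: "i \<in> {i\<in>D. i \<subseteq> c}" for i
      proof -
        have "{R\<in>D. i \<subseteq> R \<and> R \<subseteq> Q} = insert Q {R\<in>D. i \<subseteq> R \<and> R \<subseteq> c}"
        proof (intro antisym subsetI)
          fix R assume R: "R \<in> {R\<in>D. i \<subseteq> R \<and> R \<subseteq> Q}"
          hence "R \<subseteq> c \<or> c \<subseteq> R" using laminar_nested[OF D(2), of i R c] i ch[OF c] by auto
          thus "R \<in> insert Q {R\<in>D. i \<subseteq> R \<and> R \<subseteq> c}"
            using R c unfolding ch_def maxl_def by blast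
        qed (use i ch[OF c] less.prems(1) in auto)
        thus ?thesis using D(1) by (simp add: F_def psup_insert m'_def sup_assoc)
      qed
      hence "sum (F m Q) {i\<in>D. i \<subseteq> c} = sum (F m' c) {i\<in>D. i \<subseteq> c}" by (intro sum.cong) auto
      also have "\<dots> \<le> below_sum D w c * bellman_value p m' (z c)" by (rule IH(2)[OF c])
      finally show ?thesis using c Q_ch by (auto simp: \<omega>_def \<zeta>_def)
    qed
    have "sum (F m Q) {i\<in>D. i \<subseteq> Q} = F m Q Q + (\<Sum>c\<in>ch. sum (F m Q) {i\<in>D. i \<subseteq> c})"
      using below_sum_split[OF D less.prems(1), of "F m Q"] by (simp add: below_sum_def ch_def)
    also have "\<dots> \<le> \<omega> Q * bellman_value p m' (\<zeta> Q) + (\<Sum>c\<in>ch. \<omega> c * bellman_value p m' (\<zeta> c))"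
      by (intro add_mono sum_mono own child)
    also have "\<dots> = (\<Sum>c\<in>insert Q ch. \<omega> c * bellman_value p m' (\<zeta> c))" using fin_ch Q_ch by simp
    also have "\<dots> \<le> sum \<omega> (insert Q ch) * bellman_value p m (z Q)"
      using J(1) fin_ch by (simp add: m'_def z_def avg_def)
    finally have "sum (F m Q) {i\<in>D. i \<subseteq> Q} \<le> below_sum D w Q * bellman_value p m (z Q)"
      unfolding W .
    thus ?thesis using J(2) fin_ch by (auto simp: F_def avg_def)
  qed
qed

lemma laminar_strong_type:
  fixes w :: "'a set \<Rightarrow> real" and u :: "'a set \<Rightarrow> 'e"
  assumes D: "finite D" "laminar D"
    and w: "\<And>i. i \<in> D \<Longrightarrow> 0 \<le> w i" and u: "\<And>i. i \<in> D \<Longrightarrow> 0 \<le> u i"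
    and wu: "\<And>i. i \<in> D \<Longrightarrow> w i = 0 \<Longrightarrow> u i = 0"
    and S: "S \<in> D"
  shows "(\<Sum>i\<in>{i\<in>D. i \<subseteq> S}. w i * norm (psup (laminar_average D w u) {R\<in>D. i \<subseteq> R \<and> R \<subseteq> S}) powr p)
      \<le> K * (\<Sum>i\<in>{i\<in>D. i \<subseteq> S}. w i * norm ((1 / w i) *\<^sub>R u i) powr p)"
proof -
  define a where "a = (\<lambda>i. w i * norm ((1 / w i) *\<^sub>R u i) powr p)"
  define z where "z = (laminar_average D w u S, laminar_average D w a S)"
  note B = laminar_bellman[where w = w and u = u and m = 0, OF D w u wu S order_refl]
  have z: "z \<in> bellman_domain p" unfolding z_def a_def by (rule conjunct1[OF B])
  have sup0: "sup 0 (psup f {R\<in>D. i \<subseteq> R \<and> R \<subseteq> S}) = psup f {R\<in>D. i \<subseteq> R \<and> R \<subseteq> S}"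
    for f :: "'a set \<Rightarrow> 'e" and i using D(1) by (intro sup_absorb2 psup_nonneg) auto
  have "(\<Sum>i\<in>{i\<in>D. i \<subseteq> S}. w i * norm (psup (laminar_average D w u) {R\<in>D. i \<subseteq> R \<and> R \<subseteq> S}) powr p)
      \<le> below_sum D w S * bellman_value p 0 z"
    unfolding z_def a_def by (rule conjunct2[OF B, unfolded sup0])
  also have "\<dots> \<le> below_sum D w S * (K * snd z)"
    using z w by (intro mult_left_mono bellman_value_bound below_sum_nonneg)
  also have "\<dots> \<le> K * below_sum D a S"
  proof -
    have "0 \<le> below_sum D a S" using w by (intro below_sum_nonneg) (auto simp: a_def)
    thus ?thesis using K by (simp add: z_def laminar_average_def)
  qed
  finally show ?thesis by (simp add: below_sum_def a_def)
qed

text \<open>Enlarging every weight \<open>w i\<close> to \<open>w i + \<alpha> i / (4 A)\<close>, where \<open>A\<close> is the overall average, makes the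
  densities bounded by \<open>4 A\<close>, so that the strong type inequality applies, while the averages over the
  sets with average at most \<open>4 A\<close> change by a factor of at most \<open>2\<close>.\<close>

lemma laminar_weak_type:
  fixes w \<alpha> :: "'a set \<Rightarrow> real" and u :: "'a set \<Rightarrow> 'e"
  assumes D: "finite D" "laminar D"
    and w: "\<And>i. i \<in> D \<Longrightarrow> 0 \<le> w i" and u: "\<And>i. i \<in> D \<Longrightarrow> 0 \<le> u i"
    and u_le: "\<And>i. i \<in> D \<Longrightarrow> norm (u i) \<le> \<alpha> i" and w\<alpha>: "\<And>i. i \<in> D \<Longrightarrow> w i = 0 \<Longrightarrow> \<alpha> i = 0"
    and S: "S \<in> D"
  defines "B \<equiv> {i\<in>D. i \<subseteq> S \<and> 8 * (K + 1) * laminar_average D w \<alpha> S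
      < norm (psup (laminar_average D w u) {R\<in>D. i \<subseteq> R \<and> R \<subseteq> S})}"
  shows "sum w B \<le> below_sum D w S / 2"
proof -
  define W where "W = below_sum D w"
  \<comment> \<open>Averages of \<alpha> above \<open>4 * A\<close> cost a quarter of the weight.
    Elsewhere a factor \<open>2\<close> is lost in changing the weights, and a factor
    \<open>K + 1\<close> in Chebyshev's inequality leaves another quarter; altogether
    \<open>2 * 4 * (K + 1)\<close>.\<close>
  define \<Lambda> where "\<Lambda> = 8 * (K + 1)"
  define A where "A = laminar_average D w \<alpha> S"
  have \<Lambda>: "\<Lambda> > 0" using K by (simp add: \<Lambda>_def)
  have \<alpha>: "0 \<le> \<alpha> i" if "i \<in> D" for i using u_le[OF that] norm_ge_zero order_trans by blast
  have W0: "0 \<le> W Q" for Q unfolding W_def using w by (rule below_sum_nonneg)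
  have A_eq: "A = below_sum D \<alpha> S / W S" by (simp add: A_def laminar_average_def W_def)
  have B: "finite B" "B \<subseteq> D" using D(1) by (auto simp: B_def)
  show ?thesis
  proof (cases "W S = 0 \<or> below_sum D \<alpha> S = 0")
    case True
    have "\<alpha> i = 0" if "i \<in> D" "i \<subseteq> S" for i
    proof (cases "W S = 0")
      case True
      hence "w i = 0" using below_sum_eq_0D[OF D(1) w _ that] by (simp add: W_def)
      thus ?thesis by (rule w\<alpha>[OF that(1)])
    next
      case False
      thus ?thesis using below_sum_eq_0D[OF D(1) \<alpha> _ that] True by simp
    qed
    hence u0: "u i = 0" if "i \<in> D" "i \<subseteq> S" for i using u_le[OF that(1)] that by simp
    have "psup (laminar_average D w u) {R\<in>D. i \<subseteq> R \<and> R \<subseteq> S} = psup (\<lambda>_. 0) {R\<in>D. i \<subseteq> R \<and> R \<subseteq> S}" for i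
      by (intro psup_cong) (auto simp: laminar_average_def below_sum_def intro!: sum.neutral u0)
    also have "psup (\<lambda>_. 0 :: 'e) {R\<in>D. i \<subseteq> R \<and> R \<subseteq> S} = 0" for i
      using D(1) by (intro antisym psup_least psup_nonneg) auto
    finally have "B = {}" using True by (auto simp: B_def A_def[symmetric] A_eq)
    thus ?thesis using W0[of S] by (simp add: W_def)
  next
    case False
    hence WS: "W S > 0" and aS: "below_sum D \<alpha> S > 0"
      using W0[of S] below_sum_nonneg[of D \<alpha> S] \<alpha> by (auto simp: less_le)
    hence A: "A > 0" by (simp add: A_eq)
    define G where "G = {Q\<in>D. Q \<subseteq> S \<and> 4 * A * W Q < below_sum D \<alpha> Q}"
    define B1 where "B1 = {i\<in>D. \<exists>Q\<in>G. i \<subseteq> Q}"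
    have G: "G \<subseteq> D" by (auto simp: G_def)
    \<comment> \<open>The scalar weak type bound: \<open>B1\<close> splits along the maximal members
      of \<open>G\<close>, on each of which the \<alpha>-mass exceeds \<open>4 * A\<close> times the
      weight.\<close>
    have 1: "sum w B1 \<le> W S / 4"
    proof -
      have "4 * A * sum w B1 = (\<Sum>c\<in>maxl G. 4 * A * W c)"
        unfolding B1_def laminar_sum_maxl[OF D G] W_def by (simp add: sum_distrib_left)
      also have "\<dots> \<le> (\<Sum>c\<in>maxl G. below_sum D \<alpha> c)"
        by (intro sum_mono) (auto simp: maxl_def G_def)
      also have "\<dots> = sum \<alpha> B1" unfolding B1_def laminar_sum_maxl[OF D G] ..
      also have "\<dots> \<le> below_sum D \<alpha> S"
        unfolding below_sum_def using D(1) \<alpha> by (intro sum_mono2) (auto simp: B1_def G_def)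
      also have "\<dots> = A * W S" using WS by (simp add: A_eq)
      finally show ?thesis using A by (simp add: field_simps)
    qed
    define w' where "w' = (\<lambda>i. w i + \<alpha> i / (4 * A))"
    have w': "0 \<le> w' i" "w i \<le> w' i" "w' i = 0 \<Longrightarrow> u i = 0" if "i \<in> D" for i
    proof -
      have *: "0 \<le> \<alpha> i / (4 * A)" using \<alpha>[OF that] A by simp
      thus "0 \<le> w' i" "w i \<le> w' i" using w[OF that] by (auto simp: w'_def)
      assume "w' i = 0"
      hence "w i = 0" using * w[OF that] by (auto simp: w'_def)
      thus "u i = 0" using w\<alpha>[OF that] u_le[OF that] by simp
    qed
    have W': "below_sum D w' Q = W Q + below_sum D \<alpha> Q / (4 * A)" for Q
      by (simp add: below_sum_def w'_def W_def sum.distrib sum_divide_distrib)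
    define N where "N = (\<lambda>i. norm (psup (laminar_average D w' u) {R\<in>D. i \<subseteq> R \<and> R \<subseteq> S}))"
    have N: "\<Lambda> * A / 2 < N i" if i: "i \<in> B - B1" for i
    proof -
      have "laminar_average D w u R \<le> 2 *\<^sub>R laminar_average D w' u R" if R: "R \<in> {R\<in>D. i \<subseteq> R \<and> R \<subseteq> S}" for R
      proof (cases "W R = 0")
        case True
        then show ?thesis using w' u
          by (auto simp: laminar_average_def W_def intro!: scaleR_nonneg_nonneg below_sum_nonneg)
      next
        case False
        hence WR: "W R > 0" using W0[of R] by simp
        have "R \<notin> G" using i R by (auto simp: B1_def B_def)
        hence "below_sum D \<alpha> R \<le> 4 * A * W R" using R by (auto simp: G_def)
        hence "below_sum D w' R \<le> 2 * W R" unfolding W' using A by (simp add: field_simps)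
        moreover have "0 < below_sum D w' R"
          unfolding W' using WR A below_sum_nonneg[of D \<alpha> R] \<alpha> by (intro add_pos_nonneg) auto
        ultimately have "1 / W R \<le> 2 * (1 / below_sum D w' R)" using WR by (simp add: field_simps)
        moreover have "0 \<le> below_sum D u R" using u by (rule below_sum_nonneg)
        ultimately show ?thesis
          unfolding laminar_average_def W_def scaleR_scaleR by (rule scaleR_right_mono)
      qed
      hence "norm (psup (laminar_average D w u) {R\<in>D. i \<subseteq> R \<and> R \<subseteq> S})
          \<le> norm (psup (\<lambda>R. 2 *\<^sub>R laminar_average D w' u R) {R\<in>D. i \<subseteq> R \<and> R \<subseteq> S})"
        using D(1) by (intro norm_psup_mono) auto
      also have "\<dots> = 2 * N i" using D(1) by (simp add: psup_scaleR N_def)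
      finally show ?thesis using i by (simp add: B_def A_def \<Lambda>_def)
    qed
    have "(\<Lambda> * A / 2) powr p * sum w (B - B1) \<le> (\<Sum>i\<in>B - B1. w' i * N i powr p)"
      unfolding sum_distrib_left
    proof (rule sum_mono)
      fix i assume i: "i \<in> B - B1"
      have "(\<Lambda> * A / 2) powr p \<le> N i powr p" using N[OF i] p \<Lambda> A by (intro powr_mono2) auto
      thus "(\<Lambda> * A / 2) powr p * w i \<le> w' i * N i powr p"
        using i B w w' by (subst mult.commute) (intro mult_mono, auto)
    qed
    also have "\<dots> \<le> (\<Sum>i\<in>{i\<in>D. i \<subseteq> S}. w' i * N i powr p)"
      using D(1) w' by (intro sum_mono2) (auto simp: B_def)
    also have "\<dots> \<le> K * (\<Sum>i\<in>{i\<in>D. i \<subseteq> S}. w' i * norm ((1 / w' i) *\<^sub>R u i) powr p)"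
      unfolding N_def by (intro laminar_strong_type D w' u S) auto
    \<comment> \<open>Densities with respect to \<open>w'\<close> are at most \<open>4 * A\<close>,
      so all but one of the \<open>p\<close> powers are traded for a constant and only the total
      mass remains.\<close>
    also have "\<dots> \<le> K * (\<Sum>i\<in>{i\<in>D. i \<subseteq> S}. (4 * A) powr (p - 1) * \<alpha> i)"
    proof (intro mult_left_mono sum_mono K)
      fix i assume i: "i \<in> {i\<in>D. i \<subseteq> S}"
      show "w' i * norm ((1 / w' i) *\<^sub>R u i) powr p \<le> (4 * A) powr (p - 1) * \<alpha> i"
      proof (cases "w' i = 0")
        case True
        then show ?thesis using \<alpha> i by simp
      next
        case False
        hence pos: "w' i > 0" using w' i by (simp add: less_le)
        define n where "n = norm (u i) / w' i"
        have "n \<le> \<alpha> i / w' i" unfolding n_def using u_le i pos by (intro divide_right_mono) auto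
        also have "\<dots> \<le> 4 * A"
        proof -
          have "\<alpha> i = 4 * A * (\<alpha> i / (4 * A))" using A by simp
          also have "\<dots> \<le> 4 * A * w' i" using A w i by (intro mult_left_mono) (auto simp: w'_def)
          finally show ?thesis using pos by (simp add: divide_le_eq)
        qed
        finally have n: "n \<le> 4 * A" "0 \<le> n" using pos by (auto simp: n_def)
        have "n powr p = n * n powr (p - 1)"
          using n(2) by (cases "n = 0") (auto simp: powr_mult_base)
        also have "\<dots> \<le> n * (4 * A) powr (p - 1)"
          using n p by (intro mult_left_mono powr_mono2) auto
        finally have "w' i * n powr p \<le> w' i * (n * (4 * A) powr (p - 1))"
          using pos by (intro mult_left_mono) auto
        also have "\<dots> = norm (u i) * (4 * A) powr (p - 1)" using pos by (simp add: n_def)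
        also have "\<dots> \<le> \<alpha> i * (4 * A) powr (p - 1)" using u_le i by (intro mult_right_mono) auto
        finally show ?thesis using pos by (simp add: n_def mult.commute)
      qed
    qed
    also have "\<dots> = K * ((4 * A) powr (p - 1) * (A * W S))"
      using WS by (simp add: sum_distrib_left[symmetric] A_eq below_sum_def)
    also have "\<dots> = K * (4 * A) powr p * W S / 4"
    proof -
      have "(4 * A) powr p = 4 * A * (4 * A) powr (p - 1)" using A by (simp add: powr_mult_base)
      thus ?thesis by simp
    qed
    finally have le: "(\<Lambda> * A / 2) powr p * sum w (B - B1) \<le> K * (4 * A) powr p * W S / 4" .
    have "(\<Lambda> * A / 2) powr p = (K + 1) powr p * (4 * A) powr p"
    proof -
      have "\<Lambda> * A / 2 = (K + 1) * (4 * A)" by (simp add: \<Lambda>_def)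
      thus ?thesis using K A by (simp only: powr_mult)
    qed
    with le have "(4 * A) powr p * ((K + 1) powr p * sum w (B - B1)) \<le> (4 * A) powr p * (K * W S / 4)"
      by (simp add: mult_ac)
    hence "(K + 1) powr p * sum w (B - B1) \<le> K * W S / 4"
      using A by (subst (asm) mult_le_cancel_left_pos) auto
    \<comment> \<open>The constant \<open>K + 1\<close> is at least \<open>1\<close>, so its
      \<open>p\<close>-th power dominates it, which for \<open>K\<close> alone may fail.\<close>
    moreover have "K + 1 \<le> (K + 1) powr p" using powr_mono[of 1 p "K + 1"] p K by simp
    moreover have sw: "0 \<le> sum w (B - B1)" using B w by (intro sum_nonneg) auto
    ultimately have "(K + 1) * sum w (B - B1) \<le> K * W S / 4"
      using mult_right_mono[of "K + 1" "(K + 1) powr p" "sum w (B - B1)"] by linarith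
    also have "\<dots> \<le> (K + 1) * (W S / 4)" using WS by simp
    finally have 2: "sum w (B - B1) \<le> W S / 4"
      using K by (subst (asm) mult_le_cancel_left_pos) auto
    have "sum w B \<le> sum w (B - B1) + sum w B1"
    proof -
      have "sum w B \<le> sum w ((B - B1) \<union> B1)"
        using B D(1) w by (intro sum_mono2) (auto simp: B1_def)
      also have "\<dots> = sum w (B - B1) + sum w B1"
        using B D(1) by (intro sum.union_disjoint) (auto simp: B1_def)
      finally show ?thesis .
    qed
    thus ?thesis using 1 2 by (simp add: W_def)
  qed
qed

end

text \<open>Induction by removing a minimal member \<open>Q\<close>. No other member lies below
  \<open>Q\<close>, so adding it to the family changes the stopping parent of no other member; it is
  added exactly if it has no parent or is bad for its parent.\<close>

lemma stopping_family:
  assumes "finite D" "laminar D"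
  shows "\<exists>\<S>\<subseteq>D. (\<forall>Q\<in>D. \<exists>S\<in>\<S>. Q \<subseteq> S \<and> (\<forall>T\<in>\<S>. Q \<subseteq> T \<longrightarrow> S \<subseteq> T) \<and> (Q = S \<or> \<not> bad S Q)) \<and>
     (\<forall>S\<in>\<S>. \<forall>T\<in>\<S>. T \<subset> S \<longrightarrow> (\<forall>R\<in>\<S>. T \<subset> R \<longrightarrow> S \<subseteq> R) \<longrightarrow> bad S T)"
  using assms
proof (induction "card D" arbitrary: D)
  case 0
  then show ?case by simp
next
  case (Suc n)
  then obtain Q where Q: "Q \<in> D" "\<And>R. R \<in> D \<Longrightarrow> R \<subseteq> Q \<Longrightarrow> R = Q"
    using finite_has_minimal[of D] by fastforce
  define D' where "D' = D - {Q}"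
  have "laminar D'" using Suc.prems(2) by (auto simp: laminar_def D'_def)
  moreover have "card D' = n" using Suc Q by (simp add: D'_def)
  ultimately obtain \<S> where S: "\<S> \<subseteq> D'"
    "\<And>P. P \<in> D' \<Longrightarrow> \<exists>S\<in>\<S>. P \<subseteq> S \<and> (\<forall>T\<in>\<S>. P \<subseteq> T \<longrightarrow> S \<subseteq> T) \<and> (P = S \<or> \<not> bad S P)"
    "\<And>S T. S \<in> \<S> \<Longrightarrow> T \<in> \<S> \<Longrightarrow> T \<subset> S \<Longrightarrow> (\<forall>R\<in>\<S>. T \<subset> R \<longrightarrow> S \<subseteq> R) \<Longrightarrow> bad S T"
    using Suc.hyps(1)[of D'] Suc.prems(1) by (fastforce simp: D'_def)
  have SD: "\<S> \<subseteq> D" "Q \<notin> \<S>" using S(1) by (auto simp: D'_def)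
  define C where "C = {S\<in>\<S>. Q \<subseteq> S}"
  have nest: "A \<subseteq> B \<or> B \<subseteq> A" if "A \<in> C" "B \<in> C" for A B
    using laminar_nested[OF Suc.prems(2) Q(1), of A B] that SD by (auto simp: C_def)
  consider "C = {}" | S where "S \<in> C" "\<And>T. T \<in> C \<Longrightarrow> S \<subseteq> T"
  proof (cases "C = {}")
    case False
    have "finite C" using SD Suc.prems(1) by (auto simp: C_def intro: finite_subset)
    then obtain S where "S \<in> C" "\<forall>T\<in>C. T \<subseteq> S \<longrightarrow> S = T" using finite_has_minimal[of C] False by auto
    then show ?thesis using that(2)[of S] nest by blast
  qed
  then show ?case
  proof cases
    case 1
    let ?S = "insert Q \<S>"
    have no: "\<not> Q \<subseteq> T" if "T \<in> \<S>" for T using 1 that by (auto simp: C_def)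
    have good: "\<exists>S\<in>?S. P \<subseteq> S \<and> (\<forall>T\<in>?S. P \<subseteq> T \<longrightarrow> S \<subseteq> T) \<and> (P = S \<or> \<not> bad S P)" if P: "P \<in> D" for P
    proof (cases "P = Q")
      case True
      then show ?thesis using no by (intro bexI[of _ Q]) auto
    next
      case False
      hence "P \<in> D'" "\<not> P \<subseteq> Q" using P Q(2) by (auto simp: D'_def)
      from S(2)[OF this(1)] this(2) show ?thesis by (metis insert_iff)
    qed
    have bad: "bad S T" if ST: "S \<in> ?S" "T \<in> ?S" "T \<subset> S" "\<forall>R\<in>?S. T \<subset> R \<longrightarrow> S \<subseteq> R" for S T
    proof -
      have "S \<noteq> Q" using ST(2,3) Q SD by auto
      moreover have "T \<noteq> Q" using ST no \<open>S \<noteq> Q\<close> by auto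
      ultimately show ?thesis using ST by (intro S(3)) auto
    qed
    show ?thesis
    proof (intro exI[of _ ?S] conjI ballI impI)
      show "?S \<subseteq> D" using SD Q(1) by auto
    qed ((rule good, assumption) | (rule bad, assumption+))+
  next
    case (2 S0)
    have S0: "S0 \<in> \<S>" "Q \<subseteq> S0" "Q \<noteq> S0" "\<And>T. T \<in> \<S> \<Longrightarrow> Q \<subseteq> T \<Longrightarrow> S0 \<subseteq> T"
      using 2 SD by (auto simp: C_def)
    show ?thesis
    proof (cases "bad S0 Q")
      case True
      let ?S = "insert Q \<S>"
      have good: "\<exists>S\<in>?S. P \<subseteq> S \<and> (\<forall>T\<in>?S. P \<subseteq> T \<longrightarrow> S \<subseteq> T) \<and> (P = S \<or> \<not> bad S P)" if P: "P \<in> D" for P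
      proof (cases "P = Q")
        case True
        then show ?thesis by (intro bexI[of _ Q]) auto
      next
        case False
        hence "P \<in> D'" "\<not> P \<subseteq> Q" using P Q(2) by (auto simp: D'_def)
        from S(2)[OF this(1)] this(2) show ?thesis by (metis insert_iff)
      qed
      have bad: "bad S T" if ST: "S \<in> ?S" "T \<in> ?S" "T \<subset> S" "\<forall>R\<in>?S. T \<subset> R \<longrightarrow> S \<subseteq> R" for S T
      proof -
        have SQ: "S \<in> \<S>" using ST Q SD by auto
        show ?thesis
        proof (cases "T = Q")
          case T: True
          have "S0 \<subseteq> S" using S0(4)[OF SQ] ST(3) T by auto
          moreover have "S \<subseteq> S0" using ST(4) S0(1-3) T by auto
          ultimately show ?thesis using True T by auto
        next
          case False
          then show ?thesis using ST SQ by (intro S(3)) auto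
        qed
      qed
      show ?thesis
      proof (intro exI[of _ ?S] conjI ballI impI)
        show "?S \<subseteq> D" using SD Q(1) by auto
      qed ((rule good, assumption) | (rule bad, assumption+))+
    next
      case False
      have good: "\<exists>S\<in>\<S>. P \<subseteq> S \<and> (\<forall>T\<in>\<S>. P \<subseteq> T \<longrightarrow> S \<subseteq> T) \<and> (P = S \<or> \<not> bad S P)" if P: "P \<in> D" for P
      proof (cases "P = Q")
        case True
        then show ?thesis using S0 False by (intro bexI[of _ S0]) auto
      next
        case False
        then show ?thesis using P by (intro S(2)) (auto simp: D'_def)
      qed
      show ?thesis
      proof (intro exI[of _ \<S>] conjI ballI impI)
        show "\<S> \<subseteq> D" by (rule SD)
      qed ((rule good, assumption) | (rule S(3), assumption+))+
    qed
  qed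
qed

subsection \<open>Dyadic cubes and locally finite measures\<close>

definition hbox :: "('d::finite \<Rightarrow> real) \<Rightarrow> ('d \<Rightarrow> real) \<Rightarrow> (real ^ 'd) set" where
  "hbox a b = {x. \<forall>i. a i \<le> x $ i \<and> x $ i < b i}"

lemma hbox_borel [measurable]: "hbox a b \<in> sets borel"
proof -
  have "hbox a b = (\<Inter>i. {x. a i \<le> x $ i} \<inter> {x. x $ i < b i})" by (auto simp: hbox_def)
  also have "\<dots> \<in> sets borel"
    by (intro sets.finite_INT sets.Int borel_closed borel_open closed_Collect_le open_Collect_less
        continuous_intros) auto
  finally show ?thesis .
qed

lemma hbox_measure:
  fixes a b :: "'d::finite \<Rightarrow> real"
  assumes "\<And>i. a i < b i"
  shows "emeasure lborel (hbox a b) = ennreal (\<Prod>i\<in>UNIV. b i - a i)"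
proof -
  let ?a = "(\<chi> i. a i) :: real ^ 'd" and ?b = "(\<chi> i. b i) :: real ^ 'd"
  have ne: "cbox ?a ?b \<noteq> {}" using assms by (auto simp: interval_ne_empty_cart less_imp_le)
  have le: "\<And>i. i \<in> Basis \<Longrightarrow> ?a \<bullet> i \<le> ?b \<bullet> i"
    using ne by (simp add: box_ne_empty)
  have c: "emeasure lborel (cbox ?a ?b) = ennreal (\<Prod>i\<in>UNIV. b i - a i)"
  proof -
    have "emeasure lborel (cbox ?a ?b) = ennreal (measure lborel (cbox ?a ?b))"
      using emeasure_lborel_cbox_finite[of ?a ?b] by (intro emeasure_eq_ennreal_measure) auto
    thus ?thesis using content_cbox_cart[OF ne] by simp
  qed
  have "box ?a ?b \<subseteq> hbox a b"
    by (auto simp: hbox_def mem_box_cart less_imp_le)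
  hence "emeasure lborel (box ?a ?b) \<le> emeasure lborel (hbox a b)" by (intro emeasure_mono) auto
  moreover have "hbox a b \<subseteq> cbox ?a ?b" by (auto simp: hbox_def mem_box_cart less_imp_le)
  hence "emeasure lborel (hbox a b) \<le> emeasure lborel (cbox ?a ?b)" by (intro emeasure_mono) auto
  moreover have "emeasure lborel (box ?a ?b) = emeasure lborel (cbox ?a ?b)"
    using le by (simp add: emeasure_lborel_box_eq emeasure_lborel_cbox_eq)
  ultimately show ?thesis using c by simp
qed

text \<open>Describing a cube by integer parts of scaled coordinates turns nesting into arithmetic:
  the index on a coarser scale is the quotient of the finer one by a power of
  \<open>2\<close>.\<close>

definition dcube :: "int \<Rightarrow> ('d::finite \<Rightarrow> int) \<Rightarrow> (real ^ 'd) set" where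
  "dcube k m = {x. \<forall>i. \<lfloor>2 powi k * x $ i\<rfloor> = m i}"

lemma dyadic_cubes_eq: "(dyadic_cubes :: (real ^ 'd::finite) set set) = {dcube k m | k m. True}"
proof -
  have "(\<lambda>x. 2 powi (- k) *\<^sub>R (x + (\<chi> i. of_int (m i)))) ` {x. \<forall>i. 0 \<le> x $ i \<and> x $ i < 1} = dcube k m"
    for k and m :: "'d \<Rightarrow> int"
  proof (intro antisym subsetI)
    fix x :: "real ^ 'd" assume x: "x \<in> dcube k m"
    define y where "y = 2 powi k *\<^sub>R x - (\<chi> i. of_int (m i))"
    have "x = 2 powi (- k) *\<^sub>R (y + (\<chi> i. of_int (m i)))"
      by (simp add: y_def power_int_minus)
    moreover have "0 \<le> y $ i \<and> y $ i < 1" for i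
    proof -
      have "\<lfloor>2 powi k * x $ i\<rfloor> = m i" using x by (simp add: dcube_def)
      hence "of_int (m i) \<le> 2 powi k * x $ i" "2 powi k * x $ i < of_int (m i) + 1"
        by (simp_all add: floor_eq_iff)
      thus ?thesis by (simp add: y_def)
    qed
    ultimately show "x \<in> (\<lambda>x. 2 powi (- k) *\<^sub>R (x + (\<chi> i. of_int (m i)))) ` {x. \<forall>i. 0 \<le> x $ i \<and> x $ i < 1}"
      by blast
  next
    fix x :: "real ^ 'd" assume "x \<in> (\<lambda>x. 2 powi (- k) *\<^sub>R (x + (\<chi> i. of_int (m i)))) ` {x. \<forall>i. 0 \<le> x $ i \<and> x $ i < 1}"
    then obtain y :: "real ^ 'd" where "\<And>i. 0 \<le> y $ i" "\<And>i. y $ i < 1" "x = 2 powi (- k) *\<^sub>R (y + (\<chi> i. of_int (m i)))"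
      by auto
    thus "x \<in> dcube k m" by (auto simp: dcube_def power_int_minus floor_eq_iff mult.assoc[symmetric])
  qed
  thus ?thesis unfolding dyadic_cubes_def by simp
qed

lemma floor_powi_div:
  fixes x :: real
  assumes "k \<le> l"
  shows "\<lfloor>2 powi k * x\<rfloor> = \<lfloor>2 powi l * x\<rfloor> div 2 ^ nat (l - k)"
proof -
  have "2 powi l = 2 powi k * (2::real) powi (l - k)" by (subst power_int_add[symmetric]) auto
  also have "(2::real) powi (l - k) = 2 ^ nat (l - k)" using assms by (simp add: power_int_def)
  finally have "2 powi k * x = (2 powi l * x) / of_int (2 ^ nat (l - k))" by simp
  thus ?thesis using floor_divide_real_eq_div[of "2 ^ nat (l - k)" "2 powi l * x"] by simp
qed

lemma dcube_nested:
  assumes "k \<le> l" "x \<in> dcube k m" "x \<in> dcube l m'"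
  shows "dcube l m' \<subseteq> dcube k m"
proof
  fix y assume y: "y \<in> dcube l m'"
  have "\<lfloor>2 powi k * y $ i\<rfloor> = m i" for i
    using assms(2,3) y floor_powi_div[OF assms(1), of "y $ i"] floor_powi_div[OF assms(1), of "x $ i"]
    by (simp add: dcube_def)
  thus "y \<in> dcube k m" by (simp add: dcube_def)
qed

lemma dcube_nonempty: "dcube k m \<noteq> {}"
proof -
  have "(\<chi> i. 2 powi (- k) * of_int (m i)) \<in> dcube k m"
    by (simp add: dcube_def power_int_minus mult.assoc[symmetric])
  thus ?thesis by blast
qed

lemma laminar_dyadic_cubes: "laminar dyadic_cubes"
  unfolding laminar_def
proof (intro conjI ballI)
  show "{} \<notin> (dyadic_cubes :: (real ^ 'a) set set)" using dcube_nonempty unfolding dyadic_cubes_eq by force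
  fix A B :: "(real ^ 'a) set" assume "A \<in> dyadic_cubes" "B \<in> dyadic_cubes"
  then obtain k m l m' where AB: "A = dcube k m" "B = dcube l m'" unfolding dyadic_cubes_eq by blast
  show "A \<subseteq> B \<or> B \<subseteq> A \<or> A \<inter> B = {}"
  proof (cases "A \<inter> B = {}")
    case False
    then obtain x where x: "x \<in> dcube k m" "x \<in> dcube l m'" using AB by auto
    show ?thesis
    proof (cases "k \<le> l")
      case True
      show ?thesis using dcube_nested[OF True x] AB by simp
    next
      case False
      hence "l \<le> k" by simp
      from dcube_nested[OF this x(2,1)] show ?thesis using AB by simp
    qed
  qed simp
qed

lemma laminar_subset:
  assumes "laminar D" "D' \<subseteq> D"
  shows "laminar D'"
  unfolding laminar_def
proof (intro conjI ballI)
  show "{} \<notin> D'" using assms by (auto simp: laminar_def)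
  fix A B assume "A \<in> D'" "B \<in> D'"
  hence "A \<in> D" "B \<in> D" using assms(2) by auto
  thus "A \<subseteq> B \<or> B \<subseteq> A \<or> A \<inter> B = {}" using assms(1) unfolding laminar_def by blast
qed

lemma dcube_hbox: "dcube k m = hbox (\<lambda>i. 2 powi (- k) * of_int (m i)) (\<lambda>i. 2 powi (- k) * (of_int (m i) + 1))"
proof -
  have "\<lfloor>2 powi k * y\<rfloor> = n \<longleftrightarrow> 2 powi (- k) * of_int n \<le> y \<and> y < 2 powi (- k) * (of_int n + 1)" for y :: real and n
  proof -
    have "(2::real) powi k > 0" by simp
    thus ?thesis by (auto simp: floor_eq_iff power_int_minus field_simps)
  qed
  thus ?thesis by (simp add: dcube_def hbox_def)
qed

lemma dyadic_cube_borel: "Q \<in> dyadic_cubes \<Longrightarrow> Q \<in> sets borel"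
  unfolding dyadic_cubes_eq by (auto simp: dcube_hbox)

lemma hbox_bounded: "bounded (hbox a b)"
proof -
  have "hbox a b \<subseteq> cbox (\<chi> i. a i) (\<chi> i. b i)" by (auto simp: hbox_def mem_box_cart less_imp_le)
  thus ?thesis using bounded_cbox bounded_subset by blast
qed

lemma dyadic_cube_bounded: "Q \<in> dyadic_cubes \<Longrightarrow> bounded Q"
  unfolding dyadic_cubes_eq by (auto simp: dcube_hbox hbox_bounded)

lemma locally_finite_compact:
  assumes "sets M = sets borel" "locally_finite_measure M" "compact K"
  shows "emeasure M K < \<infinity>"
proof -
  obtain U where U: "\<And>x. open (U x)" "\<And>x. x \<in> U x" "\<And>x. emeasure M (U x) < \<infinity>"
    using assms(2) unfolding locally_finite_measure_def by metis
  obtain T where T: "T \<subseteq> K" "finite T" "K \<subseteq> (\<Union>x\<in>T. U x)"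
  proof (rule compactE_image[OF assms(3), of K U])
    show "K \<subseteq> (\<Union>x\<in>K. U x)" using U(2) by blast
  qed (use U in auto)
  have "emeasure M K \<le> emeasure M (\<Union>x\<in>T. U x)"
    using T(3) U(1) assms(1) by (intro emeasure_mono) (auto intro!: borel_open)
  also have "\<dots> \<le> (\<Sum>x\<in>T. emeasure M (U x))"
    using T(2) U(1) assms(1) by (intro emeasure_subadditive_finite) auto
  also have "\<dots> < \<infinity>" using T(2) U(3) by simp
  finally show ?thesis .
qed

lemma locally_finite_bounded:
  fixes A :: "'a::heine_borel set"
  assumes "sets M = sets borel" "locally_finite_measure M" "bounded A"
  shows "emeasure M A < \<infinity>"
proof -
  have "emeasure M A \<le> emeasure M (closure A)"
    using assms(1) by (intro emeasure_mono closure_subset) auto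
  also have "\<dots> < \<infinity>" using assms by (intro locally_finite_compact) auto
  finally show ?thesis .
qed

text \<open>Half-open cubes are not compact, so integrability is taken from the closure and then
  restricted.\<close>

lemma locally_integrable_bounded:
  fixes f :: "'a::heine_borel \<Rightarrow> 'b::banach"
  assumes "sets M = sets borel" "locally_integrable M f" "bounded A" "A \<in> sets borel"
  shows "\<exists>I. has_strong_integral M (\<lambda>x. indicator A x *\<^sub>R f x) I"
proof -
  have "compact (closure A)" using assms(3) by simp
  then obtain I where "has_strong_integral M (\<lambda>x. indicator (closure A) x *\<^sub>R f x) I"
    using assms(2) unfolding locally_integrable_def strongly_integrable_def by blast
  from has_strong_integral_restrict[OF this, of A] assms(1,4)
  obtain J where "has_strong_integral M (\<lambda>x. indicator A x *\<^sub>R indicator (closure A) x *\<^sub>R f x) J"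
    by auto
  moreover have "(\<lambda>x. indicator A x *\<^sub>R indicator (closure A) x *\<^sub>R f x) = (\<lambda>x. indicator A x *\<^sub>R f x)"
    using closure_subset[of A] by (auto simp: fun_eq_iff indicator_def)
  ultimately show ?thesis by auto
qed

subsection \<open>The Hardy--Littlewood property gives the dyadic maximal inequality\<close>

lemma dyadic_mean_sum: "dyadic_mean N g = (1 / 2 ^ N) *\<^sub>R (\<Sum>j<2 ^ N. g j)"
proof (induction N arbitrary: g)
  case (Suc N)
  have "(\<Sum>j<2 ^ Suc N. g j) = (\<Sum>j<2 ^ N. g j) + (\<Sum>j<2 ^ N. g (j + 2 ^ N))"
  proof -
    have "(\<Sum>j<2 ^ Suc N. g j) = (\<Sum>j<2 ^ N. g j) + sum g {0 + 2 ^ N..<2 ^ N + 2 ^ N}"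
      using sum.atLeastLessThan_concat[of 0 "2 ^ N" "2 ^ N + 2 ^ N" g]
      by (simp add: atLeast0LessThan mult_2)
    also have "sum g {0 + 2 ^ N..<2 ^ N + 2 ^ N} = (\<Sum>j\<in>{0..<2 ^ N}. g (j + 2 ^ N))"
      by (rule sum.shift_bounds_nat_ivl)
    finally show ?thesis by (simp add: atLeast0LessThan)
  qed
  thus ?case by (simp add: Suc.IH scaleR_add_right)
qed simp

text \<open>The average over the block of length \<open>2 ^ r\<close> that contains
  \<open>j\<close>, that is, the value at the ancestor of height \<open>r\<close> of the leaf
  \<open>j\<close>.\<close>

definition block_mean :: "nat \<Rightarrow> (nat \<Rightarrow> 'b::real_vector) \<Rightarrow> nat \<Rightarrow> 'b" where
  "block_mean r g j = dyadic_mean r (\<lambda>l. g ((j div 2 ^ r) * 2 ^ r + l))"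

lemma block_mean_shift:
  assumes "r \<le> N"
  shows "block_mean r (\<lambda>j. g (j + 2 ^ N)) j = block_mean r g (j + 2 ^ N)"
proof -
  obtain q where q: "N = r + q" using assms le_Suc_ex by blast
  have "(j + 2 ^ N) div 2 ^ r = j div 2 ^ r + 2 ^ q" by (simp add: q power_add)
  thus ?thesis by (simp add: block_mean_def q power_add algebra_simps)
qed

lemma dyadic_payoff_eq:
  fixes g :: "nat \<Rightarrow> 'e::banach_lattice"
  assumes "\<And>j. 0 \<le> g j" "0 \<le> m"
  shows "dyadic_payoff p N g m = dyadic_mean N (\<lambda>j. norm (sup m (psup (\<lambda>r. block_mean r g j) {..N})) powr p)"
  using assms
proof (induction N arbitrary: g m)
  case 0
  then show ?case by (simp add: psup_insert block_mean_def sup_absorb1)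
next
  case (Suc N)
  define m' where "m' = sup m (dyadic_mean (Suc N) g)"
  have m': "0 \<le> m'" using Suc.prems by (auto simp: m'_def intro: le_supI1)
  have top: "block_mean (Suc N) g j = dyadic_mean (Suc N) g" if "j < 2 ^ Suc N" for j
    using that by (simp add: block_mean_def del: dyadic_mean.simps)
  have step: "sup m (psup (\<lambda>r. block_mean r g j) {..Suc N}) = sup m' (psup (\<lambda>r. block_mean r g j) {..N})"
    if "j < 2 ^ Suc N" for j
    using top[OF that] by (simp add: atMost_Suc psup_insert sup_assoc m'_def del: dyadic_mean.simps)
  have "dyadic_payoff p N g m' = dyadic_mean N (\<lambda>j. norm (sup m (psup (\<lambda>r. block_mean r g j) {..Suc N})) powr p)"
  proof (subst Suc.IH[OF Suc.prems(1) m'], rule dyadic_mean_cong)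
    fix j :: nat assume "j < 2 ^ N"
    hence "j < 2 ^ Suc N" by simp
    from step[OF this] show "norm (sup m' (psup (\<lambda>r. block_mean r g j) {..N})) powr p =
      norm (sup m (psup (\<lambda>r. block_mean r g j) {..Suc N})) powr p" by simp
  qed
  moreover have "dyadic_payoff p N (\<lambda>j. g (j + 2 ^ N)) m' =
      dyadic_mean N (\<lambda>j. norm (sup m (psup (\<lambda>r. block_mean r g (j + 2 ^ N)) {..Suc N})) powr p)"
  proof (subst Suc.IH[OF _ m'], rule Suc.prems(1), rule dyadic_mean_cong)
    fix j :: nat assume "j < 2 ^ N"
    hence "j + 2 ^ N < 2 ^ Suc N" by simp
    moreover have "psup (\<lambda>r. block_mean r (\<lambda>j. g (j + 2 ^ N)) j) {..N} = psup (\<lambda>r. block_mean r g (j + 2 ^ N)) {..N}"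
      by (intro psup_cong block_mean_shift) auto
    ultimately show "norm (sup m' (psup (\<lambda>r. block_mean r (\<lambda>j. g (j + 2 ^ N)) j) {..N})) powr p =
      norm (sup m (psup (\<lambda>r. block_mean r g (j + 2 ^ N)) {..Suc N})) powr p" using step by simp
  qed
  ultimately show ?case by (simp only: dyadic_payoff.simps dyadic_mean.simps m'_def) simp
qed

text \<open>A sequence \<open>g\<close> becomes a function on the unit cube that depends on the coordinate \<open>i0\<close> only.\<close>

definition slab :: "'d::finite \<Rightarrow> nat \<Rightarrow> nat \<Rightarrow> ('d \<Rightarrow> int) \<Rightarrow> nat \<Rightarrow> (real ^ 'd) set" where
  "slab i0 N k m j = hbox (\<lambda>i. if i = i0 then real j / 2 ^ N else of_int (m i) / 2 ^ k)
      (\<lambda>i. if i = i0 then (real j + 1) / 2 ^ N else (of_int (m i) + 1) / 2 ^ k)"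

lemma slab_measure:
  fixes i0 :: "'d::finite"
  shows "emeasure lborel (slab i0 N k m j) = ennreal ((1 / 2 ^ N) * (1 / 2 ^ k) ^ (CARD('d) - 1))"
proof -
  have "(\<Prod>i\<in>UNIV. (if i = i0 then (real j + 1) / 2 ^ N else (of_int (m i) + 1) / 2 ^ k) -
      (if i = i0 then real j / 2 ^ N else of_int (m i) / 2 ^ k)) =
      (\<Prod>i\<in>UNIV. if i = i0 then 1 / 2 ^ N else (1 / 2 ^ k :: real))"
    by (intro prod.cong) (auto simp: diff_divide_distrib[symmetric])
  also have "\<dots> = (1 / 2 ^ N) * (\<Prod>i\<in>UNIV - {i0}. if i = i0 then 1 / 2 ^ N else (1 / 2 ^ k :: real))"
    by (subst prod.remove[of _ i0]) auto
  also have "(\<Prod>i\<in>UNIV - {i0}. if i = i0 then 1 / 2 ^ N else (1 / 2 ^ k :: real)) = (\<Prod>i\<in>UNIV - {i0}. (1 / 2 ^ k :: real))"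
    by (intro prod.cong) auto
  finally show ?thesis
    unfolding slab_def by (subst hbox_measure) (auto simp: divide_strict_right_mono card_Diff_singleton)
qed

lemma slab_floor:
  "x \<in> slab i0 N k m j \<longleftrightarrow> \<lfloor>2 ^ N * x $ i0\<rfloor> = int j \<and> (\<forall>i. i \<noteq> i0 \<longrightarrow> \<lfloor>2 ^ k * x $ i\<rfloor> = m i)"
  unfolding slab_def hbox_def floor_eq_iff by (auto simp: field_simps)

lemma dcube_floor: "x \<in> dcube (int k) m \<longleftrightarrow> (\<forall>i. \<lfloor>2 ^ k * x $ i\<rfloor> = m i)"
  by (simp add: dcube_def)

lemma dcube_dyadic: "dcube k m \<in> dyadic_cubes"
  unfolding dyadic_cubes_eq by blast

lemma floor_powi_div_nat: "k \<le> N \<Longrightarrow> \<lfloor>2 ^ k * x\<rfloor> = \<lfloor>2 ^ N * x\<rfloor> div 2 ^ (N - k)" for x :: real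
  using floor_powi_div[of "int k" "int N" x] by (simp add: nat_diff_distrib)

definition gridcubes :: "nat \<Rightarrow> (real ^ 'd::finite) set set" where
  "gridcubes N = (\<Union>k\<le>N. dcube (int k) ` (PiE UNIV (\<lambda>_. {0..<2 ^ k})))"

lemma finite_gridcubes: "finite (gridcubes N)"
  unfolding gridcubes_def by (intro finite_UN_I finite_imageI finite_PiE) auto

section \<open>Functions of one coordinate on the unit cube\<close>

context
  fixes i0 :: "'d::finite" and N :: nat and g :: "nat \<Rightarrow> 'e::banach_lattice"
  assumes g: "\<And>j. 0 \<le> g j"
begin

definition spread :: "real ^ 'd \<Rightarrow> 'e" where
  "spread x = (\<Sum>j<2 ^ N. indicator (slab i0 N 0 (\<lambda>_. 0) j) x *\<^sub>R g j)"

lemma spread_sum_indicator: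
  fixes c :: "nat \<Rightarrow> 'b::real_vector"
  assumes "x \<in> slab i0 N 0 (\<lambda>_. 0) j" "j < 2 ^ N"
  shows "(\<Sum>j<2 ^ N. indicator (slab i0 N 0 (\<lambda>_. 0) j) x *\<^sub>R c j) = c j"
proof -
  have "(\<Sum>j<2 ^ N. indicator (slab i0 N 0 (\<lambda>_. 0) j) x *\<^sub>R c j) = (\<Sum>i<2 ^ N. if i = j then c j else 0)"
    using assms(1) by (intro sum.cong) (auto simp: indicator_def slab_floor)
  thus ?thesis using assms(2) by simp
qed

lemma spread_outside:
  fixes c :: "nat \<Rightarrow> 'b::real_vector"
  assumes "\<And>j. j < 2 ^ N \<Longrightarrow> x \<notin> slab i0 N 0 (\<lambda>_. 0) j"
  shows "(\<Sum>j<2 ^ N. indicator (slab i0 N 0 (\<lambda>_. 0) j) x *\<^sub>R c j) = 0"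
  using assms by (intro sum.neutral) auto

lemma spread_abs: "\<bar>spread x\<bar> = spread x"
  unfolding spread_def by (intro abs_of_nonneg sum_nonneg scaleR_nonneg_nonneg g) auto

text \<open>Only the coordinate \<open>i0\<close> matters to \<open>spread\<close>, and a cube of
  side \<open>2 ^ - k\<close> meets a full block of \<open>2 ^ (N - k)\<close> slabs in equal
  portions. Dyadic averages in any dimension thus reduce to block means.\<close>

lemma spread_average:
  assumes x: "x \<in> slab i0 N 0 (\<lambda>_. 0) j" "j < 2 ^ N" and k: "k \<le> N"
  shows "average lborel (dcube (int k) (\<lambda>i. \<lfloor>2 ^ k * x $ i\<rfloor>)) spread = block_mean (N - k) g j"
proof -
  define Q where "Q = dcube (int k) (\<lambda>i. \<lfloor>2 ^ k * x $ i\<rfloor>)"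
  define r where "r = N - k"
  define b where "b = j div 2 ^ r"
  \<comment> \<open>The cross-section of the cube orthogonal to the direction \<open>i0\<close>; it
    cancels in the average.\<close>
  define P where "P = (1 / 2 ^ k :: real) ^ (CARD('d) - 1)"
  have P: "P > 0" by (simp add: P_def)
  have b_floor: "\<lfloor>2 ^ k * x $ i0\<rfloor> = int b"
    using x(1) floor_powi_div_nat[OF k, of "x $ i0"] by (simp add: slab_floor b_def r_def zdiv_int)
  have "2 ^ N = (2 ^ k * 2 ^ r :: nat)" using k by (simp add: r_def power_add[symmetric])
  hence b: "b < 2 ^ k" using x(2) by (simp add: b_def less_mult_imp_div_less)
  have x0: "\<lfloor>x $ i\<rfloor> = 0" if "i \<noteq> i0" for i using x(1) that by (simp add: slab_floor)
  have ind: "indicator Q y *\<^sub>R spread y = (\<Sum>l<2 ^ r. indicator (slab i0 N k (\<lambda>i. \<lfloor>2 ^ k * x $ i\<rfloor>) (b * 2 ^ r + l)) y *\<^sub>R g (b * 2 ^ r + l))" (is "?L = ?R") for y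
  proof (cases "y \<in> Q")
    case True
    hence y: "\<lfloor>2 ^ k * y $ i\<rfloor> = \<lfloor>2 ^ k * x $ i\<rfloor>" for i by (simp add: Q_def dcube_floor)
    define n where "n = \<lfloor>2 ^ N * y $ i0\<rfloor>"
    have nb: "n div 2 ^ r = int b"
      using y[of i0] b_floor floor_powi_div_nat[OF k, of "y $ i0"] by (simp add: r_def n_def)
    define l where "l = nat (n mod 2 ^ r)"
    have l: "l < 2 ^ r" by (simp add: l_def nat_less_iff)
    have n: "n = int (b * 2 ^ r + l)"
      using div_mult_mod_eq[of n "2 ^ r"] nb by (simp add: l_def)
    have "b * 2 ^ r + l < (b + 1) * 2 ^ r" using l by simp
    also have "\<dots> \<le> 2 ^ k * 2 ^ r" using b by (intro mult_right_mono) auto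
    finally have lt: "b * 2 ^ r + l < 2 ^ N" using \<open>2 ^ N = (2 ^ k * 2 ^ r :: nat)\<close> by simp
    have "\<lfloor>y $ i\<rfloor> = 0" if "i \<noteq> i0" for i
      using y[of i] x0[OF that] floor_powi_div_nat[of 0 k "y $ i"] floor_powi_div_nat[of 0 k "x $ i"] by simp
    hence "y \<in> slab i0 N 0 (\<lambda>_. 0) (b * 2 ^ r + l)" using n by (simp add: slab_floor n_def)
    hence "?L = g (b * 2 ^ r + l)"
      using True lt unfolding spread_def by (subst spread_sum_indicator) auto
    moreover have "?R = (\<Sum>i<2 ^ r. if i = l then g (b * 2 ^ r + l) else 0)"
      using y n by (intro sum.cong) (auto simp: indicator_def slab_floor n_def)
    ultimately show ?thesis using l by simp
  next
    case False
    have "y \<notin> slab i0 N k (\<lambda>i. \<lfloor>2 ^ k * x $ i\<rfloor>) (b * 2 ^ r + l)" if "l < 2 ^ r" for l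
    proof
      assume y: "y \<in> slab i0 N k (\<lambda>i. \<lfloor>2 ^ k * x $ i\<rfloor>) (b * 2 ^ r + l)"
      have "\<lfloor>2 ^ k * y $ i0\<rfloor> = int (b * 2 ^ r + l) div 2 ^ r"
        using y floor_powi_div_nat[OF k, of "y $ i0"] by (simp add: slab_floor r_def)
      also have "\<dots> = int ((b * 2 ^ r + l) div 2 ^ r)" by (simp add: zdiv_int)
      also have "\<dots> = \<lfloor>2 ^ k * x $ i0\<rfloor>" using that b_floor by simp
      finally have "y \<in> Q" using y unfolding Q_def dcube_floor slab_floor by metis
      thus False using False by simp
    qed
    thus ?thesis using False by simp
  qed
  have slab_m: "measure lborel (slab i0 N k m l) = P / 2 ^ N" for m l
    using P by (simp add: measure_def slab_measure P_def)
  have "has_strong_integral lborel (\<lambda>y. indicator Q y *\<^sub>R spread y)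
     (\<Sum>l<2 ^ r. measure lborel (slab i0 N k (\<lambda>i. \<lfloor>2 ^ k * x $ i\<rfloor>) (b * 2 ^ r + l)) *\<^sub>R g (b * 2 ^ r + l))"
    unfolding ind
    by (intro has_strong_integral_sum has_strong_integral_indicator) (auto simp: slab_measure, auto simp: slab_def)
  hence int: "strong_integral lborel (\<lambda>y. indicator Q y *\<^sub>R spread y) = (P / 2 ^ N) *\<^sub>R (\<Sum>l<2 ^ r. g (b * 2 ^ r + l))"
    by (simp add: strong_integral_eq slab_m scaleR_sum_right)
  have "Q = slab i0 k k (\<lambda>i. \<lfloor>2 ^ k * x $ i\<rfloor>) b"
    using b_floor unfolding Q_def set_eq_iff dcube_floor slab_floor by metis
  hence "measure lborel Q = P / 2 ^ k" using P by (simp add: measure_def slab_measure P_def)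
  hence "average lborel Q spread = (2 ^ k / 2 ^ N) *\<^sub>R (\<Sum>l<2 ^ r. g (b * 2 ^ r + l))"
    using P by (simp add: average_def int)
  also have "2 ^ k / 2 ^ N = (1 / 2 ^ r :: real)" using k by (simp add: r_def power_diff)
  finally show ?thesis by (simp add: Q_def[symmetric] block_mean_def dyadic_mean_sum b_def r_def)
qed

lemma spread_nn_integral:
  assumes "\<And>j. 0 \<le> c j"
  shows "(\<integral>\<^sup>+x. ennreal (\<Sum>j<2 ^ N. indicator (slab i0 N 0 (\<lambda>_. 0) j) x *\<^sub>R c j) \<partial>lborel) = ennreal (dyadic_mean N c)"
proof -
  have slab: "slab i0 N 0 (\<lambda>_. 0) j \<in> sets lborel" for j unfolding slab_def by simp
  have "(\<integral>\<^sup>+x. ennreal (\<Sum>j<2 ^ N. indicator (slab i0 N 0 (\<lambda>_. 0) j) x *\<^sub>R c j) \<partial>lborel)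
      = (\<integral>\<^sup>+x. (\<Sum>j<2 ^ N. ennreal (c j) * indicator (slab i0 N 0 (\<lambda>_. 0) j) x) \<partial>lborel)"
    using assms by (intro nn_integral_cong) (subst sum_ennreal[symmetric], auto intro!: sum.cong split: split_indicator)
  also have "\<dots> = (\<Sum>j<2 ^ N. ennreal (c j) * emeasure lborel (slab i0 N 0 (\<lambda>_. 0) j))"
    using slab by (subst nn_integral_sum) (auto simp: nn_integral_cmult_indicator)
  also have "\<dots> = ennreal (\<Sum>j<2 ^ N. c j * (1 / 2 ^ N))"
    using assms by (subst sum_ennreal[symmetric]) (auto simp: slab_measure ennreal_mult[symmetric])
  finally show ?thesis by (simp add: dyadic_mean_sum sum_distrib_left mult.commute)
qed

lemma spread_strongly_measurable: "strongly_measurable lborel spread"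
proof -
  have "has_strong_integral lborel (\<lambda>x. \<Sum>j<2 ^ N. indicator (slab i0 N 0 (\<lambda>_. 0) j) x *\<^sub>R g j)
     (\<Sum>j<2 ^ N. measure lborel (slab i0 N 0 (\<lambda>_. 0) j) *\<^sub>R g j)"
    by (intro has_strong_integral_sum has_strong_integral_indicator) (auto simp: slab_measure, auto simp: slab_def)
  thus ?thesis unfolding has_strong_integral_def spread_def by simp
qed

lemma spread_powr:
  "norm (spread x) powr p = (\<Sum>j<2 ^ N. indicator (slab i0 N 0 (\<lambda>_. 0) j) x *\<^sub>R (norm (g j) powr p))"
proof (cases "\<exists>j<2 ^ N. x \<in> slab i0 N 0 (\<lambda>_. 0) j")
  case True
  then obtain j where "x \<in> slab i0 N 0 (\<lambda>_. 0) j" "j < 2 ^ N" by blast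
  thus ?thesis unfolding spread_def by (simp only: spread_sum_indicator)
next
  case False
  thus ?thesis unfolding spread_def by (subst (1 2) spread_outside) auto
qed

lemma spread_maximal:
  assumes x: "x \<in> slab i0 N 0 (\<lambda>_. 0) j" "j < 2 ^ N"
  shows "psup (\<lambda>r. block_mean r g j) {..N} \<le> lattice_maximal lborel (gridcubes N) spread x"
proof -
  let ?f = "\<lambda>Q. indicator Q x *\<^sub>R average lborel Q (\<lambda>y. \<bar>spread y\<bar>)"
  have eq: "lattice_maximal lborel (gridcubes N) spread x = psup ?f (gridcubes N)"
    by (simp add: lattice_maximal_def psup_def)
  show ?thesis unfolding eq
  proof (rule psup_least)
    show "0 \<le> psup ?f (gridcubes N)" by (intro psup_nonneg finite_gridcubes)
    fix r assume r: "r \<in> {..N}"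
    define k where "k = N - r"
    define Q where "Q = dcube (int k) (\<lambda>i. \<lfloor>2 ^ k * x $ i\<rfloor>)"
    have k: "k \<le> N" "N - k = r" using r by (auto simp: k_def)
    have unit: "\<lfloor>x $ i\<rfloor> = 0" for i
    proof (cases "i = i0")
      case True
      then show ?thesis using x floor_powi_div_nat[of 0 N "x $ i0"] by (simp add: slab_floor zdiv_int)
    qed (use x(1) in \<open>simp add: slab_floor\<close>)
    have "\<lfloor>2 ^ k * x $ i\<rfloor> \<in> {0..<2 ^ k}" for i
      using unit[of i] by (auto simp: floor_eq_iff floor_less_iff)
    hence "Q \<in> gridcubes N" unfolding gridcubes_def Q_def using k by (intro UN_I[of k] imageI) auto
    moreover have "x \<in> Q" by (simp add: Q_def dcube_floor)
    moreover have "average lborel Q (\<lambda>y. \<bar>spread y\<bar>) = block_mean r g j"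
      unfolding spread_abs Q_def using spread_average[OF x k(1)] k(2) by simp
    ultimately show "block_mean r g j \<le> psup ?f (gridcubes N)"
      using psup_upper[OF finite_gridcubes, of Q N ?f] by simp
  qed auto
qed

end

text \<open>Testing on functions of one coordinate loses nothing, since the tree inequality is
  one-dimensional. Raising the norm inequality to the power \<open>p\<close> gives the constant
  \<open>\<bar>C\<bar> powr p\<close>, with an absolute value because \<open>C\<close> carries no
  sign.\<close>

lemma dyadic_maximal_bound_of_hardy_littlewood:
  assumes "hardy_littlewood_property TYPE('e::banach_lattice) TYPE('d::finite)"
  shows "\<exists>p K. dyadic_maximal_bound TYPE('e) p K"
proof -
  obtain p C where p: "p > 1" and HL0: "\<forall>\<D> \<subseteq> dyadic_cubes. finite \<D> \<longrightarrow>
        (\<forall>f :: real ^ 'd \<Rightarrow> 'e. f \<in> Lp_space p lborel \<longrightarrow>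
           lattice_maximal lborel \<D> f \<in> Lp_space p lborel \<and>
           Lp_norm p lborel (lattice_maximal lborel \<D> f) \<le> C * Lp_norm p lborel f)"
    using assms unfolding hardy_littlewood_property_def by (elim exE conjE)
  note HL = HL0[rule_format]
  have "dyadic_payoff p N g 0 \<le> \<bar>C\<bar> powr p * dyadic_mean N (\<lambda>j. norm (g j) powr p)"
    if g: "\<And>j. 0 \<le> g j" for N and g :: "nat \<Rightarrow> 'e"
  proof -
    \<comment> \<open>Any coordinate will do; index types are nonempty.\<close>
    define i0 :: 'd where "i0 = undefined"
    define F where "F = spread i0 N g"
    define D where "D = (gridcubes N :: (real ^ 'd) set set)"
    define M where "M = lattice_maximal lborel D F"
    define a where "a = dyadic_mean N (\<lambda>j. norm (g j) powr p)"
    have a: "0 \<le> a" by (simp add: a_def dyadic_mean_sum sum_nonneg)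
    have F: "(\<integral>\<^sup>+x. ennreal (norm (F x) powr p) \<partial>lborel) = ennreal a"
      unfolding F_def spread_powr[OF g] a_def by (intro spread_nn_integral[OF g]) auto
    have "F \<in> Lp_space p lborel"
      using F spread_strongly_measurable[OF g, of i0 N] by (simp add: Lp_space_def F_def)
    moreover have "D \<subseteq> dyadic_cubes" by (auto simp: D_def gridcubes_def dcube_dyadic)
    moreover have "finite D" by (simp add: D_def finite_gridcubes)
    ultimately have M: "M \<in> Lp_space p lborel" "Lp_norm p lborel M \<le> C * Lp_norm p lborel F"
      using HL[of D F] unfolding M_def by simp_all
    define I where "I = (\<integral>\<^sup>+x. ennreal (norm (M x) powr p) \<partial>lborel)"
    \<comment> \<open>Finiteness has to come from membership in \<open>Lp_space\<close>:
      \<open>enn2real\<close> sends infinity to \<open>0\<close>, so the norm inequality alone could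
      be void.\<close>
    have I: "I < \<infinity>" using M(1) by (simp add: Lp_space_def I_def)
    have "enn2real I powr (1 / p) \<le> C * a powr (1 / p)"
      using M(2) F a by (simp add: Lp_norm_def I_def)
    also have "\<dots> \<le> \<bar>C\<bar> * a powr (1 / p)" by (intro mult_right_mono) auto
    finally have "(enn2real I powr (1 / p)) powr p \<le> (\<bar>C\<bar> * a powr (1 / p)) powr p"
      using p by (intro powr_mono2) auto
    hence Ia: "enn2real I \<le> \<bar>C\<bar> powr p * a"
      using p a by (simp add: powr_powr powr_mult)
    define c where "c = (\<lambda>j. norm (psup (\<lambda>r. block_mean r g j) {..N}) powr p)"
    have "ennreal (dyadic_mean N c) = (\<integral>\<^sup>+x. ennreal (\<Sum>j<2 ^ N. indicator (slab i0 N 0 (\<lambda>_. 0) j) x *\<^sub>R c j) \<partial>lborel)"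
      by (intro spread_nn_integral[OF g, symmetric]) (simp add: c_def)
    also have "\<dots> \<le> I"
      unfolding I_def
    proof (intro nn_integral_mono ennreal_leI)
      fix x :: "real ^ 'd"
      show "(\<Sum>j<2 ^ N. indicator (slab i0 N 0 (\<lambda>_. 0) j) x *\<^sub>R c j) \<le> norm (M x) powr p"
      proof (cases "\<exists>j<2 ^ N. x \<in> slab i0 N 0 (\<lambda>_. 0) j")
        case True
        then obtain j where x: "x \<in> slab i0 N 0 (\<lambda>_. 0) j" "j < 2 ^ N" by blast
        have "c j \<le> norm (M x) powr p"
          unfolding c_def M_def D_def F_def using p
          by (intro powr_mono2 norm_mono_nonneg psup_nonneg spread_maximal[OF g x]) auto
        thus ?thesis using spread_sum_indicator[OF g x, of c] by simp
      next
        case False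
        thus ?thesis by (subst spread_outside[OF g]) auto
      qed
    qed
    finally have "dyadic_mean N c \<le> enn2real I"
      using I by (metis enn2real_ennreal enn2real_mono ennreal_enn2real ennreal_neg infinity_ennreal_def
          le_cases order.trans enn2real_nonneg top.not_eq_extremum)
    moreover have "dyadic_payoff p N g 0 = dyadic_mean N c"
    proof -
      have "sup 0 (psup (\<lambda>r. block_mean r g j) {..N}) = psup (\<lambda>r. block_mean r g j) {..N}" for j
        by (intro sup_absorb2 psup_nonneg) auto
      thus ?thesis using dyadic_payoff_eq[of g 0 p N] g by (simp add: c_def)
    qed
    ultimately show ?thesis using Ia by (simp add: a_def)
  qed
  hence "dyadic_maximal_bound TYPE('e) p (\<bar>C\<bar> powr p)"
    using p by unfold_locales auto
  thus ?thesis by blast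
qed

subsection \<open>The dyadic maximal inequality gives an upper estimate\<close>

context dyadic_maximal_bound
begin

text \<open>If the supremum of these \<open>2 ^ m\<close> vectors had nearly the norm of their sum, they would behave like
  the unit vectors of \<open>l\<^sup>1\<close>, whose dyadic maximal function grows linearly in \<open>m\<close>.\<close>

lemma norm_psup_lt_card:
  assumes m: "2 * (K + 1) < real m"
    and e: "\<And>i. 0 \<le> e i" "\<And>i. norm (e i) \<le> 1"
  shows "norm (psup (e :: nat \<Rightarrow> 'e) {..<2 ^ m}) \<le> 2 ^ m - 1"
proof (rule ccontr)
  assume contr: "\<not> ?thesis"
  define M where "M = (\<lambda>j. psup (\<lambda>r. block_mean r e j) {..m})"
  have large: "real m / 2 \<le> norm (M j)" if j: "j < 2 ^ m" for j
  proof -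
    define A where "A = (\<lambda>r. {i. i div 2 ^ r = j div (2::nat) ^ r})"
    \<comment> \<open>This stands for \<open>2 ^ - r\<close>, where \<open>r\<close> is the least
      height at which \<open>i\<close> and \<open>j\<close> share a block. It is written as a
      telescoping sum so that the sum over \<open>i\<close> becomes a count of block sizes, each
      level contributing \<open>1 / 2\<close>.\<close>
    define \<alpha> where "\<alpha> = (\<lambda>i. (1/2::real) ^ m + (\<Sum>r\<in>{r\<in>{..<m}. i \<in> A r}. (1/2) ^ Suc r))"
    have block: "(1/2) ^ r *\<^sub>R e i \<le> block_mean r e j" if "i \<in> A r" for i r
    proof -
      have i: "i = (j div 2 ^ r) * 2 ^ r + i mod 2 ^ r"
        using that div_mult_mod_eq[of i "2 ^ r"] by (simp add: A_def)
      have "e i \<le> (\<Sum>l<2 ^ r. e ((j div 2 ^ r) * 2 ^ r + l))"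
        by (subst i, subst sum.remove[of _ "i mod 2 ^ r"]) (auto intro!: add_increasing2 sum_nonneg e)
      thus ?thesis
        by (simp add: block_mean_def dyadic_mean_sum power_one_over scaleR_left_mono)
    qed
    have \<alpha>_le: "\<alpha> i *\<^sub>R e i \<le> M j" and \<alpha>_le1: "\<alpha> i \<le> 1" if i: "i < 2 ^ m" for i
    proof -
      define r where "r = (LEAST r. i \<in> A r)"
      have "i \<in> A m" using i j by (simp add: A_def)
      hence r: "i \<in> A r" "r \<le> m" unfolding r_def by (auto intro: LeastI Least_le)
      have "{r\<in>{..<m}. i \<in> A r} \<subseteq> {r..<m}"
        unfolding r_def by (auto intro: Least_le)
      hence "\<alpha> i \<le> (1/2) ^ m + (\<Sum>s = r..<m. (1/2) ^ Suc s)"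
        unfolding \<alpha>_def by (intro add_left_mono sum_mono2) auto
      also have "(\<Sum>s = r..<m. (1/2) ^ Suc s) = (\<Sum>s = r..<m. - ((1/2) ^ Suc s) - (- ((1/2::real) ^ s)))"
        by (intro sum.cong) auto
      also have "\<dots> = - ((1/2) ^ m) - (- ((1/2) ^ r))"
        using sum_Suc_diff'[OF r(2), of "\<lambda>s. - ((1/2::real) ^ s)"] .
      finally have \<alpha>r: "\<alpha> i \<le> (1/2) ^ r" by simp
      also have "\<dots> \<le> 1" by (simp add: power_le_one)
      finally show "\<alpha> i \<le> 1" .
      have "\<alpha> i *\<^sub>R e i \<le> (1/2) ^ r *\<^sub>R e i" using \<alpha>r e by (intro scaleR_right_mono)
      also have "\<dots> \<le> block_mean r e j" by (rule block[OF r(1)])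
      also have "\<dots> \<le> M j" unfolding M_def using r(2) by (intro psup_upper) auto
      finally show "\<alpha> i *\<^sub>R e i \<le> M j" .
    qed
    have card_A: "card {i\<in>{..<2 ^ m}. i \<in> A r} = 2 ^ r" if "r < m" for r
    proof -
      obtain q where q: "m = r + q" using \<open>r < m\<close> less_imp_add_positive by blast
      have "j div 2 ^ r < 2 ^ q" using j by (simp add: q power_add less_mult_imp_div_less mult.commute)
      hence "(j div 2 ^ r + 1) * 2 ^ r \<le> 2 ^ q * 2 ^ r" by (intro mult_right_mono) auto
      hence le: "j div 2 ^ r * 2 ^ r + 2 ^ r \<le> 2 ^ m" by (simp add: q power_add mult.commute)
      have "{i\<in>{..<2 ^ m}. i \<in> A r} = {j div 2 ^ r * 2 ^ r..<j div 2 ^ r * 2 ^ r + 2 ^ r}"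
      proof (intro antisym subsetI)
        fix i assume "i \<in> {i\<in>{..<2 ^ m}. i \<in> A r}"
        hence "i = j div 2 ^ r * 2 ^ r + i mod 2 ^ r" using div_mult_mod_eq[of i "2 ^ r"] by (simp add: A_def)
        moreover have "i mod 2 ^ r < 2 ^ r" by simp
        ultimately show "i \<in> {j div 2 ^ r * 2 ^ r..<j div 2 ^ r * 2 ^ r + 2 ^ r}"
          by (metis atLeastLessThan_iff le_add1 nat_add_left_cancel_less)
      next
        fix i assume i: "i \<in> {j div 2 ^ r * 2 ^ r..<j div 2 ^ r * 2 ^ r + 2 ^ r}"
        then obtain l where l: "i = j div 2 ^ r * 2 ^ r + l" "l < 2 ^ r"
          by (metis add_less_cancel_left atLeastLessThan_iff le_Suc_ex)
        hence "i div 2 ^ r = j div 2 ^ r" by simp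
        thus "i \<in> {i\<in>{..<2 ^ m}. i \<in> A r}" using i le by (simp add: A_def)
      qed
      thus ?thesis by simp
    qed
    have sum_\<alpha>: "(\<Sum>i<2 ^ m. \<alpha> i) = 1 + real m / 2"
    proof -
      have "(\<Sum>i<2 ^ m. \<Sum>r\<in>{r\<in>{..<m}. i \<in> A r}. (1/2::real) ^ Suc r)
          = (\<Sum>r<m. \<Sum>i\<in>{i\<in>{..<2 ^ m}. i \<in> A r}. (1/2) ^ Suc r)"
        by (rule sum.swap_restrict) auto
      also have "\<dots> = (\<Sum>r<m. 1 / 2)"
      proof (intro sum.cong refl)
        fix r assume "r \<in> {..<m}"
        hence "r < m" by simp
        show "(\<Sum>i\<in>{i\<in>{..<2 ^ m}. i \<in> A r}. (1/2::real) ^ Suc r) = 1 / 2"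
          unfolding sum_constant card_A[OF \<open>r < m\<close>] by (simp add: power_one_over)
      qed
      finally show ?thesis by (simp add: \<alpha>_def sum.distrib power_one_over)
    qed
    have M0: "0 \<le> M j" unfolding M_def by (intro psup_nonneg) auto
    have \<delta>: "0 \<le> (\<Sum>i<2 ^ m. (1 - \<alpha> i) *\<^sub>R e i)"
      using \<alpha>_le1 e by (intro sum_nonneg scaleR_nonneg_nonneg) auto
    \<comment> \<open>The part \<open>\<alpha> i\<close> of each \<open>e i\<close> lies below
      \<open>M j\<close>, and the remainders have total norm at most
      \<open>2 ^ m - 1 - m / 2\<close>. A supremum of norm above \<open>2 ^ m - 1\<close> therefore
      leaves at least \<open>m / 2\<close> for \<open>M j\<close>.\<close>
    have "psup e {..<2 ^ m} \<le> M j + (\<Sum>i<2 ^ m. (1 - \<alpha> i) *\<^sub>R e i)"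
    proof (rule psup_least)
      fix i :: nat assume i: "i \<in> {..<2 ^ m}"
      have "e i = \<alpha> i *\<^sub>R e i + (1 - \<alpha> i) *\<^sub>R e i" by (simp add: scaleR_left_distrib[symmetric])
      also have "\<dots> \<le> M j + (\<Sum>i<2 ^ m. (1 - \<alpha> i) *\<^sub>R e i)"
      proof (rule add_mono)
        show "\<alpha> i *\<^sub>R e i \<le> M j" using \<alpha>_le i by simp
        show "(1 - \<alpha> i) *\<^sub>R e i \<le> (\<Sum>i<2 ^ m. (1 - \<alpha> i) *\<^sub>R e i)"
          using i \<alpha>_le1 e by (subst sum.remove[of _ i])
            (auto intro!: add_increasing2 sum_nonneg scaleR_nonneg_nonneg)
      qed
      finally show "e i \<le> M j + (\<Sum>i<2 ^ m. (1 - \<alpha> i) *\<^sub>R e i)" .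
    qed (use M0 \<delta> in auto)
    hence "norm (psup e {..<2 ^ m}) \<le> norm (M j + (\<Sum>i<2 ^ m. (1 - \<alpha> i) *\<^sub>R e i))"
      by (intro norm_mono_nonneg psup_nonneg) auto
    also have "\<dots> \<le> norm (M j) + (\<Sum>i<2 ^ m. norm ((1 - \<alpha> i) *\<^sub>R e i))"
      by (intro order_trans[OF norm_triangle_ineq] add_left_mono norm_sum)
    also have "(\<Sum>i<2 ^ m. norm ((1 - \<alpha> i) *\<^sub>R e i)) \<le> (\<Sum>i<2 ^ m. (1 - \<alpha> i) * 1)"
      unfolding norm_scaleR using \<alpha>_le1 e by (intro sum_mono mult_mono) auto
    also have "\<dots> = 2 ^ m - (1 + real m / 2)" using sum_\<alpha> by (simp add: sum_subtractf)
    finally show ?thesis using contr by simp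
  qed
  have powr_m: "K < (real m / 2) powr p"
  proof -
    have "1 \<le> real m / 2" using m K by simp
    hence "(real m / 2) powr 1 \<le> (real m / 2) powr p" using p by (intro powr_mono) auto
    thus ?thesis using m K by simp
  qed
  have "(real m / 2) powr p = dyadic_mean m (\<lambda>j. (real m / 2) powr p)" by (simp add: dyadic_mean_const)
  also have "\<dots> \<le> dyadic_mean m (\<lambda>j. norm (sup 0 (M j)) powr p)"
  proof -
    have "sup 0 (M j) = M j" for j unfolding M_def by (intro sup_absorb2 psup_nonneg) auto
    thus ?thesis unfolding dyadic_mean_sum
      using large p by (intro scaleR_left_mono sum_mono powr_mono2) auto
  qed
  also have "\<dots> = dyadic_payoff p m e 0"
    unfolding M_def by (rule dyadic_payoff_eq[symmetric]) (use e in auto)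
  also have "\<dots> \<le> K * dyadic_mean m (\<lambda>j. norm (e j) powr p)" by (rule max_ineq) (rule e)
  also have "\<dots> \<le> K * dyadic_mean m (\<lambda>j. 1)"
    unfolding dyadic_mean_sum using e p K by (intro mult_left_mono scaleR_left_mono sum_mono powr_le1) auto
  also have "\<dots> = K" by (simp add: dyadic_mean_const)
  finally show False using powr_m by simp
qed

end

text \<open>A nontrivial bound for \<open>n\<close> unit vectors improves to a power saving by iteration.\<close>

lemma norm_psup_power:
  fixes e :: "nat \<Rightarrow> 'e::banach_lattice"
  assumes n: "2 \<le> n"
    and bound: "\<And>e :: nat \<Rightarrow> 'e. (\<And>i. 0 \<le> e i) \<Longrightarrow> (\<And>i. norm (e i) \<le> 1) \<Longrightarrow> norm (psup e {..<n}) \<le> real n - 1"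
    and e: "\<And>i. 0 \<le> e i" "\<And>i. norm (e i) \<le> 1"
  shows "norm (psup e {..<n ^ k}) \<le> (real n - 1) ^ k"
  using e
proof (induction k arbitrary: e)
  case 0
  have "psup e {..<Suc 0} = e 0" using 0 by (simp add: lessThan_Suc psup_insert sup_absorb1)
  then show ?case using 0 by simp
next
  case (Suc k)
  let ?c = "(real n - 1) ^ k"
  have c: "?c > 0" using n by simp
  define f where "f = (\<lambda>i. (1 / ?c) *\<^sub>R psup (\<lambda>l. e (i * n ^ k + l)) {..<n ^ k})"
  have f0: "0 \<le> f i" for i unfolding f_def using c by (intro scaleR_nonneg_nonneg psup_nonneg) auto
  have f1: "norm (f i) \<le> 1" for i
    using Suc.IH[of "\<lambda>l. e (i * n ^ k + l)"] Suc.prems c by (simp add: f_def divide_le_eq)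
  have "psup e {..<n ^ Suc k} \<le> ?c *\<^sub>R psup f {..<n}"
  proof (rule psup_least)
    show "0 \<le> ?c *\<^sub>R psup f {..<n}" using c by (intro scaleR_nonneg_nonneg psup_nonneg) auto
    fix j assume j: "j \<in> {..<n ^ Suc k}"
    have nk: "n ^ k > 0" using n by simp
    have "e j = e ((j div n ^ k) * n ^ k + j mod n ^ k)" by (simp only: div_mult_mod_eq)
    also have "\<dots> \<le> psup (\<lambda>l. e ((j div n ^ k) * n ^ k + l)) {..<n ^ k}"
      using nk by (intro psup_upper[of _ _ "\<lambda>l. e ((j div n ^ k) * n ^ k + l)"]) auto
    also have "\<dots> = ?c *\<^sub>R f (j div n ^ k)"
    proof -
      have "x = c *\<^sub>R ((1 / c) *\<^sub>R x)" if "c > 0" for c and x :: 'e using that by simp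
      from this[OF c] show ?thesis unfolding f_def .
    qed
    also have "\<dots> \<le> ?c *\<^sub>R psup f {..<n}"
      using c j nk by (intro scaleR_left_mono psup_upper) (auto simp: less_mult_imp_div_less)
    finally show "e j \<le> ?c *\<^sub>R psup f {..<n}" .
  qed auto
  hence "norm (psup e {..<n ^ Suc k}) \<le> norm (?c *\<^sub>R psup f {..<n})"
    by (intro norm_mono_nonneg psup_nonneg) auto
  also have "\<dots> \<le> ?c * (real n - 1)"
    using bound[of f, OF f0 f1] c by (simp add: mult_left_mono)
  finally show ?case by (simp add: mult.commute)
qed

lemma norm_psup_card:
  fixes e :: "'i \<Rightarrow> 'e::banach_lattice"
  assumes n: "2 \<le> n"
    and bound: "\<And>e :: nat \<Rightarrow> 'e. (\<And>i. 0 \<le> e i) \<Longrightarrow> (\<And>i. norm (e i) \<le> 1) \<Longrightarrow> norm (psup e {..<n}) \<le> real n - 1"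
    and A: "finite A" "card A \<le> n ^ k" and \<rho>: "0 < \<rho>"
    and e: "\<And>i. i \<in> A \<Longrightarrow> 0 \<le> e i" "\<And>i. i \<in> A \<Longrightarrow> norm (e i) \<le> \<rho>"
  shows "norm (psup e A) \<le> \<rho> * (real n - 1) ^ k"
proof -
  obtain h where h: "bij_betw h {..<card A} A"
    using ex_bij_betw_nat_finite[OF A(1)] by (auto simp: atLeast0LessThan)
  have hA: "h i \<in> A" if "i < card A" for i using h that by (auto simp: bij_betw_def)
  define f where "f = (\<lambda>i. if i < card A then (1 / \<rho>) *\<^sub>R e (h i) else 0)"
  have f: "0 \<le> f i" "norm (f i) \<le> 1" for i
    using hA[of i] e \<rho> by (auto simp: f_def scaleR_nonneg_nonneg divide_le_eq)
  have "psup e A \<le> \<rho> *\<^sub>R psup f {..<n ^ k}"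
  proof (rule psup_least[OF A(1)])
    show "0 \<le> \<rho> *\<^sub>R psup f {..<n ^ k}" using \<rho> by (intro scaleR_nonneg_nonneg psup_nonneg) auto
    fix a assume "a \<in> A"
    then obtain i where i: "i < card A" "a = h i" using h by (auto simp: bij_betw_def)
    have "e a = \<rho> *\<^sub>R f i" using i \<rho> by (simp add: f_def)
    also have "\<dots> \<le> \<rho> *\<^sub>R psup f {..<n ^ k}"
      using i A(2) \<rho> by (intro scaleR_left_mono psup_upper) auto
    finally show "e a \<le> \<rho> *\<^sub>R psup f {..<n ^ k}" .
  qed
  hence "norm (psup e A) \<le> norm (\<rho> *\<^sub>R psup f {..<n ^ k})"
    using A(1) by (intro norm_mono_nonneg psup_nonneg) auto
  also have "\<dots> \<le> \<rho> * (real n - 1) ^ k"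
    using norm_psup_power[OF n bound f] \<rho> by (simp add: mult_left_mono)
  finally show ?thesis .
qed

text \<open>Vectors are grouped by the size of their norms. If the \<open>r\<close>-th powers sum to
  at most \<open>1\<close>, at most \<open>n ^ Suc j\<close> vectors have norm about
  \<open>\<rho> ^ j\<close>, so the power saving bounds their supremum by
  \<open>\<rho> ^ j * \<theta> ^ Suc j\<close>, and these bounds are summable.\<close>

lemma upper_estimate_of_bound:
  assumes n: "2 \<le> n"
    and bound: "\<And>e :: nat \<Rightarrow> 'e::banach_lattice. (\<And>i. 0 \<le> e i) \<Longrightarrow> (\<And>i. norm (e i) \<le> 1) \<Longrightarrow>
       norm (psup e {..<n}) \<le> real n - 1"
  shows "\<exists>r>1. \<exists>C. upper_estimate TYPE('e) r C"
proof -
  define \<theta> where "\<theta> = real n - 1"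
  \<comment> \<open>A number between \<open>n - 1\<close> and \<open>n\<close>: being less than
    \<open>n\<close> it makes \<open>r\<close> exceed \<open>1\<close>, being larger than
    \<open>n - 1\<close> it makes \<open>\<rho> * \<theta>\<close> less than \<open>1\<close>. The
    half keeps it above \<open>1\<close> even for \<open>n = 2\<close>.\<close>
  define q where "q = real n - 1 / 2"
  define r where "r = ln n / ln q"
  define \<rho> where "\<rho> = 1 / q"
  define C where "C = \<theta> / (1 - \<rho> * \<theta>)"
  have q: "1 < q" "q < n" using n by (auto simp: q_def)
  have r: "1 < r" using q n by (simp add: r_def less_divide_eq)
  have \<rho>: "0 < \<rho>" "\<rho> < 1" using q by (auto simp: \<rho>_def)
  have \<theta>: "0 < \<theta>" "\<rho> * \<theta> < 1" using n q by (auto simp: \<theta>_def \<rho>_def q_def field_simps)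
  have "q powr r = n" using q n by (simp add: powr_def r_def)
  hence \<rho>r: "\<rho> powr r = 1 / n" using q by (simp add: \<rho>_def powr_divide)
  have unit: "norm (psup e A) \<le> C"
    if A: "finite A" and e: "\<And>i. i \<in> A \<Longrightarrow> 0 \<le> e i" and sum1: "(\<Sum>i\<in>A. norm (e i) powr r) \<le> 1"
    for A :: "nat set" and e :: "nat \<Rightarrow> 'e"
  proof -
    define lev where "lev = (\<lambda>i. LEAST j. \<rho> ^ Suc j < norm (e i))"
    define A' where "A' = {i\<in>A. e i \<noteq> 0}"
    have A': "finite A'" using A by (simp add: A'_def)
    have lev: "\<rho> ^ Suc (lev i) < norm (e i)" "norm (e i) \<le> \<rho> ^ lev i" if i: "i \<in> A'" for i
    proof -
      have "\<exists>j. \<rho> ^ j < norm (e i)" using i \<rho> by (intro real_arch_pow_inv) (auto simp: A'_def)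
      then obtain j where "\<rho> ^ j < norm (e i)" by blast
      moreover have "\<rho> ^ Suc j \<le> \<rho> ^ j" using \<rho> by (intro power_decreasing) auto
      ultimately have "\<rho> ^ Suc j < norm (e i)" by simp
      thus "\<rho> ^ Suc (lev i) < norm (e i)" unfolding lev_def by (rule LeastI)
      show "norm (e i) \<le> \<rho> ^ lev i"
      proof (cases "lev i")
        case 0
        have "norm (e i) powr r \<le> (\<Sum>i\<in>A. norm (e i) powr r)"
          using i A by (intro member_le_sum) (auto simp: A'_def)
        hence le: "norm (e i) powr r \<le> 1" using sum1 by simp
        have "norm (e i) \<le> 1"
        proof (rule ccontr)
          assume "\<not> ?thesis"
          hence "1 < norm (e i) powr r" using r by (intro gr_one_powr) auto
          thus False using le by simp
        qed
        thus ?thesis using 0 by simp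
      next
        case (Suc j)
        hence "\<not> \<rho> ^ Suc j < norm (e i)"
          using not_less_Least[of j "\<lambda>j. \<rho> ^ Suc j < norm (e i)"] by (simp add: lev_def)
        thus ?thesis using Suc by simp
      qed
    qed
    define J where "J = Suc (Max (insert 0 (lev ` A')))"
    have J: "lev i < J" if "i \<in> A'" for i
      using that A' by (auto simp: J_def less_Suc_eq_le)
    have level: "norm (psup e {i\<in>A'. lev i = j}) \<le> \<rho> ^ j * \<theta> ^ Suc j" for j
      unfolding \<theta>_def
    proof (rule norm_psup_card[OF n bound])
      have "real (card {i\<in>A'. lev i = j}) * (1 / n) ^ Suc j = (\<Sum>i\<in>{i\<in>A'. lev i = j}. (\<rho> ^ Suc j) powr r)"
      proof -
        have "(\<rho> ^ Suc j) powr r = (\<rho> powr r) ^ Suc j"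
          using \<rho> by (simp only: powr_realpow[symmetric] powr_powr powr_gt_zero mult.commute)
        thus ?thesis using \<rho>r by simp
      qed
      also have "\<dots> \<le> (\<Sum>i\<in>{i\<in>A'. lev i = j}. norm (e i) powr r)"
        using lev(1) \<rho> r by (intro sum_mono powr_mono2) (auto intro: less_imp_le)
      also have "\<dots> \<le> (\<Sum>i\<in>A. norm (e i) powr r)"
        using A by (intro sum_mono2) (auto simp: A'_def)
      finally have "real (card {i\<in>A'. lev i = j}) * (1 / n) ^ Suc j \<le> 1" using sum1 by simp
      hence "real (card {i\<in>A'. lev i = j}) \<le> real n ^ Suc j"
        using n by (simp add: power_one_over divide_le_eq)
      thus "card {i\<in>A'. lev i = j} \<le> n ^ Suc j" by (metis of_nat_le_iff of_nat_power)
    qed (use A \<rho> e lev(2) in \<open>auto simp: A'_def\<close>)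
    have "psup e A \<le> (\<Sum>j<J. psup e {i\<in>A'. lev i = j})"
    proof (rule psup_least[OF A])
      show 0: "0 \<le> (\<Sum>j<J. psup e {i\<in>A'. lev i = j})" using A' by (intro sum_nonneg psup_nonneg) auto
      fix i assume i: "i \<in> A"
      show "e i \<le> (\<Sum>j<J. psup e {i\<in>A'. lev i = j})"
      proof (cases "i \<in> A'")
        case True
        have "e i \<le> psup e {k\<in>A'. lev k = lev i}" using A' True by (intro psup_upper) auto
        also have "\<dots> \<le> (\<Sum>j<J. psup e {i\<in>A'. lev i = j})"
          using J[OF True] A' by (subst sum.remove[of _ "lev i"])
            (auto intro!: add_increasing2 sum_nonneg psup_nonneg)
        finally show ?thesis .
      next
        case False
        then show ?thesis using i 0 by (auto simp: A'_def)
      qed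
    qed
    hence "norm (psup e A) \<le> norm (\<Sum>j<J. psup e {i\<in>A'. lev i = j})"
      using A by (intro norm_mono_nonneg psup_nonneg)
    also have "\<dots> \<le> (\<Sum>j<J. \<rho> ^ j * \<theta> ^ Suc j)"
      by (intro order_trans[OF norm_sum] sum_mono level)
    also have "\<dots> = \<theta> * (\<Sum>j<J. (\<rho> * \<theta>) ^ j)"
      by (simp add: sum_distrib_left power_mult_distrib mult_ac)
    also have "\<dots> \<le> \<theta> * (\<Sum>j. (\<rho> * \<theta>) ^ j)"
      using \<rho> \<theta> by (intro mult_left_mono sum_le_suminf summable_geometric) auto
    also have "(\<Sum>j. (\<rho> * \<theta>) ^ j) = 1 / (1 - \<rho> * \<theta>)"
      using \<rho> \<theta> by (intro suminf_geometric) auto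
    finally show ?thesis by (simp add: C_def)
  qed
  have "norm (psup e {..<k}) \<le> C * (\<Sum>i<k. norm (e i) powr r) powr (1 / r)"
    if e: "\<And>i. i < k \<Longrightarrow> 0 \<le> e i" for k and e :: "nat \<Rightarrow> 'e"
  proof -
    define T where "T = (\<Sum>i<k. norm (e i) powr r) powr (1 / r)"
    show ?thesis
    proof (cases "T = 0")
      case True
      hence "(\<Sum>i<k. norm (e i) powr r) = 0" by (simp add: T_def)
      hence "e i = 0" if "i < k" for i using that by (simp add: sum_nonneg_eq_0_iff)
      hence "psup e {..<k} = 0" by (intro antisym psup_least psup_nonneg) auto
      thus ?thesis using True by (simp add: T_def)
    next
      case False
      hence T: "T > 0" by (simp add: T_def less_le)
      have Tr: "T powr r = (\<Sum>i<k. norm (e i) powr r)"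
        using r by (simp add: T_def powr_powr sum_nonneg)
      have "(\<Sum>i<k. norm ((1 / T) *\<^sub>R e i) powr r) = (\<Sum>i<k. norm (e i) powr r) / T powr r"
        using T by (simp add: powr_divide sum_divide_distrib)
      also have "\<dots> \<le> 1" using T by (simp add: Tr[symmetric])
      finally have "norm (psup (\<lambda>i. (1 / T) *\<^sub>R e i) {..<k}) \<le> C"
        using T e by (intro unit) (auto intro: scaleR_nonneg_nonneg)
      hence "(1 / T) * norm (psup e {..<k}) \<le> C"
        using T by (simp add: psup_scaleR)
      thus ?thesis using T by (simp add: T_def[symmetric] divide_le_eq)
    qed
  qed
  thus ?thesis using r unfolding upper_estimate_def by blast
qed

lemma (in dyadic_maximal_bound) exists_upper_estimate:
  "\<exists>r>1. \<exists>C. upper_estimate TYPE('e) r C"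
proof -
  obtain m :: nat where m: "2 * (K + 1) < real m" using reals_Archimedean2 by blast
  hence "m \<noteq> 0" using K by (intro notI) simp
  hence "2 \<le> (2::nat) ^ m" by (cases m) auto
  thus ?thesis by (rule upper_estimate_of_bound) (use norm_psup_lt_card[OF m] in simp)
qed

subsection \<open>Sparse domination\<close>

text \<open>Each member of a finite laminar family is the disjoint union of the pieces below it, so
  measures and integrals over cubes become the sums \<open>below_sum\<close> of the weighted
  model.\<close>

definition atom :: "'a set set \<Rightarrow> 'a set \<Rightarrow> 'a set" where
  "atom D i = i - \<Union>{j\<in>D. j \<subset> i}"

lemma atom_exists:
  assumes "finite D" "Q \<in> D" "x \<in> Q"
  shows "\<exists>i\<in>D. i \<subseteq> Q \<and> x \<in> atom D i"
proof -
  have "finite {j\<in>D. x \<in> j}" "Q \<in> {j\<in>D. x \<in> j}" using assms by auto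
  from finite_has_minimal2[OF this] obtain i where
    i: "i \<in> {j\<in>D. x \<in> j}" "i \<subseteq> Q" "\<forall>j\<in>{j\<in>D. x \<in> j}. j \<subseteq> i \<longrightarrow> i = j" by auto
  hence "x \<in> atom D i" by (auto simp: atom_def)
  thus ?thesis using i by blast
qed

lemma atom_disjoint:
  assumes "laminar D" "i \<in> D" "j \<in> D" "i \<noteq> j"
  shows "atom D i \<inter> atom D j = {}"
proof -
  have "i \<subseteq> j \<or> j \<subseteq> i \<or> i \<inter> j = {}" using assms(1-3) unfolding laminar_def by blast
  thus ?thesis using assms(2-4) unfolding atom_def by blast
qed

lemma indicator_atoms:
  assumes "finite D" "laminar D" "Q \<in> D"
  shows "indicat_real Q x = (\<Sum>i\<in>{i\<in>D. i \<subseteq> Q}. indicator (atom D i) x)"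
proof -
  have "Q = (\<Union>i\<in>{i\<in>D. i \<subseteq> Q}. atom D i)"
  proof (intro antisym subsetI)
    fix x assume "x \<in> Q"
    from atom_exists[OF assms(1,3) this] show "x \<in> (\<Union>i\<in>{i\<in>D. i \<subseteq> Q}. atom D i)" by blast
  qed (auto simp: atom_def)
  moreover have "disjoint_family_on (atom D) {i\<in>D. i \<subseteq> Q}"
    using atom_disjoint[OF assms(2)] by (auto simp: disjoint_family_on_def)
  ultimately show ?thesis
    using indicator_UN_disjoint[of "{i\<in>D. i \<subseteq> Q}" "atom D" x] assms(1) by simp
qed

lemma has_strong_integral_atoms:
  assumes D: "finite D" "laminar D" "Q \<in> D"
    and I: "\<And>i. i \<in> D \<Longrightarrow> has_strong_integral M (\<lambda>x. indicator (atom D i) x *\<^sub>R f x) (I i)"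
  shows "strong_integral M (\<lambda>x. indicator Q x *\<^sub>R f x) = below_sum D I Q"
proof -
  have "has_strong_integral M (\<lambda>x. \<Sum>i\<in>{i\<in>D. i \<subseteq> Q}. indicator (atom D i) x *\<^sub>R f x) (\<Sum>i\<in>{i\<in>D. i \<subseteq> Q}. I i)"
    using I by (intro has_strong_integral_sum) auto
  moreover have "(\<lambda>x. \<Sum>i\<in>{i\<in>D. i \<subseteq> Q}. indicator (atom D i) x *\<^sub>R f x) = (\<lambda>x. indicator Q x *\<^sub>R f x)"
    by (simp add: fun_eq_iff indicator_atoms[OF D] scaleR_sum_left)
  ultimately show ?thesis by (simp add: strong_integral_eq below_sum_def)
qed

text \<open>The constant is a product of two losses: \<open>\<bar>C\<bar>\<close> for adding up
  stopping cubes and \<open>8 * (K + 1)\<close> for the averages belonging to one stopping cube. The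
  half in the weak type estimate is exactly the half in the definition of sparseness.\<close>

lemma (in dyadic_maximal_bound) sparse_domination_of_upper_estimate:
  fixes \<mu> :: "(real ^ 'd::finite) measure"
  assumes \<mu>: "sets \<mu> = sets borel" "locally_finite_measure \<mu>"
    and U: "upper_estimate TYPE('e) q C" and q: "1 \<le> q"
  shows "sparse_domination TYPE('e) \<mu> q (\<bar>C\<bar> * (8 * (K + 1)))"
  unfolding sparse_domination_def
proof (intro allI impI)
  fix f :: "real ^ 'd \<Rightarrow> 'e" and D :: "(real ^ 'd) set set"
  assume D_dy: "D \<subseteq> dyadic_cubes" and f: "locally_integrable \<mu> f" and fin: "finite D"
  define \<Lambda> where "\<Lambda> = 8 * (K + 1)"
  have \<Lambda>: "1 \<le> \<Lambda>" using K by (simp add: \<Lambda>_def)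
  note D = fin laminar_subset[OF laminar_dyadic_cubes D_dy]
  have D_sets: "Q \<in> sets \<mu>" if "Q \<in> D" for Q
    using D_dy that dyadic_cube_borel \<mu>(1) by auto
  have D_fin: "emeasure \<mu> Q < \<infinity>" if "Q \<in> D" for Q
    using D_dy that \<mu> by (intro locally_finite_bounded dyadic_cube_bounded) auto
  have atom_sets: "atom D i \<in> sets \<mu>" if "i \<in> D" for i
    unfolding atom_def using that D_sets fin by (intro sets.Diff sets.finite_Union) auto
  have atom_sub: "atom D i \<subseteq> i" for i by (auto simp: atom_def)
  have atom_fin: "emeasure \<mu> (atom D i) < \<infinity>" if "i \<in> D" for i
    using emeasure_mono[OF atom_sub D_sets[OF that]] D_fin[OF that] by (rule le_less_trans)
  define u where "u = (\<lambda>i. strong_integral \<mu> (\<lambda>x. indicator (atom D i) x *\<^sub>R \<bar>f x\<bar>))"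
  define \<alpha> where "\<alpha> = (\<lambda>i. strong_integral \<mu> (\<lambda>x. indicator (atom D i) x *\<^sub>R norm (f x)))"
  have u: "has_strong_integral \<mu> (\<lambda>x. indicator (atom D i) x *\<^sub>R \<bar>f x\<bar>) (u i)" "0 \<le> u i"
    and \<alpha>: "has_strong_integral \<mu> (\<lambda>x. indicator (atom D i) x *\<^sub>R norm (f x)) (\<alpha> i)"
      "norm (u i) \<le> \<alpha> i" "measure \<mu> (atom D i) = 0 \<Longrightarrow> \<alpha> i = 0" if i: "i \<in> D" for i
  proof -
    let ?h = "\<lambda>x. indicator (atom D i) x *\<^sub>R f x"
    have "bounded (atom D i)"
      using bounded_subset[OF dyadic_cube_bounded atom_sub] D_dy i by auto
    then obtain I where I: "has_strong_integral \<mu> ?h I"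
      using locally_integrable_bounded[OF \<mu>(1) f] atom_sets[OF i] \<mu>(1) by blast
    obtain v where v: "has_strong_integral \<mu> (\<lambda>x. \<bar>?h x\<bar>) v" "0 \<le> v"
      using has_strong_integral_abs[OF I] by blast
    obtain a where a: "has_strong_integral \<mu> (\<lambda>x. norm (?h x)) a" "0 \<le> a"
      "ennreal a = (\<integral>\<^sup>+x. ennreal (norm (?h x)) \<partial>\<mu>)"
      using has_strong_integral_norm[OF I] by blast
    have "ennreal (norm v) \<le> ennreal a" using norm_strong_integral_le[OF v(1)] a(3) by simp
    hence va: "norm v \<le> a" using a(2) by simp
    have "a = 0" if "measure \<mu> (atom D i) = 0"
    proof -
      have "emeasure \<mu> (atom D i) = 0"
        using that atom_fin[OF i] by (auto simp: measure_def enn2real_eq_0_iff)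
      hence "AE x in \<mu>. x \<notin> atom D i" using atom_sets[OF i] by (intro AE_not_in) (simp add: null_sets_def)
      hence "(\<integral>\<^sup>+x. ennreal (norm (?h x)) \<partial>\<mu>) = (\<integral>\<^sup>+x. 0 \<partial>\<mu>)"
        by (intro nn_integral_cong_AE) (auto elim!: eventually_mono)
      thus "a = 0" using a by simp
    qed
    moreover have "(\<lambda>x. \<bar>?h x\<bar>) = (\<lambda>x. indicator (atom D i) x *\<^sub>R \<bar>f x\<bar>)"
      by (simp add: fun_eq_iff abs_scaleR_lattice)
    moreover have "(\<lambda>x. norm (?h x)) = (\<lambda>x. indicator (atom D i) x *\<^sub>R norm (f x))"
      by (simp add: fun_eq_iff)
    moreover from calculation have "u i = v" "\<alpha> i = a"
      using v(1) a(1) by (simp_all add: u_def \<alpha>_def strong_integral_eq)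
    ultimately show "has_strong_integral \<mu> (\<lambda>x. indicator (atom D i) x *\<^sub>R \<bar>f x\<bar>) (u i)" "0 \<le> u i"
      "has_strong_integral \<mu> (\<lambda>x. indicator (atom D i) x *\<^sub>R norm (f x)) (\<alpha> i)"
      "norm (u i) \<le> \<alpha> i" "measure \<mu> (atom D i) = 0 \<Longrightarrow> \<alpha> i = 0"
      using v a va by simp_all
  qed
  define w where "w = (\<lambda>i. measure \<mu> (atom D i))"
  have w0: "0 \<le> w i" for i by (simp add: w_def)
  have W: "measure \<mu> Q = below_sum D w Q" if "Q \<in> D" for Q
  proof -
    have "strong_integral \<mu> (\<lambda>x. indicator Q x *\<^sub>R (1::real)) = below_sum D w Q"
      using has_strong_integral_indicator[OF atom_sets atom_fin, where c = "1::real"]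
      by (intro has_strong_integral_atoms D that) (simp add: w_def)
    thus ?thesis
      using strong_integral_eq[OF has_strong_integral_indicator[OF D_sets D_fin, OF that that, where c = "1::real"]] by simp
  qed
  define avg where "avg = laminar_average D w u"
  define nrm where "nrm = laminar_average D w \<alpha>"
  have avg: "average \<mu> Q (\<lambda>x. \<bar>f x\<bar>) = avg Q" if "Q \<in> D" for Q
    using has_strong_integral_atoms[OF D that u(1)] W[OF that]
    by (simp add: average_def avg_def laminar_average_def)
  have nrm: "average \<mu> Q (\<lambda>x. norm (f x)) = nrm Q" if "Q \<in> D" for Q
    using has_strong_integral_atoms[OF D that \<alpha>(1)] W[OF that]
    by (simp add: average_def nrm_def laminar_average_def)
  have avg0: "0 \<le> avg Q" for Q
    unfolding avg_def laminar_average_def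
    by (intro scaleR_nonneg_nonneg below_sum_nonneg u(2)) (simp add: below_sum_nonneg w0)
  have avg_nrm: "norm (avg Q) \<le> nrm Q" for Q
  proof -
    have "norm (below_sum D u Q) \<le> below_sum D \<alpha> Q"
      unfolding below_sum_def using \<alpha>(2) by (intro order_trans[OF norm_sum] sum_mono) auto
    moreover have "0 \<le> below_sum D w Q" by (simp add: below_sum_nonneg w0)
    ultimately show ?thesis
      by (simp add: avg_def nrm_def laminar_average_def divide_right_mono)
  qed
  have nrm0: "0 \<le> nrm Q" for Q using avg_nrm[of Q] norm_ge_zero order_trans by blast
  define P where "P = (\<lambda>S Q. psup avg {R\<in>D. Q \<subseteq> R \<and> R \<subseteq> S})"
  define bad where "bad = (\<lambda>S Q. \<Lambda> * nrm S < norm (P S Q))"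
  obtain \<S> where \<S>: "\<S> \<subseteq> D"
    and near': "\<forall>Q\<in>D. \<exists>S\<in>\<S>. Q \<subseteq> S \<and> (\<forall>T\<in>\<S>. Q \<subseteq> T \<longrightarrow> S \<subseteq> T) \<and> (Q = S \<or> \<not> bad S Q)"
    and stop': "\<forall>S\<in>\<S>. \<forall>T\<in>\<S>. T \<subset> S \<longrightarrow> (\<forall>R\<in>\<S>. T \<subset> R \<longrightarrow> S \<subseteq> R) \<longrightarrow> bad S T"
    using stopping_family[OF D, of bad] by (elim exE conjE)
  note near = bspec[OF near'] and stop = bspec[OF bspec[OF stop'], THEN mp, THEN mp]
  have fin_S: "finite \<S>" using \<S> fin by (rule finite_subset)
  \<comment> \<open>Needed for the alternative \<open>Q = S\<close> in the stopping family; it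
    relies on \<open>1 \<le> \<Lambda>\<close>.\<close>
  have not_bad_self: "\<not> bad S S" if "S \<in> D" for S
  proof -
    have "{R\<in>D. S \<subseteq> R \<and> R \<subseteq> S} = {S}" using that by auto
    hence "P S S = avg S" using avg0 by (simp add: P_def psup_insert sup_absorb1)
    moreover have "nrm S \<le> \<Lambda> * nrm S" using \<Lambda> nrm0[of S] by (simp add: mult_le_cancel_right1)
    ultimately show ?thesis using avg_nrm[of S] by (simp add: bad_def)
  qed
  have bad_mass: "sum w {i\<in>D. i \<subseteq> S \<and> bad S i} \<le> measure \<mu> S / 2" if "S \<in> D" for S
    using laminar_weak_type[OF D w0 u(2) \<alpha>(2) _ that] \<alpha>(3) W[OF that]
    by (simp add: bad_def P_def avg_def nrm_def \<Lambda>_def w_def)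
  define E where "E = (\<lambda>S. S - \<Union>{T\<in>\<S>. T \<subset> S})"
  have E_sets: "E S \<in> sets \<mu>" if "S \<in> \<S>" for S
    unfolding E_def using that D_sets \<S> fin_S by (intro sets.Diff sets.finite_Union) auto
  have "emeasure \<mu> S / 2 \<le> emeasure \<mu> (E S)" if S: "S \<in> \<S>" for S
  proof -
    have SD: "S \<in> D" using S \<S> by auto
    let ?N = "\<Union>{T\<in>\<S>. T \<subset> S}"
    have N_sets: "?N \<in> sets \<mu>" using D_sets \<S> fin_S by (intro sets.finite_Union) auto
    \<comment> \<open>Points of smaller stopping cubes lie in a maximal one \<open>T\<close>, which
      is bad for \<open>S\<close>. Badness passes to every atom below \<open>T\<close>, because the
      chain of cubes up to \<open>S\<close> only grows.\<close>
    have "?N \<subseteq> (\<Union>i\<in>{i\<in>D. i \<subseteq> S \<and> bad S i}. atom D i)"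
    proof
      fix x assume "x \<in> ?N"
      then obtain T0 where T0: "T0 \<in> {T\<in>\<S>. T \<subset> S}" "x \<in> T0" by blast
      have "finite {T\<in>\<S>. T \<subset> S}" using fin_S by simp
      from maxl_above[OF this T0(1)] obtain T where T: "T \<in> maxl {T\<in>\<S>. T \<subset> S}" "T0 \<subseteq> T" by blast
      have TS: "T \<in> \<S>" "T \<subset> S" using maxlD(1)[OF T(1)] by auto
      have "\<forall>R\<in>\<S>. T \<subset> R \<longrightarrow> S \<subseteq> R"
      proof (intro ballI impI)
        fix R assume R: "R \<in> \<S>" "T \<subset> R"
        have "S \<subseteq> R \<or> R \<subseteq> S"
          using R TS \<S> SD by (intro laminar_nested[OF D(2), of T]) auto
        moreover have "\<not> R \<subset> S" using maxlD(2)[OF T(1), of R] R by auto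
        ultimately show "S \<subseteq> R" by auto
      qed
      hence bad_T: "bad S T" by (rule stop[OF S TS])
      have TD: "T \<in> D" using TS \<S> by auto
      obtain i where i: "i \<in> D" "i \<subseteq> T" "x \<in> atom D i"
        using atom_exists[OF fin TD] T0(2) T(2) by blast
      have "norm (P S T) \<le> norm (P S i)"
        unfolding P_def using i fin by (intro norm_psup_mono) auto
      hence "bad S i" using bad_T by (simp add: bad_def)
      thus "x \<in> (\<Union>i\<in>{i\<in>D. i \<subseteq> S \<and> bad S i}. atom D i)" using i TS by auto
    qed
    hence "emeasure \<mu> ?N \<le> emeasure \<mu> (\<Union>i\<in>{i\<in>D. i \<subseteq> S \<and> bad S i}. atom D i)"
      using fin atom_sets by (intro emeasure_mono sets.finite_UN) auto
    also have "\<dots> \<le> (\<Sum>i\<in>{i\<in>D. i \<subseteq> S \<and> bad S i}. emeasure \<mu> (atom D i))"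
      using fin atom_sets by (intro emeasure_subadditive_finite) auto
    also have "\<dots> = (\<Sum>i\<in>{i\<in>D. i \<subseteq> S \<and> bad S i}. ennreal (w i))"
      using atom_fin by (intro sum.cong) (auto simp: w_def emeasure_eq_ennreal_measure less_top)
    also have "\<dots> = ennreal (sum w {i\<in>D. i \<subseteq> S \<and> bad S i})" using w0 by (intro sum_ennreal) auto
    also have "\<dots> \<le> ennreal (measure \<mu> S / 2)" by (intro ennreal_leI bad_mass SD)
    finally have N: "emeasure \<mu> ?N \<le> ennreal (measure \<mu> S / 2)" .
    have mS: "emeasure \<mu> S = ennreal (measure \<mu> S)"
      using D_fin[OF SD] by (simp add: emeasure_eq_ennreal_measure less_top)
    have "emeasure \<mu> S / 2 = ennreal (measure \<mu> S - measure \<mu> S / 2)"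
      unfolding mS by (simp add: ennreal_divide_numeral)
    also have "\<dots> = emeasure \<mu> S - ennreal (measure \<mu> S / 2)"
      unfolding mS by (simp add: ennreal_minus)
    also have "\<dots> \<le> emeasure \<mu> S - emeasure \<mu> ?N" using N by (intro ennreal_minus_mono) auto
    also have "\<dots> = emeasure \<mu> (E S)"
      unfolding E_def using D_sets[OF SD] N_sets N
      by (intro emeasure_Diff[symmetric]) (auto simp: top_unique)
    finally show ?thesis .
  qed
  moreover have "disjoint_family_on E \<S>"
  proof -
    have "E S \<inter> E T = {}" if ST: "S \<in> \<S>" "T \<in> \<S>" "S \<noteq> T" for S T
    proof -
      have "S \<subseteq> T \<or> T \<subseteq> S \<or> S \<inter> T = {}" using ST \<S> D(2) unfolding laminar_def by blast
      thus ?thesis using ST unfolding E_def by blast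
    qed
    thus ?thesis by (simp add: disjoint_family_on_def)
  qed
  ultimately have sparse: "sparse \<mu> \<S>"
    unfolding sparse_def using E_sets by (intro exI[of _ E]) (auto simp: E_def)
  \<comment> \<open>The estimate is obtained at every point, not only almost everywhere.\<close>
  have dom: "norm (lattice_maximal \<mu> D f x) \<le> \<bar>C\<bar> * \<Lambda> * sparse_operator \<mu> q \<S> (\<lambda>y. norm (f y)) x" for x
  proof -
    define Dx where "Dx = {Q\<in>D. x \<in> Q}"
    define Sx where "Sx = {S\<in>\<S>. x \<in> S}"
    \<comment> \<open>The cubes through \<open>x\<close> whose smallest enclosing stopping cube is
      \<open>S\<close>. They form a chain, so their supremum is controlled by \<open>P S Q\<close>
      for the smallest of them, and \<open>Q\<close> is not bad for \<open>S\<close>.\<close>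
    define own where "own = (\<lambda>S. {Q\<in>Dx. Q \<subseteq> S \<and> (\<forall>T\<in>\<S>. Q \<subseteq> T \<longrightarrow> S \<subseteq> T)})"
    define g where "g = (\<lambda>S. psup avg (own S))"
    have fin_x: "finite Dx" "finite Sx" "finite (own S)" for S
      using fin fin_S by (auto simp: Dx_def Sx_def own_def)
    have g0: "0 \<le> g S" for S unfolding g_def by (intro psup_nonneg fin_x)
    have "lattice_maximal \<mu> D f x = psup (\<lambda>Q. indicator Q x *\<^sub>R average \<mu> Q (\<lambda>y. \<bar>f y\<bar>)) D"
      by (simp add: lattice_maximal_def psup_def)
    also have "\<dots> \<le> psup g Sx"
    proof (rule psup_least[OF fin])
      show 0: "0 \<le> psup g Sx" by (intro psup_nonneg fin_x)
      fix Q assume Q: "Q \<in> D"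
      show "indicator Q x *\<^sub>R average \<mu> Q (\<lambda>y. \<bar>f y\<bar>) \<le> psup g Sx"
      proof (cases "x \<in> Q")
        case True
        obtain S where S: "S \<in> \<S>" "Q \<subseteq> S" "\<forall>T\<in>\<S>. Q \<subseteq> T \<longrightarrow> S \<subseteq> T" using near[OF Q] by blast
        have "avg Q \<le> g S" unfolding g_def
          using Q True S by (intro psup_upper fin_x) (auto simp: own_def Dx_def)
        also have "\<dots> \<le> psup g Sx" using S True by (intro psup_upper fin_x) (auto simp: Sx_def)
        finally show ?thesis using True avg[OF Q] by simp
      qed (use 0 in simp)
    qed
    finally have "norm (lattice_maximal \<mu> D f x) \<le> norm (psup g Sx)"
    proof (rule norm_mono_nonneg[rotated])
      show "0 \<le> lattice_maximal \<mu> D f x"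
        using psup_nonneg[OF fin, of "\<lambda>Q. indicator Q x *\<^sub>R average \<mu> Q (\<lambda>y. \<bar>f y\<bar>)"]
        by (simp add: lattice_maximal_def psup_def)
    qed
    also have "\<dots> \<le> C * (\<Sum>S\<in>Sx. norm (g S) powr q) powr (1 / q)"
      by (intro upper_estimateD[OF U] fin_x g0)
    also have "\<dots> \<le> \<bar>C\<bar> * (\<Sum>S\<in>Sx. (\<Lambda> * nrm S) powr q) powr (1 / q)"
    proof -
      have "norm (g S) \<le> \<Lambda> * nrm S" if S: "S \<in> Sx" for S
      proof (cases "own S = {}")
        case True
        then show ?thesis using \<Lambda> nrm0[of S] by (simp add: g_def)
      next
        case False
        obtain Q where Q: "Q \<in> own S" "\<And>R. R \<in> own S \<Longrightarrow> R \<subseteq> Q \<Longrightarrow> R = Q"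
          using finite_has_minimal[OF fin_x(3) False] by metis
        have QD: "Q \<in> D" "x \<in> Q" "Q \<subseteq> S" using Q(1) by (auto simp: own_def Dx_def)
        have "own S \<subseteq> {R\<in>D. Q \<subseteq> R \<and> R \<subseteq> S}"
        proof
          fix R assume R: "R \<in> own S"
          hence RD: "R \<in> D" "x \<in> R" "R \<subseteq> S" by (auto simp: own_def Dx_def)
          have "Q \<subseteq> R \<or> R \<subseteq> Q \<or> Q \<inter> R = {}" using QD(1) RD(1) D(2) unfolding laminar_def by blast
          thus "R \<in> {R\<in>D. Q \<subseteq> R \<and> R \<subseteq> S}" using QD RD Q(2)[OF R] by auto
        qed
        hence "norm (g S) \<le> norm (P S Q)"
          unfolding g_def P_def using fin by (intro norm_psup_mono) auto
        moreover have "\<not> bad S Q"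
        proof -
          obtain S' where S': "S' \<in> \<S>" "Q \<subseteq> S'" "\<forall>T\<in>\<S>. Q \<subseteq> T \<longrightarrow> S' \<subseteq> T" "Q = S' \<or> \<not> bad S' Q"
            using near[OF QD(1)] by blast
          have "S' = S" using S' Q(1) S QD(3) by (auto simp: own_def Sx_def)
          thus ?thesis using S'(4) not_bad_self QD(1) by auto
        qed
        ultimately show ?thesis by (simp add: bad_def)
      qed
      hence "(\<Sum>S\<in>Sx. norm (g S) powr q) powr (1 / q) \<le> (\<Sum>S\<in>Sx. (\<Lambda> * nrm S) powr q) powr (1 / q)"
        using q by (intro powr_mono2 sum_mono sum_nonneg) auto
      thus ?thesis by (intro mult_mono) auto
    qed
    also have "(\<Sum>S\<in>Sx. (\<Lambda> * nrm S) powr q) powr (1 / q) = \<Lambda> * (\<Sum>S\<in>Sx. nrm S powr q) powr (1 / q)"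
    proof -
      have "(\<Sum>S\<in>Sx. (\<Lambda> * nrm S) powr q) = \<Lambda> powr q * (\<Sum>S\<in>Sx. nrm S powr q)"
        using \<Lambda> nrm0 by (simp add: powr_mult sum_distrib_left)
      thus ?thesis using \<Lambda> q by (simp add: powr_mult powr_powr sum_nonneg)
    qed
    also have "(\<Sum>S\<in>Sx. nrm S powr q) powr (1 / q) = sparse_operator \<mu> q \<S> (\<lambda>y. norm (f y)) x"
    proof -
      have "(\<Sum>S\<in>\<S>. average \<mu> S (\<lambda>y. \<bar>norm (f y)\<bar>) powr q * indicator S x)
          = (\<Sum>S\<in>\<S>. if x \<in> S then nrm S powr q else 0)"
        using nrm \<S> by (intro sum.cong) auto
      also have "\<dots> = (\<Sum>S\<in>Sx. nrm S powr q)"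
        unfolding Sx_def using fin_S by (simp add: sum.inter_filter)
      finally show ?thesis by (simp add: sparse_operator_def)
    qed
    finally show ?thesis by (simp add: mult.assoc)
  qed
  thus "\<exists>\<S>\<subseteq>D. sparse \<mu> \<S> \<and> (AE x in \<mu>. norm (lattice_maximal \<mu> D f x)
      \<le> \<bar>C\<bar> * (8 * (K + 1)) * sparse_operator \<mu> q \<S> (\<lambda>y. norm (f y)) x)"
    using \<S> sparse unfolding \<Lambda>_def by auto
qed

subsection \<open>Sharpness\<close>

text \<open>An increasing sequence of dyadic cubes with a corner at the origin never leaves its
  orthant. There are finitely many orthants, selected by \<sigma>, so one of them has infinite
  measure.\<close>

lemma dyadic_cubes_exhaust:
  fixes \<mu> :: "(real ^ 'd::finite) measure"
  assumes \<mu>: "sets \<mu> = sets borel" and inf: "emeasure \<mu> UNIV = \<infinity>"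
  shows "\<exists>P. (\<forall>k. P k \<in> dyadic_cubes) \<and> (\<forall>k. P k \<subseteq> P (Suc k)) \<and> (SUP k::nat. emeasure \<mu> (P k)) = \<infinity>"
proof -
  define Q :: "('d \<Rightarrow> bool) \<Rightarrow> nat \<Rightarrow> (real ^ 'd) set"
    where "Q = (\<lambda>\<sigma> k. dcube (- int k) (\<lambda>i. if \<sigma> i then 0 else -1))"
  have mem: "x \<in> Q \<sigma> k \<longleftrightarrow> (\<forall>i. if \<sigma> i then 0 \<le> x $ i \<and> x $ i < 2 ^ k else - (2 ^ k) \<le> x $ i \<and> x $ i < 0)" for x \<sigma> k
  proof -
    have "\<lfloor>2 powi (- int k) * y\<rfloor> = 0 \<longleftrightarrow> 0 \<le> y \<and> y < 2 ^ k" "\<lfloor>2 powi (- int k) * y\<rfloor> = -1 \<longleftrightarrow> - (2 ^ k) \<le> y \<and> y < 0" for y :: real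
      by (auto simp: power_int_minus floor_eq_iff field_simps)
    thus ?thesis unfolding Q_def dcube_def by auto
  qed
  have Q_dy: "Q \<sigma> k \<in> dyadic_cubes" for \<sigma> k unfolding Q_def by (rule dcube_dyadic)
  have Q_sets: "Q \<sigma> k \<in> sets \<mu>" for \<sigma> k using dyadic_cube_borel[OF Q_dy] \<mu> by simp
  have Q_mono: "Q \<sigma> k \<subseteq> Q \<sigma> (Suc k)" for \<sigma> k
  proof
    fix x assume x: "x \<in> Q \<sigma> k"
    have "if \<sigma> i then 0 \<le> x $ i \<and> x $ i < 2 ^ Suc k else - (2 ^ Suc k) \<le> x $ i \<and> x $ i < 0" for i
    proof -
      have "(0::real) < 2 ^ k" "(2::real) ^ Suc k = 2 ^ k + 2 ^ k" by simp_all
      moreover have "if \<sigma> i then 0 \<le> x $ i \<and> x $ i < 2 ^ k else - (2 ^ k) \<le> x $ i \<and> x $ i < 0"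
        using x unfolding mem by blast
      ultimately show ?thesis by (cases "\<sigma> i") (simp_all only: if_True if_False, auto)
    qed
    thus "x \<in> Q \<sigma> (Suc k)" unfolding mem by blast
  qed
  have cover: "UNIV = (\<Union>\<sigma>. \<Union>k. Q \<sigma> k)"
  proof (intro antisym subsetI UNIV_I)
    fix x :: "real ^ 'd"
    obtain k :: nat where k: "norm x < 2 ^ k" using real_arch_pow[of 2 "norm x"] by auto
    have "\<bar>x $ i\<bar> < 2 ^ k" for i using component_le_norm_cart[of x i] k by linarith
    hence "x \<in> Q (\<lambda>i. 0 \<le> x $ i) k" unfolding mem by (auto simp: abs_less_iff less_imp_le minus_less_iff)
    thus "x \<in> (\<Union>\<sigma>. \<Union>k. Q \<sigma> k)" by blast
  qed
  have "\<exists>\<sigma>. emeasure \<mu> (\<Union>k. Q \<sigma> k) = \<infinity>"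
  proof (rule ccontr)
    assume "\<not> ?thesis"
    hence "(\<Sum>\<sigma>\<in>UNIV. emeasure \<mu> (\<Union>k. Q \<sigma> k)) < emeasure \<mu> UNIV" by (auto simp: less_top inf)
    moreover have "emeasure \<mu> UNIV \<le> (\<Sum>\<sigma>\<in>UNIV. emeasure \<mu> (\<Union>k. Q \<sigma> k))"
      by (subst cover, intro emeasure_subadditive_finite) (use Q_sets in auto)
    ultimately show False by (metis not_le)
  qed
  then obtain \<sigma> where \<sigma>: "emeasure \<mu> (\<Union>k. Q \<sigma> k) = \<infinity>" by blast
  have "(SUP k. emeasure \<mu> (Q \<sigma> k)) = emeasure \<mu> (\<Union>k. Q \<sigma> k)"
    using Q_sets Q_mono by (intro SUP_emeasure_incseq incseq_SucI) auto
  thus ?thesis using \<sigma> Q_dy Q_mono by (intro exI[of _ "Q \<sigma>"]) auto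
qed

text \<open>Each cube of the exhausting sequence has finite measure while the measures are
  unbounded, so a cube \<open>L\<close> times as heavy is always found further along.\<close>

lemma dyadic_chain:
  fixes \<mu> :: "(real ^ 'd::finite) measure"
  assumes \<mu>: "sets \<mu> = sets borel" "locally_finite_measure \<mu>" and inf: "emeasure \<mu> UNIV = \<infinity>"
    and L: "1 < L"
  shows "\<exists>T :: nat \<Rightarrow> (real ^ 'd) set. (\<forall>k. T k \<in> dyadic_cubes \<and> 0 < measure \<mu> (T k)) \<and>
    (\<forall>k. T k \<subseteq> T (Suc k) \<and> L * measure \<mu> (T k) \<le> measure \<mu> (T (Suc k)))"
proof -
  obtain P where P: "\<And>k. P k \<in> dyadic_cubes" "\<And>k. P k \<subseteq> P (Suc k)" "(SUP k::nat. emeasure \<mu> (P k)) = \<infinity>"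
    using dyadic_cubes_exhaust[OF \<mu>(1) inf] by blast
  have fin: "emeasure \<mu> (P k) < \<infinity>" for k
    using P(1) \<mu> by (intro locally_finite_bounded dyadic_cube_bounded) auto
  have m: "emeasure \<mu> (P k) = ennreal (measure \<mu> (P k))" for k
    using fin[of k] by (simp add: emeasure_eq_ennreal_measure less_top)
  have mono: "P k \<subseteq> P l" if "k \<le> l" for k l using P(2) that by (rule lift_Suc_mono_le)
  have large: "\<exists>k. B < measure \<mu> (P k)" for B
  proof -
    have "ennreal B < (SUP k. emeasure \<mu> (P k))" unfolding P(3) by simp
    then obtain k where "ennreal B < emeasure \<mu> (P k)" unfolding less_SUP_iff by blast
    hence "ennreal B < ennreal (measure \<mu> (P k))" unfolding m .
    hence "B < measure \<mu> (P k)" by (metis ennreal_leI not_le)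
    thus ?thesis ..
  qed
  have "\<exists>\<kappa>. \<forall>i. 0 < measure \<mu> (P (\<kappa> i)) \<and> L * measure \<mu> (P (\<kappa> i)) < measure \<mu> (P (\<kappa> (Suc i)))"
  proof (rule dependent_nat_choice[where P = "\<lambda>_ k. 0 < measure \<mu> (P k)" and Q = "\<lambda>_ k l. L * measure \<mu> (P k) < measure \<mu> (P l)", simplified all_conj_distrib[symmetric]])
    show "\<exists>x. 0 < measure \<mu> (P x)" by (rule large)
    show "\<exists>y. 0 < measure \<mu> (P y) \<and> L * measure \<mu> (P x) < measure \<mu> (P y)" if "0 < measure \<mu> (P x)" for x
    proof -
      obtain y where "L * measure \<mu> (P x) < measure \<mu> (P y)" using large by blast
      moreover have "0 < L * measure \<mu> (P x)" using L that by simp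
      ultimately show ?thesis by (intro exI[of _ y]) linarith
    qed
  qed
  then obtain \<kappa> where \<kappa>: "\<And>i. 0 < measure \<mu> (P (\<kappa> i))"
    "\<And>i. L * measure \<mu> (P (\<kappa> i)) < measure \<mu> (P (\<kappa> (Suc i)))" by blast
  have "\<kappa> i \<le> \<kappa> (Suc i)" for i
  proof (rule ccontr)
    assume "\<not> ?thesis"
    hence "P (\<kappa> (Suc i)) \<subseteq> P (\<kappa> i)" by (intro mono) simp
    hence "emeasure \<mu> (P (\<kappa> (Suc i))) \<le> emeasure \<mu> (P (\<kappa> i))"
      using dyadic_cube_borel[OF P(1)] \<mu>(1) by (intro emeasure_mono) auto
    hence "measure \<mu> (P (\<kappa> (Suc i))) \<le> measure \<mu> (P (\<kappa> i))" by (simp add: m)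
    moreover have "1 * measure \<mu> (P (\<kappa> i)) \<le> L * measure \<mu> (P (\<kappa> i))" using L by (intro mult_right_mono) auto
    ultimately show False using \<kappa>(2)[of i] by simp
  qed
  thus ?thesis using \<kappa> P(1) mono
    by (intro exI[of _ "\<lambda>i. P (\<kappa> i)"]) (auto intro: less_imp_le)
qed

text \<open>On a rapidly growing chain of cubes, let \<open>f\<close> take the value \<open>e k\<close> on the \<open>k\<close>-th cube outside the
  previous one. Then the average over the \<open>k\<close>-th cube is almost \<open>e k\<close>, so that the maximal function
  on the smallest cube almost dominates \<open>sup e k\<close>.\<close>

lemma upper_estimate_of_sparse_domination:
  fixes \<mu> :: "(real ^ 'd::finite) measure"
  assumes \<mu>: "sets \<mu> = sets borel" "locally_finite_measure \<mu>" and inf: "emeasure \<mu> UNIV = \<infinity>"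
    and q: "0 < q" and sd: "sparse_domination TYPE('e::banach_lattice) \<mu> q C"
  shows "upper_estimate TYPE('e) q (2 * \<bar>C\<bar>)"
  unfolding upper_estimate_def
proof (intro allI impI)
  fix n and e :: "nat \<Rightarrow> 'e" assume e: "\<forall>i<n. 0 \<le> e i"
  show "norm (psup e {..<n}) \<le> 2 * \<bar>C\<bar> * (\<Sum>i<n. norm (e i) powr q) powr (1 / q)"
  proof (rule lq_bound_limit[OF q])
    fix \<epsilon> :: real assume \<epsilon>: "0 < \<epsilon>"
    define B where "B = (\<Sum>i<n. norm (e i))"
    have B: "0 \<le> B" by (simp add: B_def sum_nonneg)
    \<comment> \<open>The \<open>2\<close> guarantees that \<open>A k\<close> carries at least half
      of \<open>T k\<close>; the term \<open>B / \<epsilon>\<close> makes the earlier values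
      contribute at most \<open>\<epsilon>\<close> to the average over \<open>T k\<close>.\<close>
    define L where "L = 2 + B / \<epsilon>"
    have L: "2 \<le> L" "B / \<epsilon> \<le> L" "1 < L" using B \<epsilon> by (auto simp: L_def intro: add_pos_nonneg)
    obtain T :: "nat \<Rightarrow> (real ^ 'd) set" where T_dy: "\<And>k. T k \<in> dyadic_cubes" and T_pos: "\<And>k. 0 < measure \<mu> (T k)"
      and T_Suc: "\<And>k. T k \<subseteq> T (Suc k)" and T_L: "\<And>k. L * measure \<mu> (T k) \<le> measure \<mu> (T (Suc k))"
      using dyadic_chain[OF \<mu> inf L(3)] by blast
    have T_mono: "T k \<subseteq> T l" if "k \<le> l" for k l using T_Suc that by (rule lift_Suc_mono_le)
    have T_sets: "T k \<in> sets \<mu>" for k using dyadic_cube_borel[OF T_dy] \<mu>(1) by simp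
    have T_fin: "emeasure \<mu> (T k) < \<infinity>" for k
      using T_dy \<mu> by (intro locally_finite_bounded dyadic_cube_bounded) auto
    define A where "A = disjointed T"
    have A_sub: "A k \<subseteq> T k" for k unfolding A_def by (rule disjointed_subset)
    have A_sets: "A k \<in> sets \<mu>" for k
    proof -
      have "range (disjointed T) \<subseteq> sets \<mu>" using T_sets by (intro sets.range_disjointed_sets') auto
      thus ?thesis by (auto simp: A_def)
    qed
    have A_fin: "emeasure \<mu> (A k) < \<infinity>" for k
      using emeasure_mono[OF A_sub T_sets] T_fin by (rule le_less_trans)
    have A_disj: "A i \<inter> A j = {}" if "i \<noteq> j" for i j
      using disjoint_family_disjointed[of T] that by (auto simp: A_def disjoint_family_on_def)
    have T_A: "T k = (\<Union>i\<le>k. A i)" for k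
    proof -
      have "(\<Union>i\<in>{0..<Suc k}. A i) = (\<Union>i\<in>{0..<Suc k}. T i)"
        unfolding A_def by (rule finite_UN_disjointed_eq)
      moreover have "(\<Union>i\<in>{0..<Suc k}. T i) = T k" using T_mono by (auto simp: less_Suc_eq_le) blast+
      ultimately show ?thesis by (simp add: atLeast0LessThan lessThan_Suc_atMost)
    qed
    define f where "f = (\<lambda>x. \<Sum>i<n. indicator (A i) x *\<^sub>R e i)"
    have f_A: "f x = e i" if "x \<in> A i" "i < n" for x i
    proof -
      have "f x = (\<Sum>j<n. if j = i then e i else 0)"
        unfolding f_def using A_disj that(1) by (intro sum.cong) (auto simp: indicator_def)
      thus ?thesis using that(2) by simp
    qed
    have f_out: "f x = 0" if "\<And>i. i < n \<Longrightarrow> x \<notin> A i" for x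
      unfolding f_def using that by (intro sum.neutral) auto
    have restrict: "has_strong_integral \<mu> (\<lambda>x. indicator (T k) x *\<^sub>R h (f x)) (\<Sum>i\<le>k. measure \<mu> (A i) *\<^sub>R h (e i))"
      if k: "k < n" for k and h :: "'e \<Rightarrow> 'z::banach"
    proof -
      have "indicator (T k) x *\<^sub>R h (f x) = (\<Sum>i\<le>k. indicator (A i) x *\<^sub>R h (e i))" for x
      proof (cases "x \<in> T k")
        case True
        then obtain i where i: "i \<le> k" "x \<in> A i" using T_A by blast
        have "(\<Sum>j\<le>k. indicator (A j) x *\<^sub>R h (e j)) = (\<Sum>j\<le>k. if j = i then h (e i) else 0)"
          using A_disj i(2) by (intro sum.cong) (auto simp: indicator_def)
        thus ?thesis using True i f_A[OF i(2)] k by simp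
      next
        case False
        hence "(\<Sum>i\<le>k. indicator (A i) x *\<^sub>R h (e i)) = 0"
          unfolding T_A by (intro sum.neutral) auto
        thus ?thesis using False by simp
      qed
      moreover have "has_strong_integral \<mu> (\<lambda>x. \<Sum>i\<le>k. indicator (A i) x *\<^sub>R h (e i)) (\<Sum>i\<le>k. measure \<mu> (A i) *\<^sub>R h (e i))"
        by (intro has_strong_integral_sum has_strong_integral_indicator A_sets A_fin)
      ultimately show ?thesis by simp
    qed
    have "locally_integrable \<mu> f"
      unfolding locally_integrable_def strongly_integrable_def
    proof (intro allI impI)
      fix S :: "(real ^ 'd) set" assume "compact S"
      hence S: "S \<in> sets \<mu>" using \<mu>(1) by (simp add: borel_compact)
      have "indicator S x *\<^sub>R indicator (A i) x *\<^sub>R e i = indicator (S \<inter> A i) x *\<^sub>R e i" for x i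
        by (simp split: split_indicator)
      hence "(\<lambda>x. indicator S x *\<^sub>R f x) = (\<lambda>x. \<Sum>i<n. indicator (S \<inter> A i) x *\<^sub>R e i)"
        by (simp only: f_def scaleR_sum_right)
      moreover have "emeasure \<mu> (S \<inter> A i) < \<infinity>" for i
        using emeasure_mono[of "S \<inter> A i" "A i" \<mu>] A_sets A_fin le_less_trans by blast
      hence "has_strong_integral \<mu> (\<lambda>x. \<Sum>i<n. indicator (S \<inter> A i) x *\<^sub>R e i) (\<Sum>i<n. measure \<mu> (S \<inter> A i) *\<^sub>R e i)"
        by (intro has_strong_integral_sum has_strong_integral_indicator sets.Int S A_sets)
      ultimately show "\<exists>I. has_strong_integral \<mu> (\<lambda>x. indicator S x *\<^sub>R f x) I" by auto
    qed
    moreover define D where "D = T ` {..<n}"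
    have "D \<subseteq> dyadic_cubes" "finite D" using T_dy by (auto simp: D_def)
    ultimately obtain \<S> where \<S>: "\<S> \<subseteq> D"
      and ae: "AE x in \<mu>. norm (lattice_maximal \<mu> D f x) \<le> C * sparse_operator \<mu> q \<S> (\<lambda>y. norm (f y)) x"
      using sd unfolding sparse_domination_def by blast
    \<comment> \<open>One point of \<open>T 0\<close> is enough, since it lies in all cubes of the
      chain. It exists because \<open>T 0\<close> has positive measure.\<close>
    have "\<exists>x\<in>T 0. norm (lattice_maximal \<mu> D f x) \<le> C * sparse_operator \<mu> q \<S> (\<lambda>y. norm (f y)) x"
    proof (rule ccontr)
      assume "\<not> ?thesis"
      hence "AE x in \<mu>. x \<notin> T 0" using ae by (auto elim: eventually_mono)
      hence "emeasure \<mu> (T 0) = 0"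
        using AE_iff_null_sets[OF T_sets] by auto
      thus False using T_pos[of 0] by (simp add: measure_def)
    qed
    then obtain x where x: "x \<in> T 0" "norm (lattice_maximal \<mu> D f x) \<le> C * sparse_operator \<mu> q \<S> (\<lambda>y. norm (f y)) x"
      by blast
    have mA: "measure \<mu> (T k) \<le> 2 * measure \<mu> (A k)" for k
    proof (cases k)
      case 0
      have "A 0 = T 0" by (simp add: A_def disjointed_def)
      then show ?thesis using 0 by simp
    next
      case (Suc j)
      have "incseq T" using T_Suc by (rule incseq_SucI)
      from disjointed_mono[OF this] have "A k = T k - T j" by (simp add: A_def Suc)
      hence "measure \<mu> (A k) = measure \<mu> (T k) - measure \<mu> (T j)"
        using T_Suc[of j] T_sets T_fin by (simp add: Suc measure_Diff less_top)
      moreover have "2 * measure \<mu> (T j) \<le> L * measure \<mu> (T j)" using L by (intro mult_right_mono) auto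
      hence "2 * measure \<mu> (T j) \<le> measure \<mu> (T k)" using T_L[of j] by (simp add: Suc)
      ultimately show ?thesis by simp
    qed
    have abs_e: "\<bar>e i\<bar> = e i" if "i < n" for i using e that by simp
    have "(1 / 2) *\<^sub>R psup e {..<n} \<le> lattice_maximal \<mu> D f x"
    proof -
      let ?g = "\<lambda>Q. indicator Q x *\<^sub>R average \<mu> Q (\<lambda>y. \<bar>f y\<bar>)"
      have "psup (\<lambda>i. (1 / 2) *\<^sub>R e i) {..<n} \<le> psup ?g D"
      proof (rule psup_least)
        show "0 \<le> psup ?g D" by (intro psup_nonneg) (simp add: D_def)
        fix k assume "k \<in> {..<n}"
        hence k: "k < n" by simp
        have "(1 / 2) *\<^sub>R e k \<le> (measure \<mu> (A k) / measure \<mu> (T k)) *\<^sub>R e k"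
          using mA[of k] T_pos[of k] e k by (intro scaleR_right_mono) (auto simp: field_simps)
        also have "\<dots> = (1 / measure \<mu> (T k)) *\<^sub>R (measure \<mu> (A k) *\<^sub>R \<bar>e k\<bar>)" using k by (simp add: abs_e)
        also have "\<dots> \<le> (1 / measure \<mu> (T k)) *\<^sub>R (\<Sum>i\<le>k. measure \<mu> (A i) *\<^sub>R \<bar>e i\<bar>)"
          by (intro scaleR_left_mono, subst sum.remove[of _ k])
            (auto intro!: add_increasing2 sum_nonneg scaleR_nonneg_nonneg)
        also have "\<dots> = ?g (T k)"
          using T_mono[of 0 k] x(1) strong_integral_eq[OF restrict[OF k, of abs]]
          by (auto simp: average_def)
        also have "\<dots> \<le> psup ?g D" using k by (intro psup_upper) (auto simp: D_def)
        finally show "(1 / 2) *\<^sub>R e k \<le> psup ?g D" .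
      qed auto
      moreover have "psup (\<lambda>i. (1 / 2) *\<^sub>R e i) {..<n} = (1 / 2) *\<^sub>R psup e {..<n}"
        by (intro psup_scaleR) auto
      moreover have "lattice_maximal \<mu> D f x = psup ?g D" by (simp add: lattice_maximal_def psup_def)
      ultimately show ?thesis by simp
    qed
    hence "norm ((1 / 2) *\<^sub>R psup e {..<n}) \<le> norm (lattice_maximal \<mu> D f x)"
      by (intro norm_mono_nonneg scaleR_nonneg_nonneg psup_nonneg) auto
    also have "\<dots> \<le> C * sparse_operator \<mu> q \<S> (\<lambda>y. norm (f y)) x" by (rule x(2))
    also have "\<dots> \<le> \<bar>C\<bar> * (\<Sum>i<n. (norm (e i) + \<epsilon>) powr q) powr (1 / q)"
    proof (rule mult_mono)
      define a where "a = (\<lambda>Q. average \<mu> Q (\<lambda>y. \<bar>norm (f y)\<bar>))"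
      have a: "0 \<le> a (T k)" "a (T k) \<le> norm (e k) + \<epsilon>" if k: "k < n" for k
      proof -
        have a_eq: "a (T k) = (\<Sum>i\<le>k. measure \<mu> (A i) * norm (e i)) / measure \<mu> (T k)"
          using strong_integral_eq[OF restrict[OF k, of norm]] by (simp add: a_def average_def)
        thus "0 \<le> a (T k)" by (simp add: sum_nonneg)
        have small: "(\<Sum>i<k. measure \<mu> (A i) * norm (e i)) \<le> \<epsilon> * measure \<mu> (T k)"
        proof (cases k)
          case (Suc j)
          have "(\<Sum>i<k. measure \<mu> (A i) * norm (e i)) \<le> (\<Sum>i<k. measure \<mu> (T j) * norm (e i))"
          proof (intro sum_mono mult_right_mono)
            fix i assume "i \<in> {..<k}"
            hence "A i \<subseteq> T j" using A_sub[of i] T_mono[of i j] Suc by auto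
            hence "emeasure \<mu> (A i) \<le> emeasure \<mu> (T j)" using T_sets by (intro emeasure_mono)
            thus "measure \<mu> (A i) \<le> measure \<mu> (T j)"
              using T_fin[of j] by (simp add: measure_def enn2real_mono)
          qed auto
          also have "\<dots> \<le> measure \<mu> (T j) * B"
            unfolding sum_distrib_left[symmetric] B_def using k by (intro mult_left_mono sum_mono2) auto
          also have "B \<le> \<epsilon> * L" using L(2) \<epsilon> by (simp add: field_simps)
          hence "measure \<mu> (T j) * B \<le> \<epsilon> * (L * measure \<mu> (T j))"
            using mult_left_mono[of B "\<epsilon> * L" "measure \<mu> (T j)"] by (simp add: mult_ac)
          also have "\<dots> \<le> \<epsilon> * measure \<mu> (T k)" using T_L[of j] \<epsilon> Suc by (intro mult_left_mono) auto
          finally show ?thesis .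
        qed (use \<epsilon> in simp)
        have "emeasure \<mu> (A k) \<le> emeasure \<mu> (T k)" by (intro emeasure_mono A_sub T_sets)
        hence "measure \<mu> (A k) \<le> measure \<mu> (T k)" using T_fin[of k] by (simp add: measure_def enn2real_mono)
        hence "(\<Sum>i\<le>k. measure \<mu> (A i) * norm (e i)) \<le> \<epsilon> * measure \<mu> (T k) + measure \<mu> (T k) * norm (e k)"
          unfolding lessThan_Suc_atMost[symmetric] sum.lessThan_Suc
          by (intro add_mono small mult_right_mono) auto
        thus "a (T k) \<le> norm (e k) + \<epsilon>"
          unfolding a_eq using T_pos[of k] by (simp add: divide_le_eq algebra_simps)
      qed
      have "(\<Sum>S\<in>\<S>. a S powr q * indicator S x) \<le> (\<Sum>S\<in>\<S>. a S powr q)"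
        by (intro sum_mono) (auto split: split_indicator)
      also have "\<dots> \<le> (\<Sum>S\<in>D. a S powr q)" using \<S> by (intro sum_mono2) (auto simp: D_def)
      also have "\<dots> \<le> (\<Sum>k<n. a (T k) powr q)"
        unfolding D_def using sum_image_le[of "{..<n}" "\<lambda>S. a S powr q" T] by (simp add: comp_def)
      also have "\<dots> \<le> (\<Sum>k<n. (norm (e k) + \<epsilon>) powr q)"
        using a q by (intro sum_mono powr_mono2) auto
      finally show "sparse_operator \<mu> q \<S> (\<lambda>y. norm (f y)) x \<le> (\<Sum>i<n. (norm (e i) + \<epsilon>) powr q) powr (1 / q)"
        unfolding sparse_operator_def a_def using q
        by (intro powr_mono2) (auto intro!: sum_nonneg)
    qed (auto simp: sparse_operator_def)
    finally show "norm (psup e {..<n}) \<le> 2 * \<bar>C\<bar> * (\<Sum>i<n. (norm (e i) + \<epsilon>) powr q) powr (1 / q)"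
      by simp
  qed auto
qed

theorem corollary1p4:
  assumes "hardy_littlewood_property TYPE('e::banach_lattice) TYPE('d::finite)"
  shows "\<exists>C :: real \<Rightarrow> real. \<forall>\<mu> :: (real ^ 'd) measure.
           sets \<mu> = sets borel \<longrightarrow> locally_finite_measure \<mu> \<longrightarrow> emeasure \<mu> UNIV = \<infinity> \<longrightarrow>
             (\<forall>q. 1 \<le> q \<and> ereal q < convexity_exponent TYPE('e) \<longrightarrow>
                sparse_domination TYPE('e) \<mu> q (C q)) \<and>
             (\<forall>q. convexity_exponent TYPE('e) < ereal q \<longrightarrow>
                \<not> (\<exists>C'. sparse_domination TYPE('e) \<mu> q C'))"
proof -
  obtain p K where "dyadic_maximal_bound TYPE('e) p K"
    using dyadic_maximal_bound_of_hardy_littlewood[OF assms] by blast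
  then interpret dyadic_maximal_bound "TYPE('e)" p K .
  have le_exponent: "ereal q \<le> convexity_exponent TYPE('e)"
    if "upper_estimate TYPE('e) r C" "1 < q" "q < r" for q r C
    unfolding convexity_exponent_def
    using q_convex_of_upper_estimate[OF that(1), of q] that by (intro SUP_upper) auto
  \<comment> \<open>Convexity is available for exponents below \<open>r\<close> only; the supremum
    recovers \<open>r\<close> itself.\<close>
  have exponent_ge: "ereal r \<le> convexity_exponent TYPE('e)"
    if U: "upper_estimate TYPE('e) r C" and r: "1 < r" for r C
  proof (rule dense_le_bounded[of "ereal 1"])
    fix x assume x: "ereal 1 < x" "x < ereal r"
    then obtain q where "x = ereal q" by (cases x) auto
    thus "x \<le> convexity_exponent TYPE('e)" using le_exponent[OF U] x by auto
  qed (use r in simp)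
  obtain r0 C0 where r0: "1 < r0" "upper_estimate TYPE('e) r0 C0"
    using exists_upper_estimate by blast
  have "ereal 1 < ereal r0" using r0 by simp
  also have "\<dots> \<le> convexity_exponent TYPE('e)" by (rule exponent_ge[OF r0(2,1)])
  \<comment> \<open>Ensures that an exponent above the critical one exceeds \<open>1\<close>, as
    \<open>exponent_ge\<close> requires.\<close>
  finally have exponent_gt: "ereal 1 < convexity_exponent TYPE('e)" .
  \<comment> \<open>The choice depends on the lattice and on \<open>q\<close> alone and is made
    before the measure is given.\<close>
  define C where "C = (\<lambda>q. \<bar>SOME c. upper_estimate TYPE('e) q c\<bar> * (8 * (K + 1)))"
  show ?thesis
  proof (intro exI[of _ C] allI impI conjI)
    fix \<mu> :: "(real ^ 'd) measure" and q
    assume \<mu>: "sets \<mu> = sets borel" "locally_finite_measure \<mu>" "emeasure \<mu> UNIV = \<infinity>"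
    {
      assume q: "1 \<le> q \<and> ereal q < convexity_exponent TYPE('e)"
      then obtain r where r: "1 < r" "q_convex TYPE('e) r" "q < r"
        unfolding convexity_exponent_def less_SUP_iff by auto
      obtain c where "upper_estimate TYPE('e) r c"
        using upper_estimate_of_q_convex[OF r(2)] r(1) by auto
      hence "\<exists>c. upper_estimate TYPE('e) q c"
        using upper_estimate_mono q r(3) less_imp_le by blast
      hence "upper_estimate TYPE('e) q (SOME c. upper_estimate TYPE('e) q c)" by (rule someI_ex)
      thus "sparse_domination TYPE('e) \<mu> q (C q)"
        unfolding C_def using sparse_domination_of_upper_estimate[OF \<mu>(1,2)] q by blast
    next
      assume q: "convexity_exponent TYPE('e) < ereal q"
      hence "1 < q" using exponent_gt less_trans by fastforce
      show "\<nexists>C'. sparse_domination TYPE('e) \<mu> q C'"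
      proof
        assume "\<exists>C'. sparse_domination TYPE('e) \<mu> q C'"
        then obtain C' where "sparse_domination TYPE('e) \<mu> q C'" ..
        moreover have "0 < q" using \<open>1 < q\<close> by simp
        ultimately have "upper_estimate TYPE('e) q (2 * \<bar>C'\<bar>)"
          by (intro upper_estimate_of_sparse_domination[OF \<mu>])
        from exponent_ge[OF this \<open>1 < q\<close>] show False using q by simp
      qed
    }
  qed
qed

end
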